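(* Let $K$ be a field containing a primitive $4$th root of unity, let $G$ be a finite group, let $L/K$ be a $G$-Galois field extension, let $S$ be a Sylow $2$-subgroup of $G$, and let $r$ be the Frattini rank of $S$. Then the trace form $q_{L/K}$ is Witt-equivalent to the scaled Pfister form $\langle |S| \rangle \otimes \langle\langle a_1, \dots, a_r \rangle\rangle$ for some $a_1, \dots, a_r \in K^*$.
   Context: A $G$-Galois extension $L/K$ is a finite Galois field extension with $\mathrm{Gal}(L/K) \simeq G$. The trace form of a finite separable field extension $L/K$ is the non-degenerate quadratic form $q_{L/K}\colon x \mapsto \mathrm{tr}_{L/K}(x^2)$ on the $K$-vector space $L$. (A field containing a primitive $4$th root of unity has characteristic $\neq 2$.) $\langle c_1,\dots,c_n\rangle$ denotes the diagonal quadratic form $c_1x_1^2+\dots+c_nx_n^2$, and $\langle\langle a_1,\dots,a_n\rangle\rangle = \bigotimes_{i=1}^n \langle 1, -a_i\rangle$ denotes an $n$-fold Pfister form (for $n=0$ this is $\langle 1\rangle$). Two non-degenerate forms are Witt-equivalent if they have the same class in the Witt ring $W(K)$. For a finite $2$-group $S$, $S^2$ denotes the subgroup generated by all squares $g^2$, $g \in S$; it equals the Frattini subgroup $\mathrm{Fr}(S)$. The Frattini rank of $S$ is the rank $r$ of the elementary abelian group $S/S^2 \simeq (\mathbb{Z}/2)^r$. *)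

theory Defs
  imports
    "HOL-Algebra.Coset"
    "HOL-Algebra.Generated_Groups"
    "HOL-Algebra.Elementary_Groups"
    "HOL-Algebra.Product_Groups"
    "HOL-Computational_Algebra.Primes"
    "HOL-Library.Function_Algebras"
    "HOL-Library.Product_Plus"
    "Jordan_Normal_Form.Matrix"
begin

section \<open>Roots of unity and finite groups\<close>

definition primitive_root_of_unity :: "nat \<Rightarrow> 'k::field \<Rightarrow> bool" where
  "primitive_root_of_unity n \<zeta> \<longleftrightarrow> n > 0 \<and> \<zeta> ^ n = 1 \<and> (\<forall>m. 0 < m \<and> m < n \<longrightarrow> \<zeta> ^ m \<noteq> 1)"

definition sylow_subgroup :: "nat \<Rightarrow> ('g, 'm) monoid_scheme \<Rightarrow> 'g set \<Rightarrow> bool" where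
  "sylow_subgroup p G S \<longleftrightarrow> subgroup S G \<and> card S = p ^ multiplicity p (order G)"

definition square_subgroup :: "('g, 'm) monoid_scheme \<Rightarrow> 'g set" where
  "square_subgroup S = generate S {g [^]\<^bsub>S\<^esub> (2::nat) | g. g \<in> carrier S}"

definition has_frattini_rank :: "('g, 'm) monoid_scheme \<Rightarrow> nat \<Rightarrow> bool" where
  "has_frattini_rank S r \<longleftrightarrow>
     S Mod square_subgroup S \<cong> product_group {..<r} (\<lambda>_. integer_mod_group 2)"


section \<open>Field extensions\<close>

text \<open>
  A field extension L/K is given by a homomorphism \<open>\<iota>\<close> of the field K (the type \<open>'k\<close>)
  into the field L (the type \<open>'l\<close>).
\<close>

definition ext_scale :: "('k::field \<Rightarrow> 'l::field) \<Rightarrow> 'k \<Rightarrow> 'l \<Rightarrow> 'l" where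
  "ext_scale \<iota> c x = \<iota> c * x"

definition finite_extension :: "('k::field \<Rightarrow> 'l::field) \<Rightarrow> bool" where
  "finite_extension \<iota> \<longleftrightarrow> field_hom \<iota> \<and> (\<exists>B. finite B \<and> module.span (ext_scale \<iota>) B = UNIV)"

definition galois_group :: "('k::field \<Rightarrow> 'l::field) \<Rightarrow> ('l \<Rightarrow> 'l) monoid" where
  "galois_group \<iota> =
     \<lparr>carrier = {\<sigma>. field_isom \<sigma> \<and> (\<forall>c. \<sigma> (\<iota> c) = \<iota> c)}, monoid.mult = (\<circ>), one = id\<rparr>"

text \<open>
  A finite extension is Galois if K is the fixed field of the group of K-automorphisms of L.
\<close>

definition finite_galois_extension :: "('k::field \<Rightarrow> 'l::field) \<Rightarrow> bool" where
  "finite_galois_extension \<iota> \<longleftrightarrow>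
     finite_extension \<iota> \<and> {x. \<forall>\<sigma>\<in>carrier (galois_group \<iota>). \<sigma> x = x} = range \<iota>"

definition G_galois_extension :: "('g, 'm) monoid_scheme \<Rightarrow> ('k::field \<Rightarrow> 'l::field) \<Rightarrow> bool" where
  "G_galois_extension G \<iota> \<longleftrightarrow> finite_galois_extension \<iota> \<and> galois_group \<iota> \<cong> G"

text \<open>
  The trace of the K-linear endomorphism \<open>y \<mapsto> x * y\<close> of L, computed in some K-basis of L
  (\<open>extend_basis {}\<close> is an arbitrary basis).
\<close>

definition ext_trace :: "('k::field \<Rightarrow> 'l::field) \<Rightarrow> 'l \<Rightarrow> 'k" where
  "ext_trace \<iota> x =
     (let B = vector_space.extend_basis (ext_scale \<iota>) {}
      in \<Sum>b\<in>B. module.representation (ext_scale \<iota>) B (x * b) b)"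


section \<open>Quadratic forms\<close>

text \<open>
  The underlying vector space of a quadratic form is a subspace of a vector space that fills its
  type; this is what makes spaces such as \<open>K\<^sup>n\<close> with variable \<open>n\<close> available.
\<close>

record ('k, 'v) quad_form =
  qf_space :: "'v set"
  qf_scale :: "'k \<Rightarrow> 'v \<Rightarrow> 'v"
  qf_form :: "'v \<Rightarrow> 'k"

definition polar_form :: "('k::field, 'v::ab_group_add) quad_form \<Rightarrow> 'v \<Rightarrow> 'v \<Rightarrow> 'k" where
  "polar_form Q x y = qf_form Q (x + y) - qf_form Q x - qf_form Q y"

definition quadratic_form :: "('k::field, 'v::ab_group_add) quad_form \<Rightarrow> bool" where
  "quadratic_form Q \<longleftrightarrow>
     vector_space (qf_scale Q) \<and>
     (\<exists>B. finite B \<and> module.span (qf_scale Q) B = qf_space Q) \<and>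
     (\<forall>c. \<forall>x\<in>qf_space Q. qf_form Q (qf_scale Q c x) = c\<^sup>2 * qf_form Q x) \<and>
     (\<forall>x\<in>qf_space Q. \<forall>y\<in>qf_space Q. \<forall>z\<in>qf_space Q.
        polar_form Q (x + y) z = polar_form Q x z + polar_form Q y z) \<and>
     (\<forall>c. \<forall>x\<in>qf_space Q. \<forall>z\<in>qf_space Q.
        polar_form Q (qf_scale Q c x) z = c * polar_form Q x z)"

text \<open>
  In characteristic different from 2 the polar form is twice the symmetric bilinear form
  attached to the quadratic form, so both have the same radical.
\<close>

definition nondegenerate_form :: "('k::field, 'v::ab_group_add) quad_form \<Rightarrow> bool" where
  "nondegenerate_form Q \<longleftrightarrow>
     quadratic_form Q \<and>
     (\<forall>x\<in>qf_space Q. (\<forall>y\<in>qf_space Q. polar_form Q x y = 0) \<longrightarrow> x = 0)"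

definition isometric ::
  "('k::field, 'v::ab_group_add) quad_form \<Rightarrow> ('k, 'w::ab_group_add) quad_form \<Rightarrow> bool" where
  "isometric Q R \<longleftrightarrow>
     (\<exists>f. bij_betw f (qf_space Q) (qf_space R) \<and>
          (\<forall>x\<in>qf_space Q. \<forall>y\<in>qf_space Q. f (x + y) = f x + f y) \<and>
          (\<forall>c. \<forall>x\<in>qf_space Q. f (qf_scale Q c x) = qf_scale R c (f x)) \<and>
          (\<forall>x\<in>qf_space Q. qf_form R (f x) = qf_form Q x))"

definition orthogonal_sum ::
  "('k::field, 'v::ab_group_add) quad_form \<Rightarrow> ('k, 'w::ab_group_add) quad_form
    \<Rightarrow> ('k, 'v \<times> 'w) quad_form" where
  "orthogonal_sum Q R =
     \<lparr>qf_space = qf_space Q \<times> qf_space R,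
      qf_scale = (\<lambda>c (x, y). (qf_scale Q c x, qf_scale R c y)),
      qf_form = (\<lambda>(x, y). qf_form Q x + qf_form R y)\<rparr>"

text \<open>\<open>K\<^sup>n\<close> is the space of functions \<open>nat \<Rightarrow> 'k\<close> vanishing outside \<open>{..<n}\<close>.\<close>

definition diag_form :: "'k::field list \<Rightarrow> ('k, nat \<Rightarrow> 'k) quad_form" where
  "diag_form cs =
     \<lparr>qf_space = {x. \<forall>i\<ge>length cs. x i = 0},
      qf_scale = (\<lambda>c x i. c * x i),
      qf_form = (\<lambda>x. \<Sum>i<length cs. cs ! i * (x i)\<^sup>2)\<rparr>"

text \<open>\<open>hyperbolic_form m\<close> is the orthogonal sum of \<open>m\<close> hyperbolic planes \<open>\<langle>1, -1\<rangle>\<close>.\<close>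

definition hyperbolic_form :: "nat \<Rightarrow> ('k::field, nat \<Rightarrow> 'k) quad_form" where
  "hyperbolic_form m = diag_form (concat (replicate m [1, -1]))"

text \<open>
  Two non-degenerate forms have the same class in the Witt ring iff they become isometric after
  adding hyperbolic planes to both of them.  As usual, this is meant in characteristic
  different from 2.
\<close>

definition witt_equivalent ::
  "('k::field, 'v::ab_group_add) quad_form \<Rightarrow> ('k, 'w::ab_group_add) quad_form \<Rightarrow> bool" where
  "witt_equivalent Q R \<longleftrightarrow>
     nondegenerate_form Q \<and> nondegenerate_form R \<and>
     (\<exists>m n. isometric (orthogonal_sum Q (hyperbolic_form m)) (orthogonal_sum R (hyperbolic_form n)))"

text \<open>
  Diagonal forms are tensored on the level of their coefficients:
  \<open>\<langle>c\<^sub>1,\<dots>,c\<^sub>m\<rangle> \<otimes> \<langle>d\<^sub>1,\<dots>,d\<^sub>n\<rangle>\<close> is the diagonal form with the coefficients \<open>c\<^sub>i * d\<^sub>j\<close>.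
\<close>

definition diag_tensor :: "'k::field list \<Rightarrow> 'k list \<Rightarrow> 'k list" where
  "diag_tensor cs ds = [c * d. c \<leftarrow> cs, d \<leftarrow> ds]"

primrec pfister :: "'k::field list \<Rightarrow> 'k list" where
  "pfister [] = [1]"
| "pfister (a # as) = diag_tensor [1, - a] (pfister as)"

definition trace_form :: "('k::field \<Rightarrow> 'l::field) \<Rightarrow> ('k, 'l) quad_form" where
  "trace_form \<iota> =
     \<lparr>qf_space = UNIV, qf_scale = ext_scale \<iota>, qf_form = (\<lambda>x. ext_trace \<iota> (x\<^sup>2))\<rparr>"

end

theory Submission
  imports
    Defs
    "HOL-Combinatorics.Permutations"
    "HOL-Computational_Algebra.Polynomial_Factorial"
    "HOL-Algebra.Group_Action"
    "HOL-Algebra.Multiplicative_Group"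
    "Subresultants.More_Homomorphisms"
begin

text \<open>
  Write \<open>q\<close> for the trace form of \<open>L/K\<close>, \<open>S\<close> for the Sylow subgroup, \<open>K' = L\<^sup>S\<close> for its fixed
  field and \<open>\<Phi>\<close> for the subgroup generated by the squares of \<open>S\<close>.  As \<open>-1\<close> is a square in \<open>K\<close>,
  signs in diagonal forms do not matter and \<open>\<phi> \<bottom> \<phi>\<close> is always hyperbolic.  The trace of \<open>x\<close> is
  \<open>\<Sum>\<^sub>g g x\<close> (\<open>ext_trace_eq\<close>), so Galois groups act by isometries.  The proof determines the
  form over \<open>K'\<close> first and then descends to \<open>K\<close>.

  The form of \<open>L/K'\<close>.  If an isometry \<open>h\<close> of a space satisfies \<open>h\<^sup>2 = - 1\<close>, then \<open>x\<close> and \<open>h x\<close> are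
  orthogonal of equal length, so the space is an orthogonal sum of hyperbolic planes \<open>\<langle>a, a\<rangle>\<close>.  Let
  \<open>N\<close> be a normal subgroup of \<open>S\<close> properly contained in \<open>\<Phi>\<close>.  The quotient \<open>S/N\<close> contains a central
  involution \<open>z\<close> that is a square or a commutator, and the part of \<open>L\<^sup>N\<close> on which \<open>z\<close> acts as \<open>- 1\<close> is
  hyperbolic: for a square by the remark above, for a commutator \<open>[x, y]\<close> because \<open>x\<^sup>2\<close> and
  \<open>y\<^sup>2\<close> act trivially on the complement of a hyperbolic space, where thus \<open>(x y)\<^sup>2 = - 1\<close>
  (\<open>hyp_of_commutator\<close>).  Iterating, \<open>L\<close> and \<open>L\<^sup>\<Phi>\<close> have Witt equivalent forms
  (\<open>reduces_Frattini\<close>).  As \<open>L\<^sup>\<Phi> = K'(\<surd>b\<^sub>1, \<dots>, \<surd>b\<^sub>r)\<close>, the products of the square roots form an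
  orthogonal basis showing that the form of \<open>L\<^sup>\<Phi>\<close> is \<open>\<langle>|S|\<rangle> \<otimes> \<langle>\<langle>b\<^sub>1, \<dots>, b\<^sub>r\<rangle>\<rangle>\<close>
  (\<open>has_type_Frattini\<close>).

  Passage to \<open>K\<close>.  Over \<open>K'\<close> the form \<open>q\<close> becomes the orthogonal sum of \<open>[G : S]\<close> copies of the form
  of \<open>L/K'\<close> (\<open>trace_form_base_change\<close>), one for each coset of \<open>S\<close>.  This number is odd, so \<open>q\<close> is Witt
  equivalent over \<open>K'\<close> to the form above.  By Springer's theorem an anisotropic form over \<open>K\<close> stays
  anisotropic over \<open>K'\<close> (\<open>Springer_fixed_field\<close>), so every element of \<open>K\<close> represented over \<open>K'\<close> by an
  anisotropic form over \<open>K\<close> is represented over \<open>K\<close>.  Combined with the pure subform theorem for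
  Pfister forms (\<open>pure_subform\<close>) and Witt cancellation, this allows all the slots \<open>b\<^sub>i\<close> to be
  replaced by elements of \<open>K\<close>, one after another (\<open>Pfister_descent\<close>).

  Since \<open>K'\<close> is only a subset of the field \<open>L\<close>, forms are treated over a subfield \<open>F\<close> of a field type
  throughout; a diagonal form is the list of its coefficients.
\<close>

section \<open>Diagonal forms over a subfield\<close>

locale coeff_field =
  fixes F :: "'f::field set"
  assumes zero_mem [simp]: "0 \<in> F" and one_mem [simp]: "1 \<in> F"
    and add_mem [simp]: "x \<in> F \<Longrightarrow> y \<in> F \<Longrightarrow> x + y \<in> F"
    and mult_mem [simp]: "x \<in> F \<Longrightarrow> y \<in> F \<Longrightarrow> x * y \<in> F"
    and uminus_mem [simp]: "x \<in> F \<Longrightarrow> - x \<in> F"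
    and inverse_mem [simp]: "x \<in> F \<Longrightarrow> inverse x \<in> F"
begin

lemma diff_mem [simp]: "x \<in> F \<Longrightarrow> y \<in> F \<Longrightarrow> x - y \<in> F"
  using add_mem[of x "- y"] by simp

lemma divide_mem [simp]: "x \<in> F \<Longrightarrow> y \<in> F \<Longrightarrow> x / y \<in> F"
  by (simp add: divide_inverse)

lemma power_mem [simp]: "x \<in> F \<Longrightarrow> x ^ n \<in> F"
  by (induction n) auto

lemma sum_mem: "(\<And>i. i \<in> A \<Longrightarrow> f i \<in> F) \<Longrightarrow> sum f A \<in> F"
  by (induction A rule: infinite_finite_induct) auto

lemma of_nat_mem [simp]: "of_nat n \<in> F"
  by (induction n) auto

lemma numeral_mem [simp]: "numeral n \<in> F"
  using of_nat_mem[of "numeral n"] by simp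

end

definition vecs :: "'f::field set \<Rightarrow> nat \<Rightarrow> (nat \<Rightarrow> 'f) set" where
  "vecs F n = {x. (\<forall>i. x i \<in> F) \<and> (\<forall>i\<ge>n. x i = 0)}"

definition qval :: "'f::field list \<Rightarrow> (nat \<Rightarrow> 'f) \<Rightarrow> 'f" where
  "qval cs x = (\<Sum>i<length cs. cs ! i * (x i)\<^sup>2)"

definition isom_map :: "'f::field set \<Rightarrow> 'f list \<Rightarrow> 'f list \<Rightarrow> ((nat \<Rightarrow> 'f) \<Rightarrow> (nat \<Rightarrow> 'f)) \<Rightarrow> bool" where
  "isom_map F cs ds f \<longleftrightarrow>
     bij_betw f (vecs F (length cs)) (vecs F (length ds)) \<and>
     (\<forall>x\<in>vecs F (length cs). \<forall>y\<in>vecs F (length cs). f (\<lambda>i. x i + y i) = (\<lambda>i. f x i + f y i)) \<and>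
     (\<forall>c\<in>F. \<forall>x\<in>vecs F (length cs). f (\<lambda>i. c * x i) = (\<lambda>i. c * f x i)) \<and>
     (\<forall>x\<in>vecs F (length cs). qval ds (f x) = qval cs x)"

definition isom :: "'f::field set \<Rightarrow> 'f list \<Rightarrow> 'f list \<Rightarrow> bool" where
  "isom F cs ds \<longleftrightarrow> (\<exists>f. isom_map F cs ds f)"

definition vjoin :: "nat \<Rightarrow> (nat \<Rightarrow> 'f) \<Rightarrow> (nat \<Rightarrow> 'f) \<Rightarrow> nat \<Rightarrow> 'f::field" where
  "vjoin n x y = (\<lambda>i. if i < n then x i else y (i - n))"

definition vtake :: "nat \<Rightarrow> (nat \<Rightarrow> 'f) \<Rightarrow> nat \<Rightarrow> 'f::field" where
  "vtake n x = (\<lambda>i. if i < n then x i else 0)"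

definition vdrop :: "nat \<Rightarrow> (nat \<Rightarrow> 'f) \<Rightarrow> nat \<Rightarrow> 'f::field" where
  "vdrop n x = (\<lambda>i. x (n + i))"

lemma qval_Nil [simp]: "qval [] x = 0"
  by (simp add: qval_def)

lemma qval_Cons: "qval (c # cs) x = c * (x 0)\<^sup>2 + qval cs (vdrop 1 x)"
  by (simp add: qval_def sum.lessThan_Suc_shift vdrop_def del: sum.lessThan_Suc)

lemma qval_append: "qval (cs @ ds) x = qval cs x + qval ds (vdrop (length cs) x)"
proof (induction cs arbitrary: x)
  case (Cons c cs)
  have "vdrop (length cs) (vdrop 1 x) = vdrop (length (c # cs)) x"
    by (simp add: vdrop_def)
  then show ?case using Cons by (simp add: qval_Cons)
qed (simp add: vdrop_def)

lemma qval_cong: "(\<And>i. i < length cs \<Longrightarrow> x i = y i) \<Longrightarrow> qval cs x = qval cs y"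
  by (auto simp: qval_def intro!: sum.cong)

lemma isom_mapI:
  assumes "\<And>x. x \<in> vecs F (length cs) \<Longrightarrow> f x \<in> vecs F (length ds)"
    "\<And>y. y \<in> vecs F (length ds) \<Longrightarrow> g y \<in> vecs F (length cs)"
    "\<And>x. x \<in> vecs F (length cs) \<Longrightarrow> g (f x) = x"
    "\<And>y. y \<in> vecs F (length ds) \<Longrightarrow> f (g y) = y"
    "\<And>x y. x \<in> vecs F (length cs) \<Longrightarrow> y \<in> vecs F (length cs) \<Longrightarrow> f (\<lambda>i. x i + y i) = (\<lambda>i. f x i + f y i)"
    "\<And>c x. c \<in> F \<Longrightarrow> x \<in> vecs F (length cs) \<Longrightarrow> f (\<lambda>i. c * x i) = (\<lambda>i. c * f x i)"
    "\<And>x. x \<in> vecs F (length cs) \<Longrightarrow> qval ds (f x) = qval cs x"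
  shows "isom_map F cs ds f"
  using assms unfolding isom_map_def by (auto intro!: bij_betw_byWitness[where f' = g])

lemmas isomI = isom_mapI[THEN exI[of "isom_map F cs ds" f for F cs ds f], folded isom_def]

lemma isom_refl [simp]: "isom F cs cs"
  by (rule isomI[where f = id and g = id]) auto

lemma isom_map_comp: "isom_map F as bs f \<Longrightarrow> isom_map F bs cs g \<Longrightarrow> isom_map F as cs (g \<circ> f)"
proof -
  assume f: "isom_map F as bs f" and g: "isom_map F bs cs g"
  have fm: "f x \<in> vecs F (length bs)" if "x \<in> vecs F (length as)" for x
    using f that unfolding isom_map_def bij_betw_def by auto
  show "isom_map F as cs (g \<circ> f)"
    using f g fm unfolding isom_map_def by (auto intro: bij_betw_trans)
qed

lemma isom_trans [trans]: "isom F as bs \<Longrightarrow> isom F bs cs \<Longrightarrow> isom F as cs"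
  unfolding isom_def using isom_map_comp by blast

context coeff_field
begin

lemma vecs_add [simp]: "x \<in> vecs F n \<Longrightarrow> y \<in> vecs F n \<Longrightarrow> (\<lambda>i. x i + y i) \<in> vecs F n"
  by (auto simp: vecs_def)

lemma vecs_scale [simp]: "c \<in> F \<Longrightarrow> x \<in> vecs F n \<Longrightarrow> (\<lambda>i. c * x i) \<in> vecs F n"
  by (auto simp: vecs_def)

lemma vecs_zero [simp]: "(\<lambda>i. 0) \<in> vecs F n"
  by (auto simp: vecs_def)

lemma vtake_mem [simp]: "x \<in> vecs F m \<Longrightarrow> vtake n x \<in> vecs F n"
  by (auto simp: vecs_def vtake_def)

lemma vdrop_mem [simp]: "x \<in> vecs F (n + m) \<Longrightarrow> vdrop n x \<in> vecs F m"
  by (auto simp: vecs_def vdrop_def)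

lemma vdrop1_mem [simp]: "x \<in> vecs F (Suc m) \<Longrightarrow> vdrop (Suc 0) x \<in> vecs F m"
  using vdrop_mem[of x 1 m] by simp

lemma vjoin_mem [simp]: "x \<in> vecs F n \<Longrightarrow> y \<in> vecs F m \<Longrightarrow> vjoin n x y \<in> vecs F (n + m)"
  by (auto simp: vecs_def vjoin_def)

lemma vjoin_take_drop [simp]: "vjoin n (vtake n x) (vdrop n x) = x"
  by (auto simp: vjoin_def vtake_def vdrop_def)

lemma vtake_join [simp]: "x \<in> vecs F n \<Longrightarrow> vtake n (vjoin n x y) = x"
  by (auto simp: vjoin_def vtake_def vecs_def fun_eq_iff)

lemma vdrop_join [simp]: "vdrop n (vjoin n x y) = y"
  by (auto simp: vjoin_def vdrop_def)

lemma qval_take [simp]: "qval cs (vtake (length cs) x) = qval cs x"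
  by (rule qval_cong) (simp add: vtake_def)

lemma qval_join [simp]: "x \<in> vecs F (length cs) \<Longrightarrow> qval (cs @ ds) (vjoin (length cs) x y) = qval cs x + qval ds y"
  unfolding qval_append vdrop_join by (metis qval_take vtake_join)

lemma isomE:
  assumes "isom F cs ds"
  obtains f g where "isom_map F cs ds f" "isom_map F ds cs g"
    "\<And>x. x \<in> vecs F (length cs) \<Longrightarrow> f x \<in> vecs F (length ds)"
    "\<And>y. y \<in> vecs F (length ds) \<Longrightarrow> g y \<in> vecs F (length cs)"
    "\<And>x. x \<in> vecs F (length cs) \<Longrightarrow> g (f x) = x"
    "\<And>y. y \<in> vecs F (length ds) \<Longrightarrow> f (g y) = y"
proof -
  let ?V = "vecs F (length cs)" and ?W = "vecs F (length ds)"
  obtain f where f: "isom_map F cs ds f" using assms by (auto simp: isom_def)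
  then have bij: "bij_betw f ?V ?W" by (auto simp: isom_map_def)
  let ?g = "inv_into ?V f"
  have gm: "?g y \<in> ?V" "f (?g y) = y" if "y \<in> ?W" for y
    using bij that by (auto simp: bij_betw_def inv_into_into f_inv_into_f)
  have eq: "?g (f x) = x" if "x \<in> ?V" for x using bij that by (auto simp: bij_betw_def)
  have fm: "f x \<in> ?W" if "x \<in> ?V" for x using bij that by (auto simp: bij_betw_def)
  have "isom_map F ds cs ?g"
  proof (rule isom_mapI[where g = f])
    fix x y assume xy: "x \<in> ?W" "y \<in> ?W"
    have "f (\<lambda>i. ?g x i + ?g y i) = (\<lambda>i. x i + y i)"
      using f gm xy by (auto simp: isom_map_def)
    then show "?g (\<lambda>i. x i + y i) = (\<lambda>i. ?g x i + ?g y i)"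
      using eq[of "\<lambda>i. ?g x i + ?g y i"] gm xy by simp
  next
    fix c x assume xy: "c \<in> F" "x \<in> ?W"
    have "f (\<lambda>i. c * ?g x i) = (\<lambda>i. c * x i)"
      using f gm xy by (auto simp: isom_map_def)
    then show "?g (\<lambda>i. c * x i) = (\<lambda>i. c * ?g x i)"
      using eq[of "\<lambda>i. c * ?g x i"] gm xy by simp
  next
    fix x assume "x \<in> ?W"
    then show "qval cs (?g x) = qval ds x" using f gm[of x] unfolding isom_map_def by metis
  qed (use gm eq fm in auto)
  then show ?thesis using that f gm eq fm by blast
qed

lemma isom_sym: "isom F cs ds \<Longrightarrow> isom F ds cs"
  by (erule isomE) (auto simp: isom_def)

lemma isom_mapD:
  assumes "isom_map F cs ds f"
  shows "x \<in> vecs F (length cs) \<Longrightarrow> y \<in> vecs F (length cs) \<Longrightarrow> f (\<lambda>i. x i + y i) = (\<lambda>i. f x i + f y i)"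
    "c \<in> F \<Longrightarrow> x \<in> vecs F (length cs) \<Longrightarrow> f (\<lambda>i. c * x i) = (\<lambda>i. c * f x i)"
    "x \<in> vecs F (length cs) \<Longrightarrow> qval ds (f x) = qval cs x"
  using assms unfolding isom_map_def by auto

lemma vjoin_add: "vjoin n (\<lambda>i. x i + x' i) (\<lambda>i. y i + y' i) = (\<lambda>i. vjoin n x y i + vjoin n x' y' i)"
  and vjoin_scale: "vjoin n (\<lambda>i. c * x i) (\<lambda>i. c * y i) = (\<lambda>i. c * vjoin n x y i)"
  and vtake_add: "vtake n (\<lambda>i. x i + x' i) = (\<lambda>i. vtake n x i + vtake n x' i)"
  and vtake_scale: "vtake n (\<lambda>i. c * x i) = (\<lambda>i. c * vtake n x i)"
  and vdrop_add: "vdrop n (\<lambda>i. x i + x' i) = (\<lambda>i. vdrop n x i + vdrop n x' i)"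
  and vdrop_scale: "vdrop n (\<lambda>i. c * x i) = (\<lambda>i. c * vdrop n x i)"
  by (auto simp: vjoin_def vtake_def vdrop_def)

lemma isom_append: assumes "isom F cs cs'" "isom F ds ds'" shows "isom F (cs @ ds) (cs' @ ds')"
proof -
  obtain f f' where f: "isom_map F cs cs' f" "isom_map F cs' cs f'"
    "\<And>x. x \<in> vecs F (length cs) \<Longrightarrow> f x \<in> vecs F (length cs')"
    "\<And>y. y \<in> vecs F (length cs') \<Longrightarrow> f' y \<in> vecs F (length cs)"
    "\<And>x. x \<in> vecs F (length cs) \<Longrightarrow> f' (f x) = x"
    "\<And>y. y \<in> vecs F (length cs') \<Longrightarrow> f (f' y) = y"
    using isomE[OF assms(1)] by blast
  obtain g g' where g: "isom_map F ds ds' g" "isom_map F ds' ds g'"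
    "\<And>x. x \<in> vecs F (length ds) \<Longrightarrow> g x \<in> vecs F (length ds')"
    "\<And>y. y \<in> vecs F (length ds') \<Longrightarrow> g' y \<in> vecs F (length ds)"
    "\<And>x. x \<in> vecs F (length ds) \<Longrightarrow> g' (g x) = x"
    "\<And>y. y \<in> vecs F (length ds') \<Longrightarrow> g (g' y) = y"
    using isomE[OF assms(2)] by blast
  let ?n = "length cs" and ?n' = "length cs'"
  have "isom_map F (cs @ ds) (cs' @ ds') (\<lambda>x. vjoin ?n' (f (vtake ?n x)) (g (vdrop ?n x)))"
    by (rule isom_mapI[where g = "\<lambda>x. vjoin ?n (f' (vtake ?n' x)) (g' (vdrop ?n' x))"])
       (simp_all add: f g isom_mapD[OF f(1)] isom_mapD[OF g(1)] vjoin_add vjoin_scale vtake_add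
          vtake_scale vdrop_add vdrop_scale qval_append[of cs ds])
  then show ?thesis by (auto simp: isom_def)
qed

lemma isom_Cons: "isom F [c] [d] \<Longrightarrow> isom F cs ds \<Longrightarrow> isom F (c # cs) (d # ds)"
  using isom_append[of "[c]" "[d]" cs ds] by simp

lemma isom_Cons_same: "isom F cs ds \<Longrightarrow> isom F (c # cs) (c # ds)"
  by (rule isom_Cons) simp_all

lemma isom_Cons2: "isom F [a] [a'] \<Longrightarrow> isom F [b] [b'] \<Longrightarrow> isom F [a, b] [a', b']"
  by (rule isom_Cons)

lemma isom_mset: assumes "mset cs = mset ds" shows "isom F cs ds"
proof -
  obtain p where p: "p permutes {..<length ds}" "permute_list p ds = cs"
    using mset_eq_permutation[OF assms] by blast
  let ?n = "length ds"
  have len: "length cs = ?n" using assms by (metis size_mset)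
  have q: "inv_into UNIV p permutes {..<?n}" using p(1) by (rule permutes_inv)
  have out: "p i \<ge> ?n \<longleftrightarrow> i \<ge> ?n" "inv_into UNIV p i \<ge> ?n \<longleftrightarrow> i \<ge> ?n" for i
    using permutes_in_image[OF p(1)] permutes_in_image[OF q] by (metis lessThan_iff not_le)+
  have "isom_map F cs ds (\<lambda>x. x \<circ> inv_into UNIV p)"
  proof (rule isom_mapI[where g = "\<lambda>x. x \<circ> p"])
    fix x assume "x \<in> vecs F (length cs)"
    have "qval cs x = (\<Sum>i<?n. ds ! p i * (x i)\<^sup>2)"
      unfolding qval_def len using permute_list_nth[OF p(1)] p(2) by (auto intro!: sum.cong)
    also have "\<dots> = (\<Sum>i<?n. ds ! i * (x (inv_into UNIV p i))\<^sup>2)"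
      using p(1) by (intro sum.reindex_bij_witness[where i = "inv_into UNIV p" and j = p])
        (auto simp: permutes_inverses permutes_in_image[OF p(1)] permutes_in_image[OF q]
          simp del: lessThan_iff)
    finally show "qval ds (x \<circ> inv_into UNIV p) = qval cs x" by (simp add: qval_def)
  qed (use out permutes_inverses[OF p(1)] in \<open>auto simp: vecs_def len fun_eq_iff\<close>)
  then show ?thesis by (auto simp: isom_def)
qed

lemma isom_scale: assumes "isom F cs ds" shows "isom F (map ((*) c) cs) (map ((*) c) ds)"
proof -
  have q: "qval (map ((*) c) es) x = c * qval es x" for es x
    by (simp add: qval_def sum_distrib_left mult.assoc)
  obtain f where "isom_map F cs ds f" using assms by (auto simp: isom_def)
  then have "isom_map F (map ((*) c) cs) (map ((*) c) ds) f"
    by (simp add: isom_map_def q)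
  then show ?thesis by (auto simp: isom_def)
qed

lemma isom_single: assumes "c \<in> F" "c \<noteq> 0" "b = a * c\<^sup>2" shows "isom F [b] [a]"
proof -
  have "isom_map F [b] [a] (\<lambda>x i. c * x i)"
    by (rule isom_mapI[where g = "\<lambda>x i. inverse c * x i"])
       (use assms in \<open>auto simp: vecs_def qval_def power_mult_distrib fun_eq_iff algebra_simps\<close>)
  then show ?thesis by (auto simp: isom_def)
qed

text \<open>
  The vectors \<open>(1, 1)\<close> and \<open>(b, - a)\<close> are orthogonal for \<open>\<langle>a, b\<rangle>\<close> and have the lengths on the right.
\<close>

lemma isom_pair:
  assumes "a \<in> F" "b \<in> F" "a + b \<noteq> 0"
  shows "isom F [a, b] [a + b, a * b * (a + b)]"
proof -
  define g where "g = (\<lambda>(x :: nat \<Rightarrow> 'f) i. if i = 0 then x 0 + b * x 1 else if i = (1::nat) then x 0 - a * x 1 else (0::'f))"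
  define f where "f = (\<lambda>(x :: nat \<Rightarrow> 'f) i. if i = 0 then (a * x 0 + b * x 1) / (a + b)
      else if i = (1::nat) then (x 0 - x 1) / (a + b) else (0::'f))"
  have "isom_map F [a + b, a * b * (a + b)] [a, b] g"
  proof (rule isom_mapI[where g = f])
    fix x assume x: "x \<in> vecs F (length [a, b])"
    have "f x 0 + b * f x 1 = x 0" "f x 0 - a * f x 1 = x 1"
      using assms(3) by (simp_all add: f_def add_divide_distrib[symmetric] diff_divide_distrib[symmetric] nonzero_divide_eq_eq)
         (simp_all add: algebra_simps)
    then show "g (f x) = x" using x by (auto simp: g_def vecs_def fun_eq_iff)
  next
    fix x assume x: "x \<in> vecs F (length [a + b, a * b * (a + b)])"
    have "a * g x 0 + b * g x 1 = x 0 * (a + b)" "g x 0 - g x 1 = x 1 * (a + b)"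
      by (simp_all add: g_def algebra_simps)
    then have "f (g x) 0 = x 0" "f (g x) 1 = x 1" using assms(3) by (simp_all add: f_def)
    then show "f (g x) = x" using x by (auto simp: f_def vecs_def fun_eq_iff)
  next
    fix x
    show "qval [a, b] (g x) = qval [a + b, a * b * (a + b)] x"
      by (simp add: qval_def g_def power2_eq_square algebra_simps numeral_2_eq_2)
  qed (use assms in \<open>auto simp: f_def g_def vecs_def fun_eq_iff algebra_simps\<close>)
  then show ?thesis using isom_sym by (auto simp: isom_def)
qed

definition units :: "'f list \<Rightarrow> bool" where
  "units cs \<longleftrightarrow> set cs \<subseteq> F - {0}"

lemma units_Nil [simp]: "units []"
  and units_Cons [simp]: "units (c # cs) \<longleftrightarrow> c \<in> F \<and> c \<noteq> 0 \<and> units cs"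
  and units_append [simp]: "units (cs @ ds) \<longleftrightarrow> units cs \<and> units ds"
  by (auto simp: units_def)

lemma units_nth: "units cs \<Longrightarrow> i < length cs \<Longrightarrow> cs ! i \<in> F \<and> cs ! i \<noteq> 0"
  using nth_mem[of i cs] by (auto simp: units_def subset_iff)

definition std_vec :: "nat \<Rightarrow> nat \<Rightarrow> 'f" where
  "std_vec j = (\<lambda>i. if i = j then 1 else 0)"

lemma std_vec_mem: "j < n \<Longrightarrow> std_vec j \<in> vecs F n"
  by (auto simp: std_vec_def vecs_def)

text \<open>
  The scalar action \<open>scl\<close> on the target is arbitrary, so that the lemma covers linear functionals as
  well as linear maps into a vector space.
\<close>

lemma linear_expand:
  fixes h :: "(nat \<Rightarrow> 'f) \<Rightarrow> 'w::comm_monoid_add"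
  assumes add: "\<And>x y. x \<in> vecs F n \<Longrightarrow> y \<in> vecs F n \<Longrightarrow> h (\<lambda>i. x i + y i) = h x + h y"
    and scale: "\<And>c x. c \<in> F \<Longrightarrow> x \<in> vecs F n \<Longrightarrow> h (\<lambda>i. c * x i) = scl c (h x)"
    and zero: "\<And>w. scl 0 w = 0"
    and x: "x \<in> vecs F n"
  shows "h x = (\<Sum>j<n. scl (x j) (h (std_vec j)))"
proof -
  have "h (\<lambda>i. if i < k then x i else 0) = (\<Sum>j<k. scl (x j) (h (std_vec j)))" if "k \<le> n" for k
    using that
  proof (induction k)
    case 0
    have "h (\<lambda>i. 0 * x i) = scl 0 (h x)" using scale[OF zero_mem x] by blast
    then show ?case by (simp add: zero)
  next
    case (Suc k)
    let ?y = "\<lambda>i. if i < k then x i else 0"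
    have u: "std_vec k \<in> vecs F n" using Suc.prems by (intro std_vec_mem) simp
    have y: "?y \<in> vecs F n" using x by (auto simp: vecs_def)
    have xk: "x k \<in> F" using x by (auto simp: vecs_def)
    have "(\<lambda>i. if i < Suc k then x i else 0) = (\<lambda>i. ?y i + x k * std_vec k i)"
      by (auto simp: std_vec_def less_Suc_eq)
    then show ?case using add[OF y vecs_scale[OF xk u]] scale[OF xk u] Suc by simp
  qed
  moreover have "(\<lambda>i. if i < n then x i else 0) = x" using x by (auto simp: vecs_def fun_eq_iff)
  ultimately show ?thesis by (metis le_refl)
qed

lemma isom_swap: "isom F (a # b # cs) (b # a # cs)"
  by (rule isom_mset) simp

lemma vecs_0 [simp]: "vecs F 0 = {\<lambda>_. 0}"
  by (auto simp: vecs_def)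

lemma qval_mem: "units cs \<Longrightarrow> x \<in> vecs F n \<Longrightarrow> qval cs x \<in> F"
  unfolding qval_def
  by (rule sum_mem) (auto simp: units_def vecs_def subset_iff intro!: mult_mem power_mem dest!: nth_mem)

text \<open>
  The terms of the value are collected from the end of the list: if the later terms add up to
  \<open>w \<noteq> 0\<close>, induction provides \<open>w\<close> as a coefficient, and \<open>\<langle>c x\<^sup>2, w\<rangle>\<close> represents \<open>c x\<^sup>2 + w\<close>.
\<close>

lemma represent:
  assumes "units cs" "x \<in> vecs F (length cs)" "qval cs x \<noteq> 0"
  shows "\<exists>cs'. units cs' \<and> isom F cs (qval cs x # cs') \<and> length cs = Suc (length cs')"
  using assms
proof (induction cs arbitrary: x)
  case Nil
  then show ?case by simp
next
  case (Cons c cs)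
  define w where "w = qval cs (vdrop 1 x)"
  have v: "qval (c # cs) x = c * (x 0)\<^sup>2 + w" by (simp add: qval_Cons w_def)
  have x: "vdrop 1 x \<in> vecs F (length cs)" "x 0 \<in> F" using Cons.prems(2) by (simp, simp add: vecs_def)
  have wF: "w \<in> F" using qval_mem[OF _ x(1)] Cons.prems by (auto simp: w_def)
  show ?case
  proof (cases "w = 0")
    case True
    then have "x 0 \<noteq> 0" using Cons.prems v by auto
    then have "isom F [c] [qval (c # cs) x]"
      by (intro isom_sym[OF isom_single[where c = "x 0"]]) (use x v True in auto)
    then have "isom F (c # cs) (qval (c # cs) x # cs)" by (rule isom_Cons) simp
    then show ?thesis using Cons.prems by auto
  next
    case False
    then have "qval cs (vdrop 1 x) \<noteq> 0" by (simp add: w_def)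
    moreover have "units cs" using Cons.prems(1) by simp
    ultimately obtain cs' where
      cs': "units cs'" "isom F cs (w # cs')" "length cs = Suc (length cs')"
      using Cons.IH[OF _ x(1)] unfolding w_def by blast
    have 1: "isom F (c # cs) (c # w # cs')" using cs' by (intro isom_Cons_same)
    show ?thesis
    proof (cases "x 0 = 0")
      case True
      then have "qval (c # cs) x = w" using v by simp
      then show ?thesis using isom_trans[OF 1 isom_swap] cs' Cons.prems by (auto intro!: exI[of _ "c # cs'"])
    next
      case x0: False
      let ?d = "c * (x 0)\<^sup>2"
      have "isom F [c] [?d]" by (rule isom_sym[OF isom_single[where c = "x 0"]]) (use x x0 in auto)
      then have "isom F (c # w # cs') (?d # w # cs')" by (rule isom_Cons) simp
      moreover have "isom F ([?d, w] @ cs') ([?d + w, ?d * w * (?d + w)] @ cs')"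
        using Cons.prems v x wF by (intro isom_append isom_pair) auto
      ultimately have "isom F (c # cs) (qval (c # cs) x # (?d * w * (?d + w)) # cs')"
        using isom_trans[OF 1] isom_trans v by (metis append_Cons append_Nil)
      moreover have "units ((?d * w * (?d + w)) # cs')"
        using Cons.prems cs' x x0 wF False v by auto
      ultimately show ?thesis using cs'(3) by (intro exI[of _ "(?d * w * (?d + w)) # cs'"]) auto
    qed
  qed
qed

definition anisotropic :: "'f list \<Rightarrow> bool" where
  "anisotropic cs \<longleftrightarrow> (\<forall>x\<in>vecs F (length cs). qval cs x = 0 \<longrightarrow> x = (\<lambda>_. 0))"

lemma anisotropic_isom:
  assumes "isom F cs ds" "anisotropic cs" shows "anisotropic ds"
  unfolding anisotropic_def
proof (intro ballI impI)
  fix y assume y: "y \<in> vecs F (length ds)" "qval ds y = 0"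
  obtain f g where fg: "isom_map F cs ds f" "isom_map F ds cs g"
    "\<And>x. x \<in> vecs F (length cs) \<Longrightarrow> f x \<in> vecs F (length ds)"
    "\<And>y. y \<in> vecs F (length ds) \<Longrightarrow> g y \<in> vecs F (length cs)"
    "\<And>x. x \<in> vecs F (length cs) \<Longrightarrow> g (f x) = x"
    "\<And>y. y \<in> vecs F (length ds) \<Longrightarrow> f (g y) = y"
    using isomE[OF assms(1)] by blast
  have "g y = (\<lambda>_. 0)"
    using assms(2) y fg(4)[OF y(1)] isom_mapD(3)[OF fg(2) y(1)] by (auto simp: anisotropic_def)
  moreover have "f (\<lambda>i. 0 * g y i) = (\<lambda>i. 0 * f (g y) i)"
    using isom_mapD(2)[OF fg(1)] fg(4)[OF y(1)] zero_mem by blast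
  ultimately show "y = (\<lambda>_. 0)" using fg(6)[OF y(1)] by simp
qed

end

locale coeff_field_not2 = coeff_field +
  assumes two_nz [simp]: "(2::'a) \<noteq> 0"
begin

text \<open>
  As \<open>a = ((a + 1) / 2)\<^sup>2 - ((a - 1) / 2)\<^sup>2\<close>, the plane \<open>\<langle>1, - 1\<rangle>\<close> represents \<open>a\<close>, and the other
  coefficient is determined by the determinant.  One of the two squares vanishes if \<open>a\<close> is \<open>1\<close> or \<open>- 1\<close>.
\<close>

lemma isom_hyp_plane:
  assumes "a \<in> F" "a \<noteq> 0" shows "isom F [a, - a] [1, - 1]"
proof -
  consider "a = 1" | "a = - 1" | "a \<noteq> 1" "a \<noteq> - 1" by blast
  then show ?thesis
  proof cases
    case 1 then show ?thesis by auto
  next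
    case 2 then show ?thesis using isom_swap[of a 1 "[]"] by auto
  next
    case 3
    define p m where "p = (a + 1) / 2" and "m = (a - 1) / 2"
    have mem: "p \<in> F" "m \<in> F" using assms by (simp_all add: p_def m_def)
    have nz: "p \<noteq> 0" "m \<noteq> 0" using 3 by (simp_all add: p_def m_def add_eq_0_iff2)
    have p2: "2 * p = a + 1" "2 * m = a - 1" by (simp_all add: p_def m_def)
    have "2 * (p + m) = 2 * a" "2 * (p - m) = 2 * 1"
      by (simp_all only: distrib_left right_diff_distrib p2) simp_all
    then have pm: "p + m = a" "p - m = 1" by (simp_all only: mult_cancel_left two_nz simp_thms)
    have "p\<^sup>2 + (- m\<^sup>2) = (p + m) * (p - m)" by (simp add: power2_eq_square algebra_simps)
    then have s: "p\<^sup>2 + (- m\<^sup>2) = a" by (simp only: pm mult_1_right)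
    have "isom F [1, - 1] [p\<^sup>2, - m\<^sup>2]"
      by (intro isom_Cons2 isom_sym[OF isom_single[where c = p]] isom_sym[OF isom_single[where c = m]])
        (use mem nz in simp_all)
    also have "isom F [p\<^sup>2, - m\<^sup>2] [p\<^sup>2 + (- m\<^sup>2), p\<^sup>2 * (- m\<^sup>2) * (p\<^sup>2 + (- m\<^sup>2))]"
      using mem assms s by (intro isom_pair) simp_all
    also have "[p\<^sup>2 + (- m\<^sup>2), p\<^sup>2 * (- m\<^sup>2) * (p\<^sup>2 + (- m\<^sup>2))] = [a, (- a) * (p * m)\<^sup>2]"
      unfolding s by (simp add: power_mult_distrib algebra_simps)
    also have "isom F \<dots> [a, - a]"
      by (intro isom_Cons_same isom_single[where c = "p * m"]) (use mem nz in simp_all)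
    finally show ?thesis by (rule isom_sym)
  qed
qed

text \<open>
  If the first coordinate \<open>x\<close> of an isotropic vector is not zero, the remaining coefficients represent
  \<open>- c x\<^sup>2\<close>, which together with \<open>c\<close> makes a hyperbolic plane.
\<close>

lemma isotropic_splits_plane:
  assumes "units cs" "\<not> anisotropic cs"
  shows "\<exists>cs'. units cs' \<and> isom F cs (1 # - 1 # cs') \<and> length cs' < length cs"
  using assms
proof (induction cs)
  case Nil
  then show ?case by (auto simp: anisotropic_def)
next
  case (Cons c cs)
  obtain x where x: "x \<in> vecs F (length (c # cs))" "qval (c # cs) x = 0" "x \<noteq> (\<lambda>_. 0)"
    using Cons.prems by (auto simp: anisotropic_def)
  define w where "w = qval cs (vdrop 1 x)"
  have v: "c * (x 0)\<^sup>2 + w = 0" using x by (simp add: qval_Cons w_def)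
  have x': "vdrop 1 x \<in> vecs F (length cs)" "x 0 \<in> F" using x(1) by (simp, simp add: vecs_def)
  show ?case
  proof (cases "x 0 = 0")
    case True
    have "vdrop 1 x \<noteq> (\<lambda>_. 0)"
    proof
      assume "vdrop 1 x = (\<lambda>_. 0)"
      then have "x i = 0" for i using True by (cases i) (auto simp: vdrop_def fun_eq_iff)
      then show False using x(3) by auto
    qed
    then have "\<not> anisotropic cs" using x' v True by (auto simp: anisotropic_def w_def)
    moreover have "units cs" using Cons.prems(1) by simp
    ultimately obtain cs' where cs': "units cs'" "isom F cs (1 # - 1 # cs')" "length cs' < length cs"
      using Cons.IH by blast
    have "isom F (c # cs) (c # 1 # - 1 # cs')" using cs' by (intro isom_Cons_same)
    also have "isom F \<dots> (1 # - 1 # c # cs')" by (rule isom_mset) simp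
    finally show ?thesis using cs' Cons.prems by (auto intro!: exI[of _ "c # cs'"])
  next
    case False
    let ?d = "c * (x 0)\<^sup>2"
    have w: "w = - ?d" using v by (simp add: eq_neg_iff_add_eq_0 add.commute)
    have d: "?d \<in> F" "?d \<noteq> 0" using Cons.prems x' False by auto
    obtain cs' where cs': "units cs'" "isom F cs (w # cs')" "length cs = Suc (length cs')"
      using represent[of cs "vdrop 1 x"] x' Cons.prems w d by (auto simp: w_def)
    have "isom F [c] [?d]" by (rule isom_sym[OF isom_single[where c = "x 0"]]) (use x' False in auto)
    then have "isom F (c # cs) (?d # w # cs')" by (rule isom_Cons) (rule cs'(2))
    also have "isom F ([?d, - ?d] @ cs') ([1, - 1] @ cs')" using d by (intro isom_append isom_hyp_plane) auto
    then have "isom F (?d # w # cs') (1 # - 1 # cs')" by (simp add: w)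
    finally have iso: "isom F (c # cs) (1 # - 1 # cs')" .
    show ?thesis using iso cs' by auto
  qed
qed

definition bil :: "'a list \<Rightarrow> (nat \<Rightarrow> 'a) \<Rightarrow> (nat \<Rightarrow> 'a) \<Rightarrow> 'a" where
  "bil cs x y = (\<Sum>i<length cs. cs ! i * x i * y i)"

lemma bil_add: "bil cs (\<lambda>i. x i + y i) z = bil cs x z + bil cs y z"
  and bil_diff: "bil cs (\<lambda>i. x i - y i) z = bil cs x z - bil cs y z"
  and bil_scale: "bil cs (\<lambda>i. c * x i) z = c * bil cs x z"
  and bil_commute: "bil cs x y = bil cs y x"
  and bil_self: "bil cs x x = qval cs x"
  unfolding bil_def qval_def
  by (simp_all add: sum.distrib sum_subtractf sum_distrib_left power2_eq_square algebra_simps)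

lemma bil_scale_right: "bil cs x (\<lambda>i. c * y i) = c * bil cs x y"
  unfolding bil_commute[of cs x] by (rule bil_scale)

lemma qval_scale: "qval cs (\<lambda>i. c * x i) = c\<^sup>2 * qval cs x"
  by (simp add: qval_def sum_distrib_left power_mult_distrib mult.left_commute)

lemma qval_add: "qval cs (\<lambda>i. x i + y i) = qval cs x + qval cs y + 2 * bil cs x y"
  unfolding bil_self[symmetric] bil_add bil_commute[of cs _ "\<lambda>i. x i + y i"] bil_commute[of cs y x]
  by simp

lemma qval_diff: "qval cs (\<lambda>i. x i - y i) = qval cs x + qval cs y - 2 * bil cs x y"
  unfolding bil_self[symmetric] bil_diff bil_commute[of cs _ "\<lambda>i. x i - y i"] bil_commute[of cs y x]
  by simp

lemma bil_mem: "set cs \<subseteq> F \<Longrightarrow> x \<in> vecs F n \<Longrightarrow> y \<in> vecs F n \<Longrightarrow> bil cs x y \<in> F"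
  unfolding bil_def
  by (rule sum_mem) (auto simp: vecs_def subset_iff intro!: mult_mem dest!: nth_mem)

lemma bil_std_vec: assumes "j < length cs" shows "bil cs x (std_vec j) = cs ! j * x j"
proof -
  have "bil cs x (std_vec j) = (\<Sum>k<length cs. if k = j then cs ! j * x j else 0)"
    unfolding bil_def by (intro sum.cong) (auto simp: std_vec_def)
  then show ?thesis using assms by simp
qed

lemma isom_map_bil:
  assumes "isom_map F cs ds f" "x \<in> vecs F (length cs)" "y \<in> vecs F (length cs)"
  shows "bil ds (f x) (f y) = bil cs x y"
proof -
  have "qval ds (\<lambda>i. f x i + f y i) = qval cs (\<lambda>i. x i + y i)"
    using isom_mapD(1,3)[OF assms(1)] assms(2,3) by (metis vecs_add)
  then have "2 * bil ds (f x) (f y) = 2 * bil cs x y"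
    using isom_mapD(3)[OF assms(1)] assms(2,3) by (simp add: qval_add)
  then show ?thesis by simp
qed

text \<open>
  The reflection in the hyperplane orthogonal to an anisotropic vector \<open>w\<close>.
\<close>

definition reflection :: "'a list \<Rightarrow> (nat \<Rightarrow> 'a) \<Rightarrow> (nat \<Rightarrow> 'a) \<Rightarrow> nat \<Rightarrow> 'a" where
  "reflection cs w x = (\<lambda>i. x i - (2 * bil cs x w / qval cs w) * w i)"

lemma reflection_isom_map:
  assumes "set cs \<subseteq> F" "w \<in> vecs F (length cs)" "qval cs w \<noteq> 0"
  shows "isom_map F cs cs (reflection cs w)"
proof -
  let ?n = "length cs"
  let ?t = "\<lambda>x. 2 * bil cs x w / qval cs w"
  have tF: "?t x \<in> F" if "x \<in> vecs F ?n" for x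
    using bil_mem[OF assms(1) that assms(2)] bil_mem[OF assms(1) assms(2) assms(2)]
    by (simp add: bil_self)
  have mem: "reflection cs w x \<in> vecs F ?n" if "x \<in> vecs F ?n" for x
    using that tF[OF that] assms(2) unfolding reflection_def vecs_def by (auto intro!: diff_mem mult_mem simp del: times_divide_eq_left)
  have b: "bil cs (reflection cs w x) w = - bil cs x w" for x
    using assms(3) by (simp add: reflection_def bil_diff bil_scale bil_self del: times_divide_eq_left) simp
  have inv: "reflection cs w (reflection cs w x) = x" for x
    unfolding reflection_def[of cs w "reflection cs w x"] b by (simp add: reflection_def)
  show ?thesis
  proof (rule isom_mapI[where g = "reflection cs w"])
    fix x
    have "qval cs (reflection cs w x) = qval cs x + (?t x)\<^sup>2 * qval cs w - 2 * (?t x * bil cs x w)"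
      unfolding reflection_def qval_diff bil_scale_right qval_scale ..
    also have "\<dots> = qval cs x" using assms(3) by (simp add: power2_eq_square)
    finally show "qval cs (reflection cs w x) = qval cs x" .
  qed (use mem inv in \<open>auto simp: reflection_def bil_add bil_scale add_divide_distrib algebra_simps\<close>)
qed

text \<open>
  One of \<open>u - e\<close> and \<open>u + e\<close> is anisotropic, because their lengths add up to four times that of \<open>e\<close>.
  The reflection in the former maps \<open>u\<close> to \<open>e\<close>, the one in the latter to \<open>- e\<close>.
\<close>

lemma reflect_to:
  assumes "set cs \<subseteq> F" "u \<in> vecs F (length cs)" "e \<in> vecs F (length cs)"
    "qval cs u = qval cs e" "qval cs e \<noteq> 0"
  shows "\<exists>h. isom_map F cs cs h \<and> (h u = e \<or> h u = (\<lambda>i. - e i))"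
proof (cases "qval cs (\<lambda>i. u i - e i) = 0")
  case False
  let ?w = "\<lambda>i. u i - e i"
  have "2 * bil cs u ?w = qval cs ?w"
    unfolding qval_diff bil_commute[of cs u ?w] bil_diff by (simp add: bil_self assms bil_commute[of cs u e] algebra_simps)
  then have "reflection cs ?w u = e" using False by (simp add: reflection_def)
  moreover have "?w \<in> vecs F (length cs)" using assms by (auto simp: vecs_def)
  ultimately show ?thesis using reflection_isom_map[OF assms(1) _ False] by blast
next
  case True
  let ?w = "\<lambda>i. u i + e i"
  have "qval cs ?w = 2 * (2 * qval cs e)" using True assms(4) by (simp add: qval_diff qval_add)
  then have nz: "qval cs ?w \<noteq> 0" using assms(5) by (simp only: mult_eq_0_iff two_nz simp_thms not_False_eq_True)
  have "2 * bil cs u ?w = qval cs ?w"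
    unfolding qval_add bil_commute[of cs u ?w] bil_add by (simp add: bil_self assms bil_commute[of cs u e] algebra_simps)
  then have "reflection cs ?w u = (\<lambda>i. - e i)" using nz by (simp add: reflection_def)
  moreover have "?w \<in> vecs F (length cs)" using assms by (auto simp: vecs_def)
  ultimately show ?thesis using reflection_isom_map[OF assms(1) _ nz] by blast
qed

text \<open>
  After a reflection the isometry maps the first basis vector to itself up to sign, hence restricts to
  the orthogonal complements of the first basis vectors.
\<close>

theorem Witt_cancellation:
  assumes "isom F (a # cs) (a # ds)" "a \<noteq> 0" "a \<in> F" "set ds \<subseteq> F"
  shows "isom F cs ds"
proof -
  define e where "e = (\<lambda>i :: nat. if i = 0 then 1 else 0 :: 'a)"
  have e: "e \<in> vecs F (Suc n)" for n by (auto simp: e_def vecs_def)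
  have qe: "bil (a # es) x e = a * x 0" for es x
    by (simp add: bil_def e_def sum.lessThan_Suc_shift del: sum.lessThan_Suc)
  have qe': "qval (a # es) e = a" for es unfolding bil_self[symmetric] qe by (simp add: e_def)
  obtain f where f: "isom_map F (a # cs) (a # ds) f" using assms(1) by (auto simp: isom_def)
  have fe: "f e \<in> vecs F (length (a # ds))" using f e unfolding isom_map_def bij_betw_def by auto
  have "qval (a # ds) (f e) = qval (a # ds) e"
    using isom_mapD(3)[OF f, of e] e by (simp add: qe')
  then obtain h where h: "isom_map F (a # ds) (a # ds) h" "h (f e) = e \<or> h (f e) = (\<lambda>i. - e i)"
    using reflect_to[of "a # ds" "f e" e] assms fe e qe' by auto
  define g where "g = h \<circ> f"
  have g: "isom_map F (a # cs) (a # ds) g" unfolding g_def by (rule isom_map_comp[OF f h(1)])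
  have ge: "g e = e \<or> g e = (\<lambda>i. - e i)" using h by (simp add: g_def)
  let ?V = "vecs F (length (a # cs))" and ?W = "vecs F (length (a # ds))"
  have zero: "g x 0 = 0 \<longleftrightarrow> x 0 = 0" if "x \<in> ?V" for x
  proof -
    have "bil (a # ds) (g x) (g e) = a * x 0"
      using isom_map_bil[OF g that, of e] e qe by simp
    moreover have "bil (a # ds) (g x) (\<lambda>i. - e i) = - (a * g x 0)"
      using bil_scale[of "a # ds" "-1" e "g x"] qe[of ds "g x"] by (simp add: bil_commute[of _ "g x"])
    ultimately show ?thesis using ge qe[of ds "g x"] assms(2) by auto
  qed
  define g' where "g' = inv_into ?V g"
  have bij: "bij_betw g ?V ?W" using g by (simp add: isom_map_def)
  have gm: "g x \<in> ?W" if "x \<in> ?V" for x using bij that by (auto simp: bij_betw_def)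
  have g'm: "g' y \<in> ?V" "g (g' y) = y" if "y \<in> ?W" for y
    using bij that by (auto simp: g'_def bij_betw_def inv_into_into f_inv_into_f)
  have g'g: "g' (g x) = x" if "x \<in> ?V" for x using bij that by (auto simp: g'_def bij_betw_def)
  define c where "c = vjoin 1 (\<lambda>_. 0 :: 'a)"
  have c: "c x \<in> vecs F (Suc n)" "c x 0 = 0" "vdrop 1 (c x) = x" if "x \<in> vecs F n" for x n
    using vjoin_mem[of "\<lambda>_. 0" 1 x n] that by (auto simp: c_def vjoin_def vdrop_def)
  have c': "c (vdrop 1 y) = y" if "y 0 = 0" for y :: "nat \<Rightarrow> 'a"
    using that by (auto simp: c_def vjoin_def vdrop_def fun_eq_iff)
  have cq: "qval (a # es) (c x) = qval es x" if "x \<in> vecs F n" for es x n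
    using c[OF that] by (simp add: qval_Cons)
  have qd: "qval es (vdrop 1 y) = qval (a # es) y" if "y 0 = 0" for es y
    using that by (simp add: qval_Cons)
  have gc: "g (c x) 0 = 0" "g (c x) \<in> ?W" if "x \<in> vecs F (length cs)" for x
    using zero[of "c x"] c[OF that] gm[of "c x"] by auto
  have g'c: "g' (c y) 0 = 0" "g' (c y) \<in> ?V" if "y \<in> vecs F (length ds)" for y
    using zero[of "g' (c y)"] c[OF that] g'm[of "c y"] by auto
  have "isom_map F cs ds (\<lambda>x. vdrop 1 (g (c x)))"
  proof (rule isom_mapI[where g = "\<lambda>y. vdrop 1 (g' (c y))"])
    fix x assume x: "x \<in> vecs F (length cs)"
    show "vdrop 1 (g (c x)) \<in> vecs F (length ds)" using gc[OF x] by simp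
    show "vdrop 1 (g' (c (vdrop 1 (g (c x))))) = x"
      unfolding c'[of "g (c x)", OF gc(1)[OF x]] using g'g[of "c x"] c[OF x] by simp
    show "qval ds (vdrop 1 (g (c x))) = qval cs x"
      unfolding qd[of "g (c x)", OF gc(1)[OF x]] using isom_mapD(3)[OF g, of "c x"] c[OF x] cq[OF x] by simp
  next
    fix y assume y: "y \<in> vecs F (length ds)"
    show "vdrop 1 (g' (c y)) \<in> vecs F (length cs)" using g'c[OF y] by simp
    show "vdrop 1 (g (c (vdrop 1 (g' (c y))))) = y"
      unfolding c'[of "g' (c y)", OF g'c(1)[OF y]] using g'm[of "c y"] c[OF y] by simp
  next
    fix x y assume xy: "x \<in> vecs F (length cs)" "y \<in> vecs F (length cs)"
    have "c (\<lambda>i. x i + y i) = (\<lambda>i. c x i + c y i)" by (auto simp: c_def vjoin_def)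
    then show "vdrop 1 (g (c (\<lambda>i. x i + y i))) = (\<lambda>i. vdrop 1 (g (c x)) i + vdrop 1 (g (c y)) i)"
      using isom_mapD(1)[OF g, of "c x" "c y"] c(1)[OF xy(1)] c(1)[OF xy(2)] by (simp add: vdrop_def)
  next
    fix k x assume xy: "k \<in> F" "x \<in> vecs F (length cs)"
    have "c (\<lambda>i. k * x i) = (\<lambda>i. k * c x i)" by (auto simp: c_def vjoin_def)
    then show "vdrop 1 (g (c (\<lambda>i. k * x i))) = (\<lambda>i. k * vdrop 1 (g (c x)) i)"
      using isom_mapD(2)[OF g, of k "c x"] c(1)[OF xy(2)] xy by (simp add: vdrop_def)
  qed
  then show ?thesis by (auto simp: isom_def)
qed

corollary Witt_cancellation_append:
  "isom F (as @ cs) (as @ ds) \<Longrightarrow> units as \<Longrightarrow> set ds \<subseteq> F \<Longrightarrow> isom F cs ds"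
proof (induction as)
  case (Cons a as)
  then show ?case using Witt_cancellation[of a "as @ cs" "as @ ds"] by (auto simp: units_def)
qed simp

end

section \<open>Witt equivalence of diagonal forms\<close>

definition planes :: "nat \<Rightarrow> 'f::field list" where
  "planes m = concat (replicate m [1, - 1])"

lemma planes_0 [simp]: "planes 0 = []"
  and planes_Suc [simp]: "planes (Suc m) = 1 # - 1 # planes m"
  by (simp_all add: planes_def)

lemma planes_add: "planes (m + n) = planes m @ planes n"
  by (induction m) auto

definition wequiv :: "'f::field set \<Rightarrow> 'f list \<Rightarrow> 'f list \<Rightarrow> bool" where
  "wequiv F cs ds \<longleftrightarrow> (\<exists>m n. isom F (cs @ planes m) (ds @ planes n))"

context coeff_field
begin

lemma units_planes [simp]: "units (planes m)"
  by (induction m) auto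

lemma isom_Nil: assumes "isom F cs []" shows "cs = []"
proof (rule ccontr)
  assume "cs \<noteq> []"
  obtain f where f: "isom_map F cs [] f" using assms by (auto simp: isom_def)
  then have inj: "inj_on f (vecs F (length cs))" and img: "f ` vecs F (length cs) = {\<lambda>_. 0}"
    by (auto simp: isom_map_def bij_betw_def)
  let ?e = "\<lambda>i :: nat. if i = 0 then 1 else 0 :: 'f"
  have e: "?e \<in> vecs F (length cs)" using \<open>cs \<noteq> []\<close> by (auto simp: vecs_def)
  have "f x = (\<lambda>_. 0)" if "x \<in> vecs F (length cs)" for x using img that by auto
  then have "f ?e = f (\<lambda>_. 0)" using e vecs_zero[of "length cs"] by metis
  then have "?e = (\<lambda>_. 0)" using inj_onD[OF inj, of ?e "\<lambda>_. 0"] e vecs_zero by blast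
  then show False by (metis one_neq_zero)
qed

lemma isom_append_same: "isom F cs ds \<Longrightarrow> isom F (cs @ es) (ds @ es)"
  and isom_append_same': "isom F cs ds \<Longrightarrow> isom F (es @ cs) (es @ ds)"
  by (rule isom_append; simp)+

lemma isom_imp_wequiv: "isom F cs ds \<Longrightarrow> wequiv F cs ds"
  unfolding wequiv_def by (metis append_Nil2 planes_0)

lemma wequiv_refl [simp]: "wequiv F cs cs"
  by (simp add: isom_imp_wequiv)

lemma wequiv_sym: "wequiv F cs ds \<Longrightarrow> wequiv F ds cs"
  unfolding wequiv_def using isom_sym by blast

lemma wequiv_trans [trans]: assumes "wequiv F cs ds" "wequiv F ds es" shows "wequiv F cs es"
proof -
  obtain m n m' n' where 1: "isom F (cs @ planes m) (ds @ planes n)"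
    and 2: "isom F (ds @ planes m') (es @ planes n')" using assms by (auto simp: wequiv_def)
  have "isom F (cs @ planes (m + m')) (ds @ planes n @ planes m')"
    using isom_append_same[OF 1, of "planes m'"] by (simp add: planes_add)
  also have "isom F \<dots> ((ds @ planes m') @ planes n)" by (rule isom_mset) simp
  also have "isom F \<dots> ((es @ planes n') @ planes n)" using 2 by (rule isom_append_same)
  finally show ?thesis by (auto simp: wequiv_def planes_add[symmetric])
qed

lemma isom_wequiv_trans [trans]: "isom F cs ds \<Longrightarrow> wequiv F ds es \<Longrightarrow> wequiv F cs es"
  and wequiv_isom_trans [trans]: "wequiv F cs ds \<Longrightarrow> isom F ds es \<Longrightarrow> wequiv F cs es"
  using wequiv_trans isom_imp_wequiv by blast+

lemma wequiv_mset: "mset cs = mset ds \<Longrightarrow> wequiv F cs ds"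
  by (intro isom_imp_wequiv isom_mset)

lemma wequiv_append: assumes "wequiv F cs ds" "wequiv F cs' ds'" shows "wequiv F (cs @ cs') (ds @ ds')"
proof -
  obtain m n m' n' where 1: "isom F (cs @ planes m) (ds @ planes n)"
    and 2: "isom F (cs' @ planes m') (ds' @ planes n')" using assms by (auto simp: wequiv_def)
  have "isom F ((cs @ cs') @ planes (m + m')) ((cs @ planes m) @ (cs' @ planes m'))"
    by (rule isom_mset) (simp add: planes_add)
  also have "isom F \<dots> ((ds @ planes n) @ (ds' @ planes n'))" using 1 2 by (rule isom_append)
  also have "isom F \<dots> ((ds @ ds') @ planes (n + n'))"
    by (rule isom_mset) (simp add: planes_add)
  finally show ?thesis by (auto simp: wequiv_def)
qed

lemma wequiv_planes [simp]: "wequiv F (planes m) []"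
  unfolding wequiv_def by (rule exI[of _ 0], rule exI[of _ m]) simp

end

context coeff_field_not2
begin

lemma wequiv_plane: "a \<in> F \<Longrightarrow> a \<noteq> 0 \<Longrightarrow> wequiv F [a, - a] []"
  using isom_imp_wequiv[OF isom_hyp_plane] wequiv_planes[of 1] wequiv_trans by fastforce

lemma wequiv_scale: assumes "wequiv F cs ds" "c \<in> F" "c \<noteq> 0"
  shows "wequiv F (map ((*) c) cs) (map ((*) c) ds)"
proof -
  have pl: "wequiv F (map ((*) c) (planes m)) []" for m
  proof (induction m)
    case (Suc m)
    then show ?case using wequiv_append[OF wequiv_plane[OF assms(2,3)] Suc] by simp
  qed simp
  obtain m n where 1: "isom F (cs @ planes m) (ds @ planes n)" using assms(1) by (auto simp: wequiv_def)
  have "wequiv F (map ((*) c) cs) (map ((*) c) cs @ map ((*) c) (planes m))"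
    using wequiv_append[OF wequiv_refl wequiv_sym[OF pl]] by simp
  also have "wequiv F \<dots> (map ((*) c) ds @ map ((*) c) (planes n))"
    using isom_imp_wequiv[OF isom_scale[OF 1, of c]] by simp
  also have "wequiv F \<dots> (map ((*) c) ds)"
    using wequiv_append[OF wequiv_refl pl] by simp
  finally show ?thesis .
qed

lemma anisotropic_kernel: "units cs \<Longrightarrow> \<exists>ds. units ds \<and> anisotropic ds \<and> wequiv F cs ds"
proof (induction "length cs" arbitrary: cs rule: less_induct)
  case less
  show ?case
  proof (cases "anisotropic cs")
    case False
    then obtain cs' where cs': "units cs'" "isom F cs (1 # - 1 # cs')" "length cs' < length cs"
      using isotropic_splits_plane less.prems by blast
    then obtain ds where ds: "units ds" "anisotropic ds" "wequiv F cs' ds" using less.hyps by blast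
    have "wequiv F ([1, - 1] @ cs') ([] @ ds)"
      using wequiv_plane[of 1] ds by (intro wequiv_append) auto
    then have "wequiv F cs ds" using isom_imp_wequiv[OF cs'(2)] wequiv_trans by fastforce
    then show ?thesis using ds by blast
  qed (use less.prems wequiv_refl in blast)
qed

lemma isotropic_plane: "\<not> anisotropic (1 # - 1 # cs)"
proof -
  let ?x = "\<lambda>i :: nat. if i < 2 then 1 else 0 :: 'a"
  have "?x \<in> vecs F (length (1 # - 1 # cs))" by (auto simp: vecs_def)
  moreover have "qval (1 # - 1 # cs) ?x = 0"
    unfolding qval_Cons by (simp add: vdrop_def qval_def)
  moreover have "?x \<noteq> (\<lambda>_. 0)" by (auto simp: fun_eq_iff intro!: exI[of _ 0])
  ultimately show ?thesis unfolding anisotropic_def by blast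
qed

lemma wequiv_anisotropic_aux:
  assumes "isom F (cs @ planes m) (ds @ planes n)" "m \<le> n" "units cs" "units ds"
    "anisotropic cs"
  shows "isom F cs ds"
proof -
  have eq: "planes n = (planes m @ planes (n - m) :: 'a list)"
    using planes_add[of m "n - m"] assms(2) by simp
  have "isom F (planes m @ cs) (cs @ planes m)" by (rule isom_mset) simp
  also note assms(1)
  also have "isom F (ds @ planes n) (planes m @ planes (n - m) @ ds)"
    using eq by (intro isom_mset) simp
  finally have iso: "isom F cs (planes (n - m) @ ds)"
    by (rule Witt_cancellation_append) (use assms units_planes in \<open>auto simp: units_def\<close>)
  show ?thesis
  proof (cases "n - m")
    case (Suc k)
    then show ?thesis using anisotropic_isom[OF iso assms(5)] isotropic_plane by simp
  qed (use iso in simp)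
qed

text \<open>
  Cancelling hyperbolic planes leaves planes on at most one side; there they would contradict
  anisotropy.
\<close>

lemma wequiv_anisotropic_imp_isom:
  assumes "wequiv F cs ds" "units cs" "units ds" "anisotropic cs" "anisotropic ds"
  shows "isom F cs ds"
proof -
  obtain m n where 1: "isom F (cs @ planes m) (ds @ planes n)" using assms(1) by (auto simp: wequiv_def)
  show ?thesis
  proof (cases "m \<le> n")
    case True then show ?thesis using wequiv_anisotropic_aux[OF 1] assms by blast
  next
    case False then show ?thesis using wequiv_anisotropic_aux[OF isom_sym[OF 1]] assms isom_sym by simp
  qed
qed

lemma wequiv_Nil_anisotropic: "wequiv F cs [] \<Longrightarrow> units cs \<Longrightarrow> anisotropic cs \<Longrightarrow> cs = []"
proof -
  assume a: "wequiv F cs []" "units cs" "anisotropic cs"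
  have "isom F cs []" by (rule wequiv_anisotropic_imp_isom) (use a in \<open>auto simp: anisotropic_def\<close>)
  then show ?thesis by (rule isom_Nil)
qed

end

section \<open>Pfister forms\<close>

lemma diag_tensor_Nil [simp]: "diag_tensor [] ds = []"
  and diag_tensor_Cons: "diag_tensor (c # cs) ds = map ((*) c) ds @ diag_tensor cs ds"
  by (simp_all add: diag_tensor_def)

lemma diag_tensor_append: "diag_tensor (as @ bs) ds = diag_tensor as ds @ diag_tensor bs ds"
  by (simp add: diag_tensor_def)

lemma map_times_one [simp]: "map ((*) (1 :: 'f :: field)) ds = ds"
  by (simp add: map_idI)

lemma diag_tensor_one_left [simp]: "diag_tensor [1] ds = ds"
  by (simp add: diag_tensor_Cons)

lemma diag_tensor_pair: "diag_tensor [1, a] ds = ds @ map ((*) a) ds"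
  by (simp add: diag_tensor_Cons)

lemma map_times_diag_tensor: "map ((*) (c :: 'f :: field)) (diag_tensor as bs) = diag_tensor (map ((*) c) as) bs"
  by (induction as) (auto simp: diag_tensor_Cons mult.assoc)

lemma diag_tensor_assoc: "diag_tensor (diag_tensor as bs) cs = diag_tensor as (diag_tensor bs cs)"
  by (induction as) (auto simp: diag_tensor_Cons diag_tensor_append map_times_diag_tensor)

lemma mset_diag_tensor_append_right:
  "mset (diag_tensor as (bs @ cs)) = mset (diag_tensor as bs @ diag_tensor as cs)"
  by (induction as) (auto simp: diag_tensor_Cons)

lemma mset_diag_tensor_commute: "mset (diag_tensor as bs) = mset (diag_tensor bs as)"
proof (induction as)
  case Nil
  show ?case by (induction bs) (auto simp: diag_tensor_Cons)
next
  case (Cons a as)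
  have "mset (diag_tensor bs [a]) = mset (map ((*) a) bs)"
    by (induction bs) (auto simp: diag_tensor_Cons mult.commute)
  then show ?case using Cons mset_diag_tensor_append_right[of bs "[a]" as] by (simp add: diag_tensor_Cons)
qed

context coeff_field
begin

lemma units_map [simp]: "c \<in> F \<Longrightarrow> c \<noteq> 0 \<Longrightarrow> units cs \<Longrightarrow> units (map ((*) c) cs)"
  by (auto simp: units_def)

lemma units_diag_tensor [simp]: "units as \<Longrightarrow> units bs \<Longrightarrow> units (diag_tensor as bs)"
  by (induction as) (auto simp: diag_tensor_Cons)

lemma isom_tensor_right: "isom F as bs \<Longrightarrow> isom F (diag_tensor cs as) (diag_tensor cs bs)"
proof (induction cs)
  case (Cons c cs)
  then show ?case unfolding diag_tensor_Cons by (intro isom_append[OF isom_scale])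
qed simp

lemma isom_tensor_left: assumes "isom F as bs" shows "isom F (diag_tensor as cs) (diag_tensor bs cs)"
proof -
  have "isom F (diag_tensor as cs) (diag_tensor cs as)"
    by (rule isom_mset) (rule mset_diag_tensor_commute)
  also have "isom F \<dots> (diag_tensor cs bs)" using assms by (rule isom_tensor_right)
  also have "isom F \<dots> (diag_tensor bs cs)"
    by (rule isom_mset) (rule mset_diag_tensor_commute)
  finally show ?thesis .
qed

lemma isom_scale_square: "c \<in> F \<Longrightarrow> c \<noteq> 0 \<Longrightarrow> isom F (map ((*) (c\<^sup>2)) cs) cs"
proof (induction cs)
  case (Cons a cs)
  then have "isom F (map ((*) (c\<^sup>2)) cs) cs" by blast
  moreover have "isom F [c\<^sup>2 * a] [a]" by (rule isom_single[where c = c]) (use Cons.prems in auto)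
  ultimately show ?case using isom_Cons by simp
qed simp

end

context coeff_field_not2
begin

lemma wequiv_tensor_right:
  "wequiv F as bs \<Longrightarrow> units cs \<Longrightarrow> wequiv F (diag_tensor cs as) (diag_tensor cs bs)"
proof (induction cs)
  case (Cons c cs)
  then show ?case unfolding diag_tensor_Cons by (intro wequiv_append[OF wequiv_scale]) simp_all
qed simp

lemma wequiv_tensor_left:
  assumes "wequiv F as bs" "units cs" shows "wequiv F (diag_tensor as cs) (diag_tensor bs cs)"
proof -
  have "wequiv F (diag_tensor as cs) (diag_tensor cs as)"
    by (rule wequiv_mset) (rule mset_diag_tensor_commute)
  also have "wequiv F \<dots> (diag_tensor cs bs)" using assms by (rule wequiv_tensor_right)
  also have "wequiv F \<dots> (diag_tensor bs cs)"
    by (rule wequiv_mset) (rule mset_diag_tensor_commute)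
  finally show ?thesis .
qed

end

text \<open>
  The Pfister form with \<open>\<langle>1, a\<rangle>\<close> in place of \<open>\<langle>1, - a\<rangle>\<close>, which avoids all signs; the two
  conventions are related by replacing the slots by their negatives.
\<close>

primrec pf :: "'f::field list \<Rightarrow> 'f list" where
  "pf [] = [1]"
| "pf (a # as) = diag_tensor [1, a] (pf as)"

lemma pf_Cons: "pf (a # as) = pf as @ map ((*) a) (pf as)"
  by (simp add: diag_tensor_pair)

declare pf.simps(2) [simp del]

lemma pf_append: "pf (as @ bs) = diag_tensor (pf as) (pf bs)"
  by (induction as) (simp_all add: pf.simps(2) diag_tensor_assoc)

lemma pf_Cons_tl: "pf as = 1 # tl (pf as)"
proof (induction as)
  case (Cons a as)
  then show ?case by (metis append_Cons list.sel(3) pf_Cons)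
qed simp

lemma length_diag_tensor: "length (diag_tensor as bs) = length as * length bs"
  by (induction as) (auto simp: diag_tensor_Cons)

lemma length_pf: "length (pf as) = 2 ^ length as"
  by (induction as) (auto simp: pf_Cons)

lemma mset_pf: "mset as = mset bs \<Longrightarrow> mset (pf as) = mset (pf bs)"
proof (induction as arbitrary: bs)
  case (Cons a as)
  have "a \<in> set bs" using Cons.prems by (metis list.set_intros(1) set_mset_mset)
  then obtain us vs where bs: "bs = us @ a # vs" by (metis split_list)
  have "mset (pf (us @ a # vs)) = mset (pf (a # us @ vs))"
    by (induction us) (auto simp: pf_Cons multiset.map_comp comp_def mult.left_commute)
  moreover have "mset (pf as) = mset (pf (us @ vs))" using Cons bs by simp
  ultimately show ?case unfolding bs by (simp add: pf_Cons)
qed simp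

context coeff_field
begin

lemma units_pf [simp]: "units as \<Longrightarrow> units (pf as)"
  by (induction as) (auto simp: pf_Cons)

lemma isom_pf_Cons: "isom F (pf as) (pf bs) \<Longrightarrow> isom F (pf (a # as)) (pf (a # bs))"
  unfolding pf.simps(2) by (rule isom_tensor_right)

lemma isom_pf_swap: "isom F (pf (a # b # cs)) (pf (b # a # cs))"
  by (rule isom_mset) (simp add: pf_Cons comp_def mult.left_commute)

text \<open>
  Nonzero values of Pfister forms are similarity factors: if \<open>u\<close> and \<open>v\<close> are nonzero values of the
  Pfister form \<open>\<tau>\<close>, then \<open>\<tau> \<bottom> a \<tau>\<close> is isometric to \<open>\<langle>u, a v\<rangle> \<otimes> \<tau>\<close> by induction, and
  \<open>\<langle>u, a v\<rangle>\<close> represents \<open>u + a v\<close>.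
\<close>

lemma pf_round:
  assumes "units as" "x \<in> vecs F (length (pf as))" "qval (pf as) x \<noteq> 0"
  shows "isom F (map ((*) (qval (pf as) x)) (pf as)) (pf as)"
  using assms
proof (induction as arbitrary: x)
  case Nil
  then show ?case by (auto simp: qval_def vecs_def intro!: isom_single[where c = "x 0"])
next
  case (Cons a as)
  let ?T = "pf as"
  define u v where "u = qval ?T (vtake (length ?T) x)" and "v = qval ?T (vdrop (length ?T) x)"
  have a: "a \<in> F" "a \<noteq> 0" and as: "units as" using Cons.prems by auto
  have q: "qval (pf (a # as)) x = u + a * v"
    by (simp add: pf_Cons qval_append u_def v_def) (simp add: qval_def sum_distrib_left mult.assoc)
  have mem: "vtake (length ?T) x \<in> vecs F (length ?T)" "vdrop (length ?T) x \<in> vecs F (length ?T)"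
    using Cons.prems(2) by (auto simp: pf_Cons vecs_def vtake_def vdrop_def)
  have uv: "u \<in> F" "v \<in> F" unfolding u_def v_def by (rule qval_mem[OF units_pf[OF as] mem(1)] qval_mem[OF units_pf[OF as] mem(2)])+
  have U: "isom F (map ((*) u) ?T) ?T" if "u \<noteq> 0"
    using Cons.IH[OF as mem(1)] that by (simp add: u_def)
  have V: "isom F (map ((*) v) ?T) ?T" if "v \<noteq> 0"
    using Cons.IH[OF as mem(2)] that by (simp add: v_def)
  have comp: "map ((*) b) (map ((*) c) cs) = map ((*) (b * c)) cs" for b c :: 'f and cs
    by (simp add: mult.assoc)
  have goal: "isom F (map ((*) (u + a * v)) ?T @ map ((*) ((u + a * v) * a)) ?T) (?T @ map ((*) a) ?T)"
  proof (cases "v = 0 \<or> u = 0")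
    case True
    then consider "v = 0" "u \<noteq> 0" | "u = 0" "v \<noteq> 0" using q Cons.prems(3) by auto
    then show ?thesis
    proof cases
      case 1
      then show ?thesis using isom_append[OF U isom_scale[OF U, of a]] 1 by (simp add: comp mult.commute del: map_map)
    next
      case 2
      have "isom F (map ((*) (a * v)) ?T) (map ((*) a) ?T)"
        using isom_scale[OF V, of a] 2 by (simp add: comp del: map_map)
      moreover have "isom F (map ((*) (a * v * a)) ?T) ?T"
        using isom_trans[OF isom_scale[OF V, of "a\<^sup>2"] isom_scale_square[OF a]] 2
        by (simp add: comp power2_eq_square mult.commute mult.left_commute del: map_map)
      ultimately have "isom F (map ((*) (a * v)) ?T @ map ((*) (a * v * a)) ?T) (map ((*) a) ?T @ ?T)"
        by (rule isom_append)
      also have "isom F \<dots> (?T @ map ((*) a) ?T)" by (rule isom_mset) simp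
      finally show ?thesis using 2 by simp
    qed
  next
    case False
    let ?c = "u + a * v"
    have "isom F (?T @ map ((*) a) ?T) (map ((*) u) ?T @ map ((*) (a * v)) ?T)"
      using isom_append[OF isom_sym[OF U] isom_scale[OF isom_sym[OF V], of a]] False by (simp add: comp del: map_map)
    also have "\<dots> = diag_tensor [u, a * v] ?T" by (simp add: diag_tensor_Cons)
    also have "isom F \<dots> (diag_tensor [?c, u * (a * v) * ?c] ?T)"
      by (intro isom_tensor_left isom_pair) (use uv a Cons.prems(3) q in auto)
    also have "\<dots> = map ((*) ?c) ?T @ map ((*) (?c * a)) (map ((*) u) (map ((*) v) ?T))"
      by (simp add: diag_tensor_Cons ac_simps)
    also have "isom F \<dots> (map ((*) ?c) ?T @ map ((*) (?c * a)) ?T)"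
      using isom_trans[OF isom_scale[OF V, of u] U] False by (intro isom_append_same' isom_scale) auto
    finally show ?thesis by (rule isom_sym)
  qed
  then show ?case unfolding q by (simp add: pf_Cons comp del: map_map)
qed

lemma mset_pair_slots:
  "mset (diag_tensor ([u + z, u * z * (u + z)] @ [1, z * u]) cs) =
    mset (diag_tensor [1, u + z] (diag_tensor [1, z * u] cs))" for u z :: "'b :: field"
proof -
  have "u * z * (u + z) = (u + z) * (z * u)" by simp
  then show ?thesis by (simp only: append.simps diag_tensor_Cons) (simp add: comp_def mult.assoc[symmetric])
qed

text \<open>
  The pure subform theorem, relative to the factor \<open>pf bs\<close>: as \<open>pf (as @ bs)\<close> is
  \<open>pf bs\<close> plus \<open>pf bs\<close> times the pure part of \<open>pf as\<close>, any value of the second summand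
  is a slot of the Pfister form that leaves the slots \<open>bs\<close> alone.
\<close>

lemma pure_subform:
  assumes "units as" "units bs" "x \<in> vecs F (length (diag_tensor (tl (pf as)) (pf bs)))"
    "qval (diag_tensor (tl (pf as)) (pf bs)) x = c" "c \<noteq> 0"
  shows "\<exists>as'. units as' \<and> length as = Suc (length as') \<and> isom F (pf (as @ bs)) (pf (c # as' @ bs))"
  using assms
proof (induction as arbitrary: x c)
  case Nil
  then show ?case by simp
next
  case (Cons a as)
  let ?T = "pf (as @ bs)" and ?T' = "diag_tensor (tl (pf as)) (pf bs)"
  have a: "a \<in> F" "a \<noteq> 0" and as: "units as" using Cons.prems by auto
  have "tl (pf (a # as)) = tl (pf as) @ map ((*) a) (pf as)"
    unfolding pf_Cons by (subst pf_Cons_tl) simp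
  then have eq: "diag_tensor (tl (pf (a # as))) (pf bs) = ?T' @ map ((*) a) ?T"
    by (simp add: diag_tensor_append pf_append map_times_diag_tensor)
  define x1 x2 where "x1 = vtake (length ?T') x" and "x2 = vdrop (length ?T') x"
  define u v where "u = qval ?T' x1" and "v = qval ?T x2"
  have c: "c = u + a * v"
    using Cons.prems(4) unfolding eq
    by (simp add: qval_append u_def v_def x1_def x2_def) (simp add: qval_def sum_distrib_left mult.assoc)
  have mem: "x1 \<in> vecs F (length ?T')" "x2 \<in> vecs F (length ?T)"
    using Cons.prems(3) unfolding eq by (auto simp: x1_def x2_def vecs_def vtake_def vdrop_def)
  have "units (tl (pf as))" using units_pf[OF as] by (metis units_Cons pf_Cons_tl)
  then have "units ?T'" using Cons.prems(2) by (intro units_diag_tensor units_pf)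
  then have uv: "u \<in> F" "v \<in> F" unfolding u_def v_def using qval_mem[OF _ mem(1)] qval_mem[OF _ mem(2)] as Cons.prems(2) by auto
  show ?case
  proof (cases "v = 0")
    case True
    then obtain as' where as': "units as'" "length as = Suc (length as')" "isom F ?T (pf (c # as' @ bs))"
      using Cons.IH[OF as Cons.prems(2) mem(1), of c] Cons.prems(5) c by (auto simp: u_def)
    have "isom F (pf (a # as @ bs)) (pf (a # c # as' @ bs))" using as'(3) by (rule isom_pf_Cons)
    also have "isom F \<dots> (pf (c # a # as' @ bs))" by (rule isom_pf_swap)
    finally show ?thesis using as' a by (intro exI[of _ "a # as'"]) auto
  next
    case False
    have V: "isom F (map ((*) v) ?T) ?T"
      using pf_round[of "as @ bs" x2] as Cons.prems(2) mem(2) False by (simp add: v_def)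
    have "isom F (?T @ map ((*) a) ?T) (?T @ map ((*) a) (map ((*) v) ?T))"
      by (intro isom_append_same' isom_scale isom_sym[OF V])
    then have av: "isom F (pf (a # as @ bs)) (pf (a * v # as @ bs))" by (simp add: pf_Cons mult.assoc[symmetric] comp_def)
    show ?thesis
    proof (cases "u = 0")
      case True
      then show ?thesis using av as c by auto
    next
      case u: False
      then obtain as' where as': "units as'" "length as = Suc (length as')" "isom F ?T (pf (u # as' @ bs))"
        using Cons.IH[OF as Cons.prems(2) mem(1), of u] by (auto simp: u_def)
      let ?U = "pf (as' @ bs)" and ?z = "a * v"
      have "isom F (pf (?z # as @ bs)) (pf (?z # u # as' @ bs))" using as'(3) by (rule isom_pf_Cons)
      also have "isom F \<dots> (diag_tensor ([u, ?z] @ [1, ?z * u]) ?U)"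
        by (rule isom_mset) (simp add: pf_Cons diag_tensor_Cons comp_def mult.assoc[symmetric])
      also have "isom F \<dots> (diag_tensor ([u + ?z, u * ?z * (u + ?z)] @ [1, ?z * u]) ?U)"
        by (intro isom_tensor_left isom_append_same isom_pair) (use uv a c Cons.prems(5) in auto)
      also have "isom F \<dots> (pf (c # (?z * u) # as' @ bs))"
        unfolding c pf.simps(2) by (rule isom_mset) (rule mset_pair_slots)
      finally have "isom F (pf (a # as @ bs)) (pf (c # (?z * u) # as' @ bs))" using av isom_trans by blast
      then show ?thesis using as' uv a False u by (intro exI[of _ "?z * u # as'"]) auto
    qed
  qed
qed

end

locale coeff_field_i = coeff_field_not2 +
  assumes minus_one_square: "\<exists>i\<in>F. i\<^sup>2 = - 1"
begin

lemma isom_uminus: "isom F [- a] [a]"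
proof -
  obtain i where "i \<in> F" "i\<^sup>2 = - 1" using minus_one_square by blast
  then show ?thesis by (intro isom_single[where c = i]) auto
qed

lemma wequiv_double: assumes "units cs" shows "wequiv F (cs @ cs) []"
  using assms
proof (induction cs)
  case (Cons c cs)
  have "wequiv F ((c # cs) @ (c # cs)) ([c, c] @ (cs @ cs))" by (rule wequiv_mset) simp
  also have "wequiv F \<dots> ([c, - c] @ (cs @ cs))"
    by (intro wequiv_append wequiv_refl isom_imp_wequiv isom_Cons_same isom_sym[OF isom_uminus])
  also have "wequiv F \<dots> ([] @ [])" using Cons by (intro wequiv_append wequiv_plane) auto
  finally show ?case by simp
qed simp

lemma wequiv_odd_multiple:
  assumes "units cs" "odd m" shows "wequiv F (concat (replicate m cs)) cs"
proof -
  obtain k where "m = Suc (2 * k)" using assms(2) by (auto elim: oddE)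
  moreover have "wequiv F (concat (replicate (2 * k) cs)) []"
  proof (induction k)
    case (Suc k)
    have "wequiv F ((cs @ cs) @ concat (replicate (2 * k) cs)) ([] @ [])"
      using assms(1) Suc by (intro wequiv_append wequiv_double)
    then show ?case by simp
  qed simp
  then have "wequiv F (cs @ concat (replicate (2 * k) cs)) (cs @ [])" by (intro wequiv_append wequiv_refl)
  ultimately show ?thesis by simp
qed

text \<open>
  If \<open>\<tau>\<close> is anisotropic and \<open>\<tau> \<bottom> a \<tau>\<close> is not, then \<open>u + a v = 0\<close> for nonzero values \<open>u\<close>, \<open>v\<close> of
  \<open>\<tau>\<close>, and by roundness \<open>\<tau> \<bottom> a \<tau>\<close> is isometric to \<open>u \<tau> \<bottom> a v \<tau> = \<langle>u, - u\<rangle> \<otimes> \<tau>\<close>.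
\<close>

lemma isotropic_pf:
  assumes "units as" "\<not> anisotropic (pf as)" shows "wequiv F (pf as) []"
  using assms
proof (induction as)
  case Nil
  have "x = (\<lambda>_. 0)" if "x \<in> vecs F 1" "x 0 = 0" for x
    using that by (auto simp: vecs_def fun_eq_iff) (metis not_less_eq_eq le0 le_0_eq One_nat_def)
  then have "anisotropic (pf [])" by (auto simp: anisotropic_def qval_def)
  then show ?case using Nil by blast
next
  case (Cons a as)
  let ?T = "pf as"
  have a: "a \<in> F" "a \<noteq> 0" and as: "units as" using Cons.prems by auto
  show ?case
  proof (cases "anisotropic ?T")
    case False
    then have "wequiv F ?T []" using Cons.IH as by blast
    then have "wequiv F (?T @ map ((*) a) ?T) ([] @ map ((*) a) [])"
      using a by (intro wequiv_append wequiv_scale)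
    then show ?thesis by (simp add: pf_Cons)
  next
    case True
    obtain x where x: "x \<in> vecs F (length (pf (a # as)))" "qval (pf (a # as)) x = 0" "x \<noteq> (\<lambda>_. 0)"
      using Cons.prems(2) by (auto simp: anisotropic_def)
    define x1 x2 where "x1 = vtake (length ?T) x" and "x2 = vdrop (length ?T) x"
    define u v where "u = qval ?T x1" and "v = qval ?T x2"
    have q: "u + a * v = 0"
      using x(2) by (simp add: pf_Cons qval_append u_def v_def x1_def x2_def) (simp add: qval_def sum_distrib_left mult.assoc)
    have mem: "x1 \<in> vecs F (length ?T)" "x2 \<in> vecs F (length ?T)"
      using x(1) by (auto simp: pf_Cons x1_def x2_def vecs_def vtake_def vdrop_def)
    have uv: "u \<in> F" "v \<in> F" unfolding u_def v_def by (rule qval_mem[OF units_pf[OF as] mem(1)] qval_mem[OF units_pf[OF as] mem(2)])+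
    have "u \<noteq> 0"
    proof
      assume "u = 0"
      then have "v = 0" using q a by simp
      then have "x1 = (\<lambda>_. 0)" "x2 = (\<lambda>_. 0)" using True mem \<open>u = 0\<close> by (auto simp: anisotropic_def u_def v_def)
      then have "x = vjoin (length ?T) (\<lambda>_. 0) (\<lambda>_. 0)" using vjoin_take_drop[of "length ?T" x] by (simp add: x1_def x2_def)
      then show False using x(3) by (auto simp: vjoin_def)
    qed
    then have nz: "u \<noteq> 0" "v \<noteq> 0" using q by auto
    have U: "isom F ?T (map ((*) u) ?T)" using pf_round[OF as mem(1)] nz isom_sym by (simp add: u_def)
    have V: "isom F ?T (map ((*) v) ?T)" using pf_round[OF as mem(2)] nz isom_sym by (simp add: v_def)
    have av: "a * v = - u" using q by (simp add: eq_neg_iff_add_eq_0 add.commute)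
    have "isom F (?T @ map ((*) a) ?T) (map ((*) u) ?T @ map ((*) a) (map ((*) v) ?T))"
      by (intro isom_append isom_scale U V)
    also have "map ((*) u) ?T @ map ((*) a) (map ((*) v) ?T) = diag_tensor [u, - u] ?T"
      by (simp add: diag_tensor_Cons comp_def mult.assoc[symmetric] av)
    also have "wequiv F \<dots> (diag_tensor [] ?T)"
      by (intro wequiv_tensor_left wequiv_plane) (use uv nz as in auto)
    finally have "wequiv F (?T @ map ((*) a) ?T) (diag_tensor [] ?T)" .
    then show ?thesis by (simp add: pf_Cons)
  qed
qed

end

section \<open>Extension of scalars\<close>

locale scalar_extension = K: coeff_field_i "UNIV :: 'k::field set" + L: coeff_field_i F + field_hom \<iota>
  for F :: "'l::field set" and \<iota> :: "'k::field \<Rightarrow> 'l" +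
  assumes range_sub: "range \<iota> \<subseteq> F"
begin

lemma emb_mem [simp]: "\<iota> c \<in> F"
  using range_sub by auto

lemma units_map_emb [simp]: "K.units cs \<Longrightarrow> L.units (map \<iota> cs)"
  by (auto simp: K.units_def L.units_def)

lemma isom_map_expand:
  assumes "isom_map UNIV cs ds f" "y \<in> vecs UNIV (length cs)"
  shows "f y i = (\<Sum>j<length cs. y j * f (K.std_vec j) i)"
  using K.isom_mapD(1,2)[OF assms(1)] assms(2) by (intro K.linear_expand) auto

text \<open>
  The isometry and its inverse are extended by their matrices.
\<close>

lemma isom_base_change: assumes "isom UNIV cs ds" shows "isom F (map \<iota> cs) (map \<iota> ds)"
proof -
  obtain f g where fg: "isom_map UNIV cs ds f" "isom_map UNIV ds cs g"
    "\<And>x. x \<in> vecs UNIV (length cs) \<Longrightarrow> f x \<in> vecs UNIV (length ds)"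
    "\<And>y. y \<in> vecs UNIV (length ds) \<Longrightarrow> g y \<in> vecs UNIV (length cs)"
    "\<And>x. x \<in> vecs UNIV (length cs) \<Longrightarrow> g (f x) = x"
    "\<And>y. y \<in> vecs UNIV (length ds) \<Longrightarrow> f (g y) = y"
    using K.isomE[OF assms] by blast
  define ext where "ext = (\<lambda>n (h :: (nat \<Rightarrow> 'k) \<Rightarrow> nat \<Rightarrow> 'k) (x :: nat \<Rightarrow> 'l) i. \<Sum>j<n. x j * \<iota> (h (K.std_vec j) i))"
  have mem: "ext (length as) h x \<in> vecs F (length bs)"
    if h: "isom_map UNIV as bs h" and x: "x \<in> vecs F (length as)" for h as bs x
  proof -
    have "h (K.std_vec j) \<in> vecs UNIV (length bs)" if "j < length as" for j
      using h K.std_vec_mem[OF that] by (auto simp: isom_map_def bij_betw_def)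
    then show ?thesis using x by (auto simp: ext_def vecs_def intro!: L.sum_mem)
  qed
  have inv: "ext (length bs) h' (ext (length as) h x) = x"
    if h: "isom_map UNIV as bs h" and h': "isom_map UNIV bs as h'"
      and hh: "\<And>x. x \<in> vecs UNIV (length as) \<Longrightarrow> h' (h x) = x"
      and x: "x \<in> vecs F (length as)" for h h' as bs x
  proof
    fix i
    have "ext (length bs) h' (ext (length as) h x) i =
        (\<Sum>k<length bs. \<Sum>j<length as. x j * \<iota> (h (K.std_vec j) k * h' (K.std_vec k) i))"
      by (simp add: ext_def sum_distrib_right mult.assoc hom_mult)
    also have "\<dots> = (\<Sum>j<length as. x j * \<iota> (\<Sum>k<length bs. h (K.std_vec j) k * h' (K.std_vec k) i))"
      by (subst sum.swap) (simp add: hom_sum sum_distrib_left)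
    also have "\<dots> = (\<Sum>j<length as. x j * \<iota> (K.std_vec j i))"
    proof (rule sum.cong[OF refl])
      fix j assume "j \<in> {..<length as}"
      then have j: "K.std_vec j \<in> vecs UNIV (length as)" by (simp add: K.std_vec_mem)
      then have "h (K.std_vec j) \<in> vecs UNIV (length bs)" using h by (auto simp: isom_map_def bij_betw_def)
      from isom_map_expand[OF h' this, of i]
      show "x j * \<iota> (\<Sum>k<length bs. h (K.std_vec j) k * h' (K.std_vec k) i) = x j * \<iota> (K.std_vec j i)"
        by (simp add: hh[OF j])
    qed
    also have "\<dots> = (\<Sum>j<length as. if j = i then x j else 0)"
      by (intro sum.cong) (auto simp: K.std_vec_def)
    also have "\<dots> = x i" using x by (auto simp: vecs_def)
    finally show "ext (length bs) h' (ext (length as) h x) i = x i" .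
  qed
  have "isom_map F (map \<iota> cs) (map \<iota> ds) (ext (length cs) f)"
  proof (rule isom_mapI[where g = "ext (length ds) g"])
    fix x assume "x \<in> vecs F (length (map \<iota> cs))"
    let ?B = "\<lambda>j j'. x j * x j' * \<iota> (K.bil ds (f (K.std_vec j)) (f (K.std_vec j')))"
    have "qval (map \<iota> ds) (ext (length cs) f x) = (\<Sum>i<length ds. \<Sum>j<length cs. \<Sum>j'<length cs.
        x j * x j' * \<iota> (ds ! i * f (K.std_vec j) i * f (K.std_vec j') i))"
      by (simp add: qval_def ext_def power2_eq_square sum_product sum_distrib_left hom_mult ac_simps)
    also have "\<dots> = (\<Sum>j<length cs. \<Sum>i<length ds. \<Sum>j'<length cs.
        x j * x j' * \<iota> (ds ! i * f (K.std_vec j) i * f (K.std_vec j') i))" by (rule sum.swap)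
    also have "\<dots> = (\<Sum>j<length cs. \<Sum>j'<length cs. ?B j j')"
      by (rule sum.cong[OF refl], subst sum.swap) (simp add: K.bil_def hom_sum sum_distrib_left)
    also have "\<dots> = (\<Sum>j<length cs. \<Sum>j'<length cs. if j' = j then \<iota> (cs ! j) * (x j)\<^sup>2 else 0)"
    proof (intro sum.cong[OF refl])
      fix j j' assume j: "j \<in> {..<length cs}" "j' \<in> {..<length cs}"
      have "K.bil ds (f (K.std_vec j)) (f (K.std_vec j')) = K.bil cs (K.std_vec j) (K.std_vec j')"
        using j by (intro K.isom_map_bil[OF fg(1)] K.std_vec_mem) auto
      also have "\<dots> = (\<Sum>i<length cs. if i = j then (if j' = j then cs ! j else 0) else 0)"
        unfolding K.bil_def by (intro sum.cong) (auto simp: K.std_vec_def)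
      also have "\<dots> = (if j' = j then cs ! j else 0)" using j by auto
      finally show "?B j j' = (if j' = j then \<iota> (cs ! j) * (x j)\<^sup>2 else 0)"
        by (simp add: power2_eq_square)
    qed
    also have "\<dots> = qval (map \<iota> cs) x" by (simp add: qval_def)
    finally show "qval (map \<iota> ds) (ext (length cs) f x) = qval (map \<iota> cs) x" .
  qed (use mem[OF fg(1)] mem[OF fg(2)] inv[OF fg(1,2,5)] inv[OF fg(2,1,6)] in
      \<open>auto simp: ext_def distrib_right sum.distrib sum_distrib_left mult.assoc\<close>)
  then show ?thesis by (auto simp: isom_def)
qed

lemma map_emb_planes: "map \<iota> (planes m) = planes m"
  by (induction m) (auto simp: hom_uminus)

lemma wequiv_base_change: "wequiv UNIV cs ds \<Longrightarrow> wequiv F (map \<iota> cs) (map \<iota> ds)"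
  unfolding wequiv_def by (metis isom_base_change map_append map_emb_planes)

lemma map_emb_pf: "map \<iota> (pf as) = pf (map \<iota> as)"
proof (induction as)
  case (Cons a as)
  show ?case by (simp add: pf_Cons hom_mult comp_def Cons[symmetric])
qed simp

end

text \<open>
  The property that Springer's theorem establishes for extensions of odd degree.
\<close>

locale anisotropy_preserving = scalar_extension +
  assumes Springer: "K.anisotropic cs \<Longrightarrow> L.anisotropic (map \<iota> cs)"
begin

text \<open>
  An anisotropic form represents \<open>t\<close> if and only if its sum with \<open>\<langle>- t\<rangle>\<close> is isotropic, and isotropy
  descends.
\<close>

lemma value_descent:
  assumes "K.anisotropic cs" "K.units cs" "t \<noteq> 0" "L.units ds"
    "isom F (map \<iota> cs) (\<iota> t # ds)"
  shows "\<exists>cs'. K.units cs' \<and> isom UNIV cs (t # cs')"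
proof -
  have "\<not> L.anisotropic (map \<iota> (- t # cs))"
  proof
    assume "L.anisotropic (map \<iota> (- t # cs))"
    moreover have "isom F (map \<iota> (- t # cs)) (- \<iota> t # \<iota> t # ds)"
      using L.isom_Cons_same[OF assms(5), of "- \<iota> t"] by (simp add: hom_uminus)
    then have "isom F (map \<iota> (- t # cs)) ([\<iota> t, - \<iota> t] @ ds)"
      using isom_trans[OF _ L.isom_swap] by fastforce
    moreover have "isom F ([\<iota> t, - \<iota> t] @ ds) ([1, - 1] @ ds)"
      using assms(3) by (intro L.isom_append_same L.isom_hyp_plane) auto
    ultimately show False using L.isotropic_plane L.anisotropic_isom isom_trans
      by (metis append_Cons append_Nil)
  qed
  then have "\<not> K.anisotropic (- t # cs)" using Springer by blast
  then obtain x where x: "x \<in> vecs UNIV (Suc (length cs))" "qval (- t # cs) x = 0" "x \<noteq> (\<lambda>_. 0)"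
    by (auto simp: K.anisotropic_def)
  have x1: "vdrop 1 x \<in> vecs UNIV (length cs)" using x by simp
  have q: "qval cs (vdrop 1 x) = t * (x 0)\<^sup>2" using x(2) by (simp add: qval_Cons eq_neg_iff_add_eq_0 add.commute)
  have x0: "x 0 \<noteq> 0"
  proof
    assume "x 0 = 0"
    then have "vdrop 1 x = (\<lambda>_. 0)" using q x1 assms(1) by (auto simp: K.anisotropic_def)
    then have "x i = 0" for i using \<open>x 0 = 0\<close> by (cases i) (auto simp: vdrop_def fun_eq_iff)
    then show False using x(3) by auto
  qed
  then obtain cs' where cs': "K.units cs'" "isom UNIV cs (t * (x 0)\<^sup>2 # cs')"
    using K.represent[OF assms(2) x1] q assms(3) by auto
  have "isom UNIV (t * (x 0)\<^sup>2 # cs') (t # cs')"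
    by (rule K.isom_Cons[OF K.isom_single[where c = "x 0"]]) (use x0 in auto)
  then show ?thesis using cs' isom_trans by blast
qed

text \<open>
  The coefficients of the subform are split off one after another, with Witt cancellation over the
  larger field.
\<close>

lemma subform_descent:
  assumes "K.anisotropic cs" "K.units cs" "K.units ts" "L.units ds"
    "isom F (map \<iota> cs) (map \<iota> ts @ ds)"
  shows "\<exists>cs'. K.units cs' \<and> isom UNIV cs (ts @ cs')"
  using assms
proof (induction ts arbitrary: cs)
  case Nil
  then show ?case by auto
next
  case (Cons t ts)
  obtain cs1 where cs1: "K.units cs1" "isom UNIV cs (t # cs1)"
    using value_descent[of cs t "map \<iota> ts @ ds"] Cons.prems by auto
  have "isom F (\<iota> t # map \<iota> cs1) (\<iota> t # map \<iota> ts @ ds)"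
    using isom_trans[OF L.isom_sym[OF isom_base_change[OF cs1(2)]] Cons.prems(5)] by simp
  then have iso: "isom F (map \<iota> cs1) (map \<iota> ts @ ds)"
    by (rule L.Witt_cancellation) (use Cons.prems in \<open>auto simp: L.units_def\<close>)
  have "K.anisotropic (t # cs1)" using K.anisotropic_isom[OF cs1(2)] Cons.prems by blast
  then have "K.anisotropic cs1" unfolding K.anisotropic_def
  proof (intro ballI impI)
    fix x assume a: "\<forall>x\<in>vecs UNIV (length (t # cs1)). qval (t # cs1) x = 0 \<longrightarrow> x = (\<lambda>_. 0)"
      and x: "x \<in> vecs UNIV (length cs1)" "qval cs1 x = 0"
    let ?y = "vjoin 1 (\<lambda>_. 0) x"
    have "?y \<in> vecs UNIV (length (t # cs1))" using K.vjoin_mem[of "\<lambda>_. 0" 1 x] x by simp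
    moreover have "qval (t # cs1) ?y = 0" unfolding qval_Cons K.vdrop_join using x by (simp add: vjoin_def)
    ultimately have "?y = (\<lambda>_. 0)" using a by blast
    then have "vdrop 1 ?y = (\<lambda>_. 0)" by (simp add: vdrop_def)
    then show "x = (\<lambda>_. 0)" by simp
  qed
  then obtain cs' where "K.units cs'" "isom UNIV cs1 (ts @ cs')" using Cons iso cs1 by auto
  then show ?case using isom_trans[OF cs1(2) K.isom_Cons_same] by auto
qed

text \<open>
  Slots of the Pfister form over the larger field are replaced one by one with elements
  of the smaller one: as long as a slot outside the smaller field is left, \<open>cs\<close> has
  coefficients beyond those of the Pfister form of the slots already found, and any of them
  can serve as the next slot by the pure subform theorem.
\<close>

lemma Pfister_descent:
  assumes "K.anisotropic cs" "K.units cs" "L.units bs" "isom F (map \<iota> cs) (pf bs)"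
  shows "\<exists>as. length as = length bs \<and> K.units as \<and> isom UNIV cs (pf as)"
proof -
  have "\<exists>as bs'. length as = n \<and> K.units as \<and> L.units bs' \<and> length bs' = length bs - n \<and>
      isom F (pf bs) (pf (bs' @ map \<iota> as))" if "n \<le> length bs" for n
    using that
  proof (induction n)
    case 0
    then show ?case using assms(3) by (intro exI[of _ "[]"] exI[of _ bs]) auto
  next
    case (Suc n)
    then obtain as bs' where IH: "length as = n" "K.units as" "L.units bs'" "length bs' = length bs - n"
      "isom F (pf bs) (pf (bs' @ map \<iota> as))" by auto
    let ?D = "diag_tensor (tl (pf bs')) (pf (map \<iota> as))"
    have split: "pf (bs' @ map \<iota> as) = pf (map \<iota> as) @ ?D"
      unfolding pf_append by (subst pf_Cons_tl) (simp add: diag_tensor_Cons)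
    have uD: "L.units ?D"
      using L.units_pf[of "bs' @ map \<iota> as"] IH unfolding split by (simp add: units_map_emb)
    have iso: "isom F (map \<iota> cs) (map \<iota> (pf as) @ ?D)"
      using isom_trans[OF assms(4) IH(5)] by (simp add: split map_emb_pf)
    obtain cs' where cs': "K.units cs'" "isom UNIV cs (pf as @ cs')"
      using subform_descent[OF assms(1,2) _ uD iso] IH by auto
    have "isom F (map \<iota> (pf as) @ map \<iota> cs') (map \<iota> (pf as) @ ?D)"
      using isom_trans[OF L.isom_sym[OF isom_base_change[OF cs'(2)]] iso] by simp
    then have iso': "isom F (map \<iota> cs') ?D"
      by (rule L.Witt_cancellation_append[OF _ units_map_emb[OF K.units_pf]])
        (use IH(2) uD in \<open>auto simp: L.units_def\<close>)
    have "length bs' > 0" using IH(4) Suc.prems by simp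
    then have "(2 :: nat) ^ length bs' > 1" by (rule one_less_power[rotated]) simp
    then have "length ?D > 0" by (simp add: length_diag_tensor length_pf)
    then have "?D \<noteq> []" by auto
    then have "cs' \<noteq> []" using L.isom_Nil[OF L.isom_sym] iso' by auto
    then obtain c cs'' where c: "cs' = c # cs''" by (cases cs') auto
    have c0: "c \<noteq> 0" using cs' c by simp
    obtain f where f: "isom_map F (map \<iota> cs') ?D f" using iso' by (auto simp: isom_def)
    let ?e = "\<lambda>i :: nat. if i = 0 then 1 else 0 :: 'a"
    have e: "?e \<in> vecs F (length (map \<iota> cs'))" using c by (auto simp: vecs_def)
    have "qval (map \<iota> cs') ?e = \<iota> c" by (simp add: c qval_Cons) (simp add: qval_def vdrop_def)
    then have "qval ?D (f ?e) = \<iota> c" using L.isom_mapD(3)[OF f e] by simp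
    moreover have "f ?e \<in> vecs F (length ?D)" using f e unfolding isom_map_def bij_betw_def by blast
    ultimately obtain bs1 where bs1: "L.units bs1" "length bs' = Suc (length bs1)"
      "isom F (pf (bs' @ map \<iota> as)) (pf (\<iota> c # bs1 @ map \<iota> as))"
      using L.pure_subform[of bs' "map \<iota> as" "f ?e" "\<iota> c"] IH c0 by auto
    have "isom F (pf (\<iota> c # bs1 @ map \<iota> as)) (pf (bs1 @ map \<iota> (c # as)))"
      by (rule L.isom_mset, rule mset_pf) simp
    then have "isom F (pf bs) (pf (bs1 @ map \<iota> (c # as)))"
      using IH(5) bs1(3) isom_trans by blast
    then show ?case using IH bs1 cs' c by (intro exI[of _ "c # as"] exI[of _ bs1]) auto
  qed
  from this[of "length bs"] obtain as where as: "length as = length bs" "K.units as" "isom F (pf bs) (pf (map \<iota> as))"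
    by auto
  have iso: "isom F (map \<iota> cs) (map \<iota> (pf as) @ [])"
    using isom_trans[OF assms(4) as(3)] by (simp add: map_emb_pf)
  then obtain cs' where cs': "K.units cs'" "isom UNIV cs (pf as @ cs')"
    using subform_descent[OF assms(1,2)] as by (metis K.units_pf L.units_Nil)
  have "isom F (map \<iota> (pf as) @ map \<iota> cs') (map \<iota> (pf as) @ [])"
    using isom_trans[OF L.isom_sym[OF isom_base_change[OF cs'(2)]] iso] by simp
  then have "isom F (map \<iota> cs') []"
    by (rule L.Witt_cancellation_append) (use as in auto)
  then have "cs' = []" using L.isom_Nil by auto
  then show ?thesis using as cs' by auto
qed

text \<open>
  If the extended form is isotropic over the larger field, it is Witt equivalent to \<open>0\<close>
  there, hence also over the smaller field, and \<open>\<langle>1, 1\<rangle>\<close> is a hyperbolic plane.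
\<close>

theorem scaled_Pfister_descent:
  assumes "K.units cs" "L.units bs" "e \<noteq> 0" "wequiv F (map \<iota> cs) (map ((*) (\<iota> e)) (pf bs))"
  shows "\<exists>as. length as = length bs \<and> K.units as \<and> wequiv UNIV cs (map ((*) e) (pf as))"
proof -
  have ee: "isom UNIV (map ((*) e) (map ((*) e) ds)) ds" for ds
    using K.isom_scale_square[of e ds] assms(3) by (simp add: power2_eq_square comp_def mult.assoc[symmetric])
  obtain ds where ds: "K.units ds" "K.anisotropic ds" "wequiv UNIV (map ((*) e) cs) ds"
    using K.anisotropic_kernel[of "map ((*) e) cs"] assms by auto
  have "wequiv F (map \<iota> ds) (map \<iota> (map ((*) e) cs))"
    by (rule wequiv_base_change[OF K.wequiv_sym[OF ds(3)]])
  also have "map \<iota> (map ((*) e) cs) = map ((*) (\<iota> e)) (map \<iota> cs)" by (simp add: hom_mult)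
  also have "wequiv F \<dots> (map ((*) (\<iota> e)) (map ((*) (\<iota> e)) (pf bs)))"
    using assms(3,4) by (intro L.wequiv_scale) auto
  also have "isom F \<dots> (pf bs)"
    using L.isom_scale_square[of "\<iota> e" "pf bs"] assms(3) by (simp add: power2_eq_square comp_def mult.assoc[symmetric])
  finally have dsb: "wequiv F (map \<iota> ds) (pf bs)" .
  have "\<exists>as. length as = length bs \<and> K.units as \<and> wequiv UNIV ds (pf as)"
  proof (cases "L.anisotropic (pf bs)")
    case True
    then have "isom F (map \<iota> ds) (pf bs)"
      using L.wequiv_anisotropic_imp_isom[OF dsb] ds assms(2) Springer by auto
    then show ?thesis using Pfister_descent[OF ds(2,1) assms(2)] K.isom_imp_wequiv by blast
  next
    case False
    have "wequiv F (map \<iota> ds) []" using dsb L.isotropic_pf[OF assms(2) False] L.wequiv_trans by blast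
    then have "ds = []" using L.wequiv_Nil_anisotropic[of "map \<iota> ds"] ds Springer by auto
    have "bs \<noteq> []"
    proof
      assume "bs = []"
      then have "\<exists>x\<in>vecs F 1. x 0 = 0 \<and> x \<noteq> (\<lambda>_. 0)" using False by (auto simp: L.anisotropic_def qval_def)
      then obtain x where "x \<in> vecs F 1" "x 0 = 0" "x \<noteq> (\<lambda>_. 0)" by blast
      then show False by (auto simp: vecs_def fun_eq_iff) (metis not_less_eq_eq le0 le_0_eq One_nat_def)
    qed
    define as where "as = replicate (length bs) (1 :: 'b)"
    have "K.units (replicate k 1)" for k by (auto simp: K.units_def)
    then have double: "wequiv UNIV (pf (replicate k (1 :: 'b)) @ pf (replicate k 1)) []" for k
      by (intro K.wequiv_double K.units_pf)
    obtain k where "length bs = Suc k" using \<open>bs \<noteq> []\<close> by (cases bs) auto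
    then have "wequiv UNIV (pf as) []" using double[of k] by (simp add: as_def pf_Cons)
    then show ?thesis using \<open>ds = []\<close> K.wequiv_sym
      by (intro exI[of _ as]) (auto simp: as_def K.units_def)
  qed
  then obtain as where as: "length as = length bs" "K.units as" "wequiv UNIV ds (pf as)" by blast
  have "wequiv UNIV cs (map ((*) e) (map ((*) e) cs))" by (rule K.isom_imp_wequiv[OF K.isom_sym[OF ee]])
  also have "wequiv UNIV \<dots> (map ((*) e) (pf as))"
    using K.wequiv_trans[OF ds(3) as(3)] assms(3) by (intro K.wequiv_scale) auto
  finally show ?thesis using as by blast
qed

end

section \<open>Springer's theorem\<close>

definition qpoly :: "'k::field list \<Rightarrow> (nat \<Rightarrow> 'k poly) \<Rightarrow> 'k poly" where
  "qpoly cs v = (\<Sum>i<length cs. smult (cs ! i) ((v i)\<^sup>2))"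

lemma odd_degree_irreducible_factor:
  fixes p :: "'k::field poly"
  assumes "odd (degree p)"
  shows "\<exists>q. irreducible q \<and> odd (degree q) \<and> q dvd p"
  using assms
proof (induction "degree p" arbitrary: p rule: less_induct)
  case less
  show ?case
  proof (cases "irreducible p")
    case True
    then show ?thesis using less.prems by auto
  next
    case False
    have "p \<noteq> 0" "\<not> p dvd 1" using less.prems by (auto simp: is_unit_iff_degree)
    then obtain a b where ab: "p = a * b" "\<not> a dvd 1" "\<not> b dvd 1"
      using False by (auto simp: irreducible_def)
    then have nz: "a \<noteq> 0" "b \<noteq> 0" using \<open>p \<noteq> 0\<close> by auto
    then have pos: "degree a > 0" "degree b > 0" using ab by (auto simp: is_unit_iff_degree)
    have deg: "degree p = degree a + degree b" using ab nz by (simp add: degree_mult_eq)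
    then consider "odd (degree a)" | "odd (degree b)" using less.prems by auto
    then show ?thesis
    proof cases
      case 1
      moreover have "degree a < degree p" using deg pos by simp
      ultimately show ?thesis using less.hyps ab(1) by (meson dvd_mult2)
    next
      case 2
      moreover have "degree b < degree p" using deg pos by simp
      ultimately show ?thesis using less.hyps ab(1) by (meson dvd_mult)
    qed
  qed
qed

context coeff_field
begin

lemma anisotropic_coeff:
  assumes "F = UNIV" "anisotropic cs" "qval cs y = 0" "i < length cs" shows "y i = 0"
proof -
  let ?y = "\<lambda>i. if i < length cs then y i else 0"
  have "?y \<in> vecs F (length cs)" using assms(1) by (auto simp: vecs_def)
  moreover have "qval cs ?y = 0" using assms(3) by (subst qval_cong[of cs ?y y]) auto
  ultimately have "?y = (\<lambda>_. 0)" using assms(2) by (auto simp: anisotropic_def)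
  then show ?thesis using assms(4) by (metis (full_types))
qed

end

text \<open>
  The coefficient at \<open>2 * D\<close> is the value of the form at the coefficients at \<open>D\<close>, and this is not zero
  by anisotropy.
\<close>

lemma degree_qpoly:
  assumes "\<forall>y. qval cs y = 0 \<longrightarrow> (\<forall>i<length cs. y i = 0)"
    and "\<And>i. i < length cs \<Longrightarrow> degree (v i) \<le> D" and "k < length cs" "degree (v k) = D" "v k \<noteq> 0"
  shows "degree (qpoly cs v) = 2 * D" "qpoly cs v \<noteq> 0"
proof -
  have "Polynomial.coeff ((v i)\<^sup>2) (2 * D) = (Polynomial.coeff (v i) D)\<^sup>2" if "i < length cs" for i
  proof (cases "degree (v i) = D")
    case True
    then have "Polynomial.coeff ((v i)\<^sup>2) (D + D) = Polynomial.coeff (v i) D * Polynomial.coeff (v i) D"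
      using coeff_mult_degree_sum[of "v i" "v i"] by (simp add: power2_eq_square)
    then show ?thesis by (simp add: power2_eq_square mult_2)
  next
    case False
    then have lt: "degree (v i) < D" using assms(2)[OF that] by simp
    have "degree ((v i)\<^sup>2) \<le> degree (v i) * 2" by (rule degree_power_le)
    then have "Polynomial.coeff ((v i)\<^sup>2) (2 * D) = 0" using lt by (intro coeff_eq_0) linarith
    then show ?thesis using lt by (simp add: coeff_eq_0)
  qed
  then have "Polynomial.coeff (qpoly cs v) (2 * D) = qval cs (\<lambda>i. Polynomial.coeff (v i) D)"
    by (simp add: qpoly_def qval_def coeff_sum)
  moreover have "qval cs (\<lambda>i. Polynomial.coeff (v i) D) \<noteq> 0"
  proof
    assume "qval cs (\<lambda>i. Polynomial.coeff (v i) D) = 0"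
    then have "Polynomial.coeff (v k) D = 0" using spec[OF assms(1), of "\<lambda>i. Polynomial.coeff (v i) D"] assms(3) by blast
    then show False using assms(4,5) by (metis leading_coeff_0_iff)
  qed
  ultimately have nz: "Polynomial.coeff (qpoly cs v) (2 * D) \<noteq> 0" by simp
  then show "qpoly cs v \<noteq> 0" by auto
  have "degree (qpoly cs v) \<le> 2 * D" unfolding qpoly_def
  proof (rule degree_sum_le)
    fix i assume "i \<in> {..<length cs}"
    then have "degree ((v i)\<^sup>2) \<le> D * 2"
      using assms(2)[of i] degree_power_le[of "v i" 2] by (meson lessThan_iff le_trans mult_le_mono1)
    then show "degree (smult (cs ! i) ((v i)\<^sup>2)) \<le> 2 * D"
      using degree_smult_le[of "cs ! i" "(v i)\<^sup>2"] by simp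
  qed simp
  then show "degree (qpoly cs v) = 2 * D" using le_degree[OF nz] by simp
qed

text \<open>
  Suppose that \<open>f\<close> divides a value of \<open>cs\<close> on a vector of polynomials not all divisible by
  \<open>f\<close>, and choose such a vector of least degree \<open>D\<close>.  Then \<open>D < degree f\<close>, the value has degree
  exactly \<open>2 * D\<close> by anisotropy, so the cofactor has odd degree less than \<open>degree f\<close>.  By
  induction an irreducible factor of odd degree of the cofactor divides the whole vector, and
  cancelling it gives a smaller vector.
\<close>

theorem Springer_polynomials:
  fixes f :: "'k::field poly"
  assumes aniso: "\<forall>y. qval cs y = 0 \<longrightarrow> (\<forall>i<length cs. y i = 0)"
    and "irreducible f" "odd (degree f)" "f dvd qpoly cs v" "i < length cs"
  shows "f dvd v i"
  using assms(2-)
proof (induction "degree f" arbitrary: f v i rule: less_induct)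
  case less
  let ?n = "length cs"
  have f: "prime_elem f" using less.prems(1) by (rule field_poly_irreducible_imp_prime)
  have f0: "f \<noteq> 0" using less.prems(1) by auto
  define bad where "bad = (\<lambda>D. \<exists>w. f dvd qpoly cs w \<and> (\<exists>i<?n. \<not> f dvd w i) \<and> (\<forall>i<?n. degree (w i) \<le> D))"
  show ?case
  proof (rule ccontr)
    assume neg: "\<not> f dvd v i"
    have "bad (Max ((degree \<circ> v) ` {..<?n}))"
      unfolding bad_def using less.prems(3,4) neg by (intro exI[of _ v]) auto
    then obtain D where D: "bad D" "\<And>E. E < D \<Longrightarrow> \<not> bad E" using exists_least_iff[of bad] by blast
    then obtain w where w: "f dvd qpoly cs w" "\<exists>i<?n. \<not> f dvd w i" "\<And>i. i < ?n \<Longrightarrow> degree (w i) \<le> D"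
      unfolding bad_def by blast
    have small: "D < degree f"
    proof (rule ccontr)
      assume "\<not> D < degree f"
      define w' where "w' = (\<lambda>i. w i mod f)"
      have dv: "f dvd w i - w' i" for i by (simp add: w'_def dvd_minus_mod)
      have diff_sq: "p\<^sup>2 - q\<^sup>2 = (p - q) * (p + q)" for p q :: "'k poly"
        by (simp add: power2_eq_square algebra_simps)
      have "qpoly cs w - qpoly cs w' = (\<Sum>i<?n. smult (cs ! i) ((w i - w' i) * (w i + w' i)))"
        by (simp only: qpoly_def sum_subtractf[symmetric] smult_diff_right[symmetric] diff_sq)
      also have "f dvd \<dots>" using dv by (intro dvd_sum dvd_smult dvd_mult2)
      finally have "f dvd qpoly cs w - (qpoly cs w - qpoly cs w')" using w(1) by (rule dvd_diff[rotated])
      moreover have "qpoly cs w - (qpoly cs w - qpoly cs w') = qpoly cs w'" by simp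
      ultimately have "f dvd qpoly cs w'" by (simp only:)
      moreover have "\<exists>i<?n. \<not> f dvd w' i" using w(2) by (auto simp: w'_def dvd_mod_iff)
      moreover have "degree (w' i) \<le> degree f - 1" for i
        using degree_mod_less[OF f0, of "w i"] by (auto simp: w'_def)
      ultimately have "bad (degree f - 1)" unfolding bad_def by blast
      moreover have "degree f - 1 < D" using \<open>\<not> D < degree f\<close> less.prems(2) by (cases "degree f") auto
      ultimately show False using D(2) by blast
    qed
    obtain k where k: "k < ?n" "degree (w k) = D" "w k \<noteq> 0"
    proof (cases "D = 0")
      case True
      then show ?thesis using that w(2,3) by (metis dvd_0_right le_zero_eq)
    next
      case False
      have "\<exists>k<?n. degree (w k) = D"
      proof (rule ccontr)
        assume "\<not> (\<exists>k<?n. degree (w k) = D)"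
        then have "degree (w i) \<noteq> D" if "i < ?n" for i using that by blast
        then have "degree (w i) \<le> D - 1" if "i < ?n" for i using w(3)[OF that] that by fastforce
        then have "bad (D - 1)" unfolding bad_def using w by blast
        then show False using D(2)[of "D - 1"] False by simp
      qed
      then show ?thesis using that False by (metis degree_0)
    qed
    have Q: "degree (qpoly cs w) = 2 * D" "qpoly cs w \<noteq> 0"
      using degree_qpoly[of cs w D k, OF aniso w(3) k] by auto
    obtain g where g: "qpoly cs w = f * g" using w(1) by (elim dvdE)
    then have g0: "g \<noteq> 0" using Q by auto
    have deg: "degree f + degree g = 2 * D" using Q(1) g f0 g0 by (simp add: degree_mult_eq)
    then have "odd (degree g)" using less.prems(2) by presburger
    then obtain p where p: "irreducible p" "odd (degree p)" "p dvd g" using odd_degree_irreducible_factor by blast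
    have "degree p \<le> degree g" using p g0 by (simp add: dvd_imp_degree_le)
    then have lt: "degree p < degree f" using deg small by linarith
    have "p dvd qpoly cs w" using p g by simp
    then have pd: "p dvd w i" if "i < ?n" for i using less.hyps[OF lt p(1,2)] that by blast
    define w' where "w' = (\<lambda>i. w i div p)"
    have w': "w i = p * w' i" if "i < ?n" for i using pd[OF that] by (simp add: w'_def)
    have p0: "p \<noteq> 0" using p by auto
    have "\<not> f dvd p" using lt p0 dvd_imp_degree_le[of f p] by auto
    have "qpoly cs w = p\<^sup>2 * qpoly cs w'"
      by (simp add: qpoly_def w' sum_distrib_left power_mult_distrib)
    then have "f dvd qpoly cs w'"
      using w(1) f \<open>\<not> f dvd p\<close> by (metis prime_elem_dvd_mult_iff prime_elem_dvd_power)
    moreover have "\<exists>i<?n. \<not> f dvd w' i" using w(2) w' by (metis dvd_mult)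
    moreover have "degree (w' i) \<le> D - 1" if "i < ?n" for i
    proof (cases "w' i = 0")
      case False
      then have "degree (w i) = degree p + degree (w' i)" using w'[OF that] p0 by (simp add: degree_mult_eq)
      moreover have "degree p > 0" using p(2) by (cases "degree p") auto
      ultimately show ?thesis using w(3)[OF that] by linarith
    qed simp
    ultimately have "bad (D - 1)" unfolding bad_def by blast
    moreover have "D > 0" using deg less.prems(2) by (cases D) auto
    ultimately show False using D(2) by simp
  qed
qed

section \<open>Quadratic spaces over a subfield\<close>

text \<open>
  The scalars act on the ambient type for all of the field type, but the form \<open>b\<close> is bilinear only
  over the subfield \<open>F\<close>.  In this way the same ambient space carries forms over different subfields.
\<close>

locale quad_space = coeff_field_not2 F for F :: "'f::field set" +
  fixes sc :: "'f \<Rightarrow> 'v::ab_group_add \<Rightarrow> 'v" and b :: "'v \<Rightarrow> 'v \<Rightarrow> 'f"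
  assumes sc_add: "sc c (x + y) = sc c x + sc c y"
    and sc_add_left: "sc (c + d) x = sc c x + sc d x"
    and sc_assoc: "sc c (sc d x) = sc (c * d) x"
    and sc_one [simp]: "sc 1 x = x"
    and b_add: "b (x + y) z = b x z + b y z"
    and b_scale: "c \<in> F \<Longrightarrow> b (sc c x) z = c * b x z"
    and b_sym: "b x y = b y x"
begin

lemma sc_zero [simp]: "sc 0 x = 0" "sc c 0 = 0"
  using sc_add_left[of 0 0 x] sc_add[of c 0 0] by simp_all

lemma sc_uminus: "sc (- 1) x = - x"
  using sc_add_left[of 1 "- 1" x] by (simp add: eq_neg_iff_add_eq_0 add.commute)

lemma b_add_right: "b z (x + y) = b z x + b z y"
  and b_scale_right: "c \<in> F \<Longrightarrow> b z (sc c x) = c * b z x"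
  by (simp_all add: b_add b_scale b_sym[of z])

lemma b_uminus [simp]: "b (- x) z = - b x z" "b z (- x) = - b z x"
  using b_scale[of "- 1" x z] b_scale_right[of "- 1" z x] by (simp_all add: sc_uminus)

lemma b_zero [simp]: "b 0 z = 0" "b z 0 = 0"
  using b_scale[of 0 0 z] b_scale_right[of 0 z 0] by simp_all

lemma b_diff: "b (x - y) z = b x z - b y z"
  using b_add[of x "- y" z] by simp

definition subsp :: "'v set \<Rightarrow> bool" where
  "subsp V \<longleftrightarrow> 0 \<in> V \<and> (\<forall>x\<in>V. \<forall>y\<in>V. x + y \<in> V) \<and> (\<forall>c\<in>F. \<forall>x\<in>V. sc c x \<in> V)"

lemma subspD:
  assumes "subsp V"
  shows "0 \<in> V" "x \<in> V \<Longrightarrow> y \<in> V \<Longrightarrow> x + y \<in> V" "c \<in> F \<Longrightarrow> x \<in> V \<Longrightarrow> sc c x \<in> V"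
    "x \<in> V \<Longrightarrow> - x \<in> V" "x \<in> V \<Longrightarrow> y \<in> V \<Longrightarrow> x - y \<in> V"
proof -
  show 1: "0 \<in> V" "x \<in> V \<Longrightarrow> y \<in> V \<Longrightarrow> x + y \<in> V" "c \<in> F \<Longrightarrow> x \<in> V \<Longrightarrow> sc c x \<in> V" for x y c
    using assms by (auto simp: subsp_def)
  show 2: "x \<in> V \<Longrightarrow> - x \<in> V" for x using 1(3)[of "- 1" x] by (simp add: sc_uminus)
  show "x \<in> V \<Longrightarrow> y \<in> V \<Longrightarrow> x - y \<in> V" using 1(2)[of x "- y"] 2[of y] by simp
qed

text \<open>
  Coordinates with respect to an orthogonal basis, that is, a linear isometry of the diagonal form onto
  \<open>V\<close>.
\<close>

definition coordinates :: "'v set \<Rightarrow> 'f list \<Rightarrow> ((nat \<Rightarrow> 'f) \<Rightarrow> 'v) \<Rightarrow> bool" where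
  "coordinates V cs \<phi> \<longleftrightarrow>
     bij_betw \<phi> (vecs F (length cs)) V \<and>
     (\<forall>x\<in>vecs F (length cs). \<forall>y\<in>vecs F (length cs). \<phi> (\<lambda>i. x i + y i) = \<phi> x + \<phi> y) \<and>
     (\<forall>c\<in>F. \<forall>x\<in>vecs F (length cs). \<phi> (\<lambda>i. c * x i) = sc c (\<phi> x)) \<and>
     (\<forall>x\<in>vecs F (length cs). b (\<phi> x) (\<phi> x) = qval cs x)"

definition has_type :: "'v set \<Rightarrow> 'f list \<Rightarrow> bool" where
  "has_type V cs \<longleftrightarrow> units cs \<and> (\<exists>\<phi>. coordinates V cs \<phi>)"

lemma coordinatesD:
  assumes "coordinates V cs \<phi>"
  shows "bij_betw \<phi> (vecs F (length cs)) V"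
    "x \<in> vecs F (length cs) \<Longrightarrow> \<phi> x \<in> V"
    "x \<in> vecs F (length cs) \<Longrightarrow> y \<in> vecs F (length cs) \<Longrightarrow> \<phi> (\<lambda>i. x i + y i) = \<phi> x + \<phi> y"
    "c \<in> F \<Longrightarrow> x \<in> vecs F (length cs) \<Longrightarrow> \<phi> (\<lambda>i. c * x i) = sc c (\<phi> x)"
    "x \<in> vecs F (length cs) \<Longrightarrow> b (\<phi> x) (\<phi> x) = qval cs x"
  using assms unfolding coordinates_def by (auto simp: bij_betw_def)

lemma coordinates_zero: "coordinates V cs \<phi> \<Longrightarrow> \<phi> (\<lambda>_. 0) = 0"
  using coordinatesD(4)[of V cs \<phi> 0 "\<lambda>_. 0"] by simp

lemma coordinates_bil:
  assumes "coordinates V cs \<phi>" "x \<in> vecs F (length cs)" "y \<in> vecs F (length cs)"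
  shows "b (\<phi> x) (\<phi> y) = bil cs x y"
proof -
  have "b (\<phi> x + \<phi> y) (\<phi> x + \<phi> y) = qval cs (\<lambda>i. x i + y i)"
    using coordinatesD(5)[OF assms(1) vecs_add[OF assms(2,3)]] coordinatesD(3)[OF assms] by simp
  then have "2 * b (\<phi> x) (\<phi> y) = 2 * bil cs x y"
    using coordinatesD(5)[OF assms(1)] assms(2,3) by (simp add: qval_add b_add b_add_right b_sym[of "\<phi> y" "\<phi> x"])
  then show ?thesis by simp
qed

lemma has_type_subsp: assumes "has_type V cs" shows "subsp V"
proof -
  obtain \<phi> where \<phi>: "coordinates V cs \<phi>" using assms by (auto simp: has_type_def)
  let ?X = "vecs F (length cs)"
  have im: "V = \<phi> ` ?X" using coordinatesD(1)[OF \<phi>] by (auto simp: bij_betw_def)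
  show ?thesis unfolding subsp_def im
  proof (intro conjI ballI; (elim imageE)?)
    show "0 \<in> \<phi> ` ?X" using coordinates_zero[OF \<phi>] by (intro image_eqI[where x = "\<lambda>_. 0"]) auto
    show "p + q \<in> \<phi> ` ?X" if "p = \<phi> x" "x \<in> ?X" "q = \<phi> y" "y \<in> ?X" for p q x y
      using coordinatesD(3)[OF \<phi>, of x y] that by (intro image_eqI[where x = "\<lambda>i. x i + y i"]) auto
    show "sc c p \<in> \<phi> ` ?X" if "c \<in> F" "p = \<phi> x" "x \<in> ?X" for c p x
      using coordinatesD(4)[OF \<phi>, of c x] that by (intro image_eqI[where x = "\<lambda>i. c * x i"]) auto
  qed
qed

theorem has_type_unique: assumes "has_type V cs" "has_type V ds" shows "isom F cs ds"
proof -
  obtain \<phi> \<psi> where \<phi>: "coordinates V cs \<phi>" and \<psi>: "coordinates V ds \<psi>"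
    using assms by (auto simp: has_type_def)
  let ?X = "vecs F (length cs)" and ?Y = "vecs F (length ds)"
  define \<psi>' where "\<psi>' = inv_into ?Y \<psi>"
  have \<psi>': "\<psi>' v \<in> ?Y" "\<psi> (\<psi>' v) = v" if "v \<in> V" for v
    using coordinatesD(1)[OF \<psi>] that unfolding \<psi>'_def by (auto simp: bij_betw_def inv_into_into f_inv_into_f)
  have \<psi>'': "\<psi>' (\<psi> y) = y" if "y \<in> ?Y" for y
    using coordinatesD(1)[OF \<psi>] that unfolding \<psi>'_def by (auto simp: bij_betw_def)
  have "bij_betw \<psi>' V ?Y" unfolding \<psi>'_def by (rule bij_betw_inv_into[OF coordinatesD(1)[OF \<psi>]])
  then have "bij_betw (\<psi>' \<circ> \<phi>) ?X ?Y" using bij_betw_trans[OF coordinatesD(1)[OF \<phi>]] by blast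
  moreover have "(\<psi>' \<circ> \<phi>) (\<lambda>i. x i + y i) = (\<lambda>i. (\<psi>' \<circ> \<phi>) x i + (\<psi>' \<circ> \<phi>) y i)" if "x \<in> ?X" "y \<in> ?X" for x y
  proof -
    have v: "\<phi> x \<in> V" "\<phi> y \<in> V" using that coordinatesD(2)[OF \<phi>] by auto
    have "\<psi> (\<lambda>i. \<psi>' (\<phi> x) i + \<psi>' (\<phi> y) i) = \<phi> x + \<phi> y"
      using coordinatesD(3)[OF \<psi> \<psi>'(1)[OF v(1)] \<psi>'(1)[OF v(2)]] \<psi>'(2) v by simp
    then show ?thesis using \<psi>''[OF vecs_add[OF \<psi>'(1)[OF v(1)] \<psi>'(1)[OF v(2)]]] coordinatesD(3)[OF \<phi> that] by simp
  qed
  moreover have "(\<psi>' \<circ> \<phi>) (\<lambda>i. c * x i) = (\<lambda>i. c * (\<psi>' \<circ> \<phi>) x i)" if "c \<in> F" "x \<in> ?X" for c x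
  proof -
    have v: "\<phi> x \<in> V" using that coordinatesD(2)[OF \<phi>] by auto
    have "\<psi> (\<lambda>i. c * \<psi>' (\<phi> x) i) = sc c (\<phi> x)"
      using coordinatesD(4)[OF \<psi> that(1) \<psi>'(1)[OF v]] \<psi>'(2) v by simp
    then show ?thesis using \<psi>''[OF vecs_scale[OF that(1) \<psi>'(1)[OF v]]] coordinatesD(4)[OF \<phi> that] by simp
  qed
  moreover have "qval ds ((\<psi>' \<circ> \<phi>) x) = qval cs x" if "x \<in> ?X" for x
  proof -
    have v: "\<phi> x \<in> V" using that coordinatesD(2)[OF \<phi>] by auto
    show ?thesis using coordinatesD(5)[OF \<psi> \<psi>'(1)[OF v]] coordinatesD(5)[OF \<phi> that] \<psi>'(2)[OF v] by simp
  qed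
  ultimately have "isom_map F cs ds (\<psi>' \<circ> \<phi>)" unfolding isom_map_def by blast
  then show ?thesis by (auto simp: isom_def)
qed

lemma has_type_nondegenerate:
  assumes "has_type V cs" "v \<in> V" "\<And>u. u \<in> V \<Longrightarrow> b v u = 0" shows "v = 0"
proof -
  obtain \<phi> where \<phi>: "coordinates V cs \<phi>" and cs: "units cs" using assms by (auto simp: has_type_def)
  obtain x where x: "x \<in> vecs F (length cs)" "v = \<phi> x"
    using assms(2) coordinatesD(1)[OF \<phi>] by (auto simp: bij_betw_def)
  have "x i = 0" for i
  proof (cases "i < length cs")
    case True
    have "bil cs x (std_vec i) = 0"
      using coordinates_bil[OF \<phi> x(1) std_vec_mem[OF True]] assms(3) coordinatesD(2)[OF \<phi> std_vec_mem[OF True]] x(2) by simp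
    then have "cs ! i * x i = 0" using bil_std_vec[OF True] by simp
    then show ?thesis using units_nth[OF cs True] by simp
  qed (use x in \<open>auto simp: vecs_def\<close>)
  then have "x = (\<lambda>_. 0)" by auto
  then show ?thesis using x coordinates_zero[OF \<phi>] by simp
qed

lemma Riesz:
  assumes U: "has_type U cs"
    and add: "\<And>x y. x \<in> U \<Longrightarrow> y \<in> U \<Longrightarrow> h (x + y) = h x + h y"
    and scale: "\<And>c x. c \<in> F \<Longrightarrow> x \<in> U \<Longrightarrow> h (sc c x) = c * h x"
    and mem: "\<And>x. x \<in> U \<Longrightarrow> h x \<in> F"
  shows "\<exists>u\<in>U. \<forall>x\<in>U. b u x = h x"
proof -
  obtain \<phi> where \<phi>: "coordinates U cs \<phi>" and cs: "units cs" using assms by (auto simp: has_type_def)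
  let ?X = "vecs F (length cs)"
  define w where "w = (\<lambda>i. if i < length cs then h (\<phi> (std_vec i)) / cs ! i else 0)"
  have w: "w \<in> ?X" using mem coordinatesD(2)[OF \<phi> std_vec_mem] units_nth[OF cs]
    by (auto simp: w_def vecs_def intro!: divide_mem)
  have "b (\<phi> w) u' = h u'" if u': "u' \<in> U" for u'
  proof -
    obtain x where x: "x \<in> ?X" "u' = \<phi> x"
      using u' coordinatesD(1)[OF \<phi>] by (auto simp: bij_betw_def)
    have "h (\<phi> x) = (\<Sum>j<length cs. x j * h (\<phi> (std_vec j)))"
      using x(1) coordinatesD(2,3,4)[OF \<phi>] by (intro linear_expand) (auto simp: add scale)
    also have "\<dots> = bil cs w x" unfolding bil_def
      using units_nth[OF cs] by (intro sum.cong) (auto simp: w_def)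
    finally show ?thesis using coordinates_bil[OF \<phi> w x(1)] x by simp
  qed
  then show ?thesis using coordinatesD(2)[OF \<phi> w] by blast
qed

lemma orthogonal_projection:
  assumes "has_type U cs" "\<And>u. u \<in> U \<Longrightarrow> b v u \<in> F"
  shows "\<exists>u\<in>U. \<forall>u'\<in>U. b (v - u) u' = 0"
proof -
  obtain u where "u \<in> U" "\<forall>x\<in>U. b u x = b v x"
    using Riesz[OF assms(1), of "b v"] assms(2) by (auto simp: b_add_right b_scale_right)
  then show ?thesis by (intro bexI[of _ u]) (simp_all add: b_diff)
qed

definition osum :: "'v set \<Rightarrow> 'v set \<Rightarrow> 'v set \<Rightarrow> bool" where
  "osum V U W \<longleftrightarrow> V = {u + w | u w. u \<in> U \<and> w \<in> W} \<and> (\<forall>u\<in>U. \<forall>w\<in>W. b u w = 0)"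

text \<open>
  The sum is direct, as a common vector would be orthogonal to all of \<open>U\<close>.
\<close>

lemma osum_has_type:
  assumes "osum V U W" "has_type U cs" "has_type W ds" shows "has_type V (cs @ ds)"
proof -
  obtain \<phi> where \<phi>: "coordinates U cs \<phi>" and cs: "units cs" using assms by (auto simp: has_type_def)
  obtain \<psi> where \<psi>: "coordinates W ds \<psi>" and ds: "units ds" using assms by (auto simp: has_type_def)
  let ?n = "length cs" and ?m = "length ds"
  let ?f = "\<lambda>x. \<phi> (vtake ?n x) + \<psi> (vdrop ?n x)"
  have orth: "b u w = 0" if "u \<in> U" "w \<in> W" for u w using assms(1) that by (auto simp: osum_def)
  have zero: "u = 0 \<and> w = 0" if "u \<in> U" "w \<in> W" "u + w = 0" for u w
  proof -
    have u: "u = - w" using that(3) by (simp add: eq_neg_iff_add_eq_0)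
    have "u = 0"
    proof (rule has_type_nondegenerate[OF assms(2) that(1)])
      fix u' assume "u' \<in> U"
      then have "b u' w = 0" using orth that by blast
      then show "b u u' = 0" unfolding u by (simp add: b_sym)
    qed
    then show ?thesis using that by simp
  qed
  have inj1: "x = y" if "\<phi> x = \<phi> y" "x \<in> vecs F ?n" "y \<in> vecs F ?n" for x y
    using coordinatesD(1)[OF \<phi>] that by (auto simp: bij_betw_def inj_on_def)
  have inj2: "x = y" if "\<psi> x = \<psi> y" "x \<in> vecs F ?m" "y \<in> vecs F ?m" for x y
    using coordinatesD(1)[OF \<psi>] that by (auto simp: bij_betw_def inj_on_def)
  have "bij_betw ?f (vecs F (?n + ?m)) V"
    unfolding bij_betw_def
  proof
    show "inj_on ?f (vecs F (?n + ?m))"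
    proof
      fix x y assume xy: "x \<in> vecs F (?n + ?m)" "y \<in> vecs F (?n + ?m)" "?f x = ?f y"
      have "\<phi> (vtake ?n x) - \<phi> (vtake ?n y) = 0 \<and> \<psi> (vdrop ?n x) - \<psi> (vdrop ?n y) = 0"
        using xy coordinatesD(2)[OF \<phi>] coordinatesD(2)[OF \<psi>]
        by (intro zero subspD(5)[OF has_type_subsp[OF assms(2)]] subspD(5)[OF has_type_subsp[OF assms(3)]])
           (auto simp: algebra_simps)
      then have "vtake ?n x = vtake ?n y" "vdrop ?n x = vdrop ?n y" using inj1 inj2 xy by auto
      then show "x = y" by (metis vjoin_take_drop)
    qed
    show "?f ` vecs F (?n + ?m) = V"
    proof (intro equalityI subsetI)
      fix v assume "v \<in> ?f ` vecs F (?n + ?m)"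
      then obtain x where x: "x \<in> vecs F (?n + ?m)" "v = ?f x" by blast
      have "\<phi> (vtake ?n x) \<in> U" "\<psi> (vdrop ?n x) \<in> W"
        using x coordinatesD(2)[OF \<phi>] coordinatesD(2)[OF \<psi>] by auto
      with x(2) show "v \<in> V" using assms(1) unfolding osum_def by blast
    next
      fix v assume "v \<in> V"
      then obtain u w where uw: "u \<in> U" "w \<in> W" "v = u + w" using assms(1) by (auto simp: osum_def)
      obtain x y where xy: "x \<in> vecs F ?n" "u = \<phi> x" "y \<in> vecs F ?m" "w = \<psi> y"
        using uw coordinatesD(1)[OF \<phi>] coordinatesD(1)[OF \<psi>] by (auto simp: bij_betw_def)
      then have "?f (vjoin ?n x y) = v" using uw by simp
      then show "v \<in> ?f ` vecs F (?n + ?m)" using vjoin_mem[OF xy(1,3)] by blast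
    qed
  qed
  then have "coordinates V (cs @ ds) ?f"
    unfolding coordinates_def
    using orth coordinatesD[OF \<phi>] coordinatesD[OF \<psi>]
    by (auto simp: vtake_add vtake_scale vdrop_add vdrop_scale sc_add b_add b_add_right
        qval_append b_sym[of "\<psi> _" "\<phi> _"] algebra_simps)
  then show ?thesis using cs ds by (auto simp: has_type_def)
qed

lemma has_type_zero [simp]: "has_type {0} []"
proof -
  have "coordinates {0} [] (\<lambda>_. 0)" by (auto simp: coordinates_def bij_betw_def)
  then show ?thesis by (auto simp: has_type_def)
qed

lemma has_type_line:
  assumes "b e e \<in> F" "b e e \<noteq> 0" shows "has_type {sc c e | c. c \<in> F} [b e e]"
proof -
  have "c = d" if "sc c e = sc d e" "c \<in> F" "d \<in> F" for c d
  proof -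
    have "c * b e e = b (sc d e) e" using that(2) by (simp add: b_scale flip: that(1))
    then show ?thesis using that(3) assms(2) by (simp add: b_scale)
  qed
  then have inj: "inj_on (\<lambda>x. sc (x 0) e) (vecs F 1)"
    by (auto simp: inj_on_def vecs_def fun_eq_iff) (metis le_0_eq not_less_eq_eq One_nat_def)
  have "(\<lambda>x. sc (x 0) e) ` vecs F 1 = {sc c e | c. c \<in> F}"
  proof (intro equalityI subsetI)
    fix v assume "v \<in> {sc c e | c. c \<in> F}"
    then obtain c where "c \<in> F" "v = sc c e" by auto
    then show "v \<in> (\<lambda>x. sc (x 0) e) ` vecs F 1"
      by (intro image_eqI[of _ _ "\<lambda>i. if i = 0 then c else 0"]) (auto simp: vecs_def)
  qed (auto simp: vecs_def)
  then have "coordinates {sc c e | c. c \<in> F} [b e e] (\<lambda>x. sc (x 0) e)"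
    using inj by (auto simp: coordinates_def bij_betw_def sc_add_left sc_assoc vecs_def b_scale b_scale_right
        qval_def power2_eq_square algebra_simps)
  then show ?thesis using assms by (auto simp: has_type_def)
qed

lemma has_type_extend:
  assumes "has_type U cs" "\<And>u. u \<in> U \<Longrightarrow> b w u = 0" "b w w \<in> F" "b w w \<noteq> 0"
  shows "has_type {u + sc c w | u c. u \<in> U \<and> c \<in> F} (cs @ [b w w])"
proof (rule osum_has_type[OF _ assms(1) has_type_line[OF assms(3,4)]])
  have "b u w = 0" if "u \<in> U" for u using assms(2)[OF that] by (simp add: b_sym)
  then show "osum {u + sc c w | u c. u \<in> U \<and> c \<in> F} U {sc c w | c. c \<in> F}"
    by (auto simp: osum_def b_scale_right)
qed

definition nondeg :: "'v set \<Rightarrow> bool" where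
  "nondeg V \<longleftrightarrow> subsp V \<and> (\<forall>x\<in>V. \<forall>y\<in>V. b x y \<in> F) \<and> (\<forall>x\<in>V. (\<forall>y\<in>V. b x y = 0) \<longrightarrow> x = 0)"

text \<open>
  A form of finite dimensionality for \<open>V\<close> that needs no notion of dimension over \<open>F\<close>.
\<close>

definition bounded :: "'v set \<Rightarrow> bool" where
  "bounded V \<longleftrightarrow> (\<exists>N. \<forall>U cs. U \<subseteq> V \<longrightarrow> has_type U cs \<longrightarrow> length cs \<le> N)"

lemma bounded_subset: "bounded V \<Longrightarrow> U \<subseteq> V \<Longrightarrow> bounded U"
  unfolding bounded_def by (meson order_trans)

text \<open>
  An orthogonal basis of a maximal subspace having the property \<open>P\<close> is one of the whole
  space, provided that \<open>P\<close> can always be propagated beyond a further anisotropic vector.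
\<close>

lemma exhaust:
  assumes V: "nondeg V" "bounded V" and P0: "P {0} []"
    and step: "\<And>U cs w. P U cs \<Longrightarrow> has_type U cs \<Longrightarrow> U \<subseteq> V \<Longrightarrow> w \<in> V \<Longrightarrow> (\<forall>u\<in>U. b w u = 0) \<Longrightarrow>
      b w w \<noteq> 0 \<Longrightarrow> \<exists>U' cs'. P U' cs' \<and> has_type U' cs' \<and> U' \<subseteq> V \<and> length cs < length cs'"
  shows "\<exists>cs. P V cs \<and> has_type V cs"
proof -
  have sV: "subsp V" and VF: "\<And>x y. x \<in> V \<Longrightarrow> y \<in> V \<Longrightarrow> b x y \<in> F" using V(1) by (auto simp: nondeg_def)
  obtain N where N: "\<And>U cs. U \<subseteq> V \<Longrightarrow> has_type U cs \<Longrightarrow> length cs \<le> N" using V(2) by (auto simp: bounded_def)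
  define Q where "Q = (\<lambda>n. \<exists>U cs. P U cs \<and> has_type U cs \<and> U \<subseteq> V \<and> length cs = n)"
  have "Q 0" unfolding Q_def using P0 subspD(1)[OF sV] by (intro exI[of _ "{0}"] exI[of _ "[]"]) auto
  moreover have "\<forall>n. Q n \<longrightarrow> n \<le> N" using N by (auto simp: Q_def)
  ultimately obtain n where n: "Q n" "\<And>m. Q m \<Longrightarrow> m \<le> n" by (metis GreatestI_nat Greatest_le_nat)
  then obtain U cs where U: "P U cs" "has_type U cs" "U \<subseteq> V" "length cs = n" by (auto simp: Q_def)
  have "V \<subseteq> U"
  proof
    fix v assume v: "v \<in> V"
    have "b v u \<in> F" if "u \<in> U" for u using VF v U(3) that by blast
    then obtain u where u: "u \<in> U" "\<forall>u'\<in>U. b (v - u) u' = 0"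
      using orthogonal_projection[OF U(2), of v] by blast
    let ?w = "v - u"
    have w: "?w \<in> V" using u v U(3) subspD(5)[OF sV] by blast
    have sq: "b w w = 0" if "w \<in> V" "\<forall>u\<in>U. b w u = 0" for w
      using step[OF U(1-3) that] n(2) U(4) unfolding Q_def by (metis not_less)
    have "b ?w y = 0" if "y \<in> V" for y
    proof -
      have "b y u \<in> F" if "u \<in> U" for u using VF \<open>y \<in> V\<close> U(3) that by blast
      then obtain u' where u': "u' \<in> U" "\<forall>u''\<in>U. b (y - u') u'' = 0"
        using orthogonal_projection[OF U(2), of y] by blast
      let ?y = "y - u'"
      have y: "?y \<in> V" using u' that U(3) subspD(5)[OF sV] by blast
      have "\<forall>u\<in>U. b (?w + ?y) u = 0" using u(2) u'(2) by (simp only: b_add) simp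
      then have "b (?w + ?y) (?w + ?y) = 0" using subspD(2)[OF sV w y] by (intro sq)
      moreover have "b ?w ?w = 0" "b ?y ?y = 0" using sq[OF w u(2)] sq[OF y u'(2)] .
      ultimately have "2 * b ?w ?y = 0" by (simp only: b_add[of ?w ?y] b_add_right[of _ ?w ?y] b_sym[of ?y ?w]) simp
      then have "b ?w ?y = 0" by simp
      moreover have "b ?w y = b ?w ?y + b ?w u'" using b_add_right[of ?w ?y u'] by simp
      ultimately show ?thesis using u u' by simp
    qed
    then have "?w = 0" using V(1) w unfolding nondeg_def by blast
    then show "v \<in> U" using u by simp
  qed
  then have "U = V" using U(3) by auto
  then show ?thesis using U by blast
qed

lemma orthogonal_basis: assumes "nondeg V" "bounded V" shows "\<exists>cs. has_type V cs"
proof -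
  have "\<exists>cs. True \<and> has_type V cs"
  proof (rule exhaust[OF assms])
    fix U cs w assume a: "has_type U cs" "U \<subseteq> V" "w \<in> V" "\<forall>u\<in>U. b w u = 0" "b w w \<noteq> 0"
    have sV: "subsp V" and "b w w \<in> F" using assms(1) a by (auto simp: nondeg_def)
    then have "has_type {u + sc c w | u c. u \<in> U \<and> c \<in> F} (cs @ [b w w])"
      using a by (intro has_type_extend) auto
    moreover have "{u + sc c w | u c. u \<in> U \<and> c \<in> F} \<subseteq> V"
      using a subspD(2,3)[OF sV] by blast
    ultimately show "\<exists>U' cs'. True \<and> has_type U' cs' \<and> U' \<subseteq> V \<and> length cs < length cs'"
      by (intro exI[of _ "{u + sc c w | u c. u \<in> U \<and> c \<in> F}"] exI[of _ "cs @ [b w w]"]) simp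
  qed simp
  then show ?thesis by simp
qed

end

text \<open>
  Pairwise orthogonal anisotropic vectors are linearly independent over any field \<open>'k\<close> of scalars with
  respect to which the form is semilinear, in particular over a field smaller than \<open>F\<close>.
\<close>

lemma (in quad_space) bounded_of_spanning:
  fixes scale :: "'k::field \<Rightarrow> 'v \<Rightarrow> 'v"
  assumes vs: "vector_space scale" and B: "finite B" "module.span scale B = UNIV"
    and lin: "\<And>c x y. b (scale c x) y = h c * b x y" and h: "\<And>c. h c = 0 \<Longrightarrow> c = 0"
  shows "bounded V"
  unfolding bounded_def
proof (intro exI[of _ "card B"] allI impI)
  fix U cs assume "has_type U cs"
  then obtain \<phi> where \<phi>: "coordinates U cs \<phi>" and cs: "units cs" by (auto simp: has_type_def)
  interpret vector_space scale by (rule vs)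
  define e where "e = (\<lambda>i. \<phi> (std_vec i))"
  have be: "b (e j) (e i) = (if j = i then cs ! i else 0)" if "i < length cs" "j < length cs" for i j
  proof -
    have "b (e j) (e i) = bil cs (std_vec j) (std_vec i)"
      unfolding e_def by (rule coordinates_bil[OF \<phi> std_vec_mem[OF that(2)] std_vec_mem[OF that(1)]])
    also have "\<dots> = (if j = i then cs ! i else 0)" using bil_std_vec[OF that(1)] by (simp add: std_vec_def)
    finally show ?thesis .
  qed
  have inj: "inj_on e {..<length cs}"
  proof
    fix i j assume ij: "i \<in> {..<length cs}" "j \<in> {..<length cs}" "e i = e j"
    then show "i = j" using be[of i j] be[of i i] units_nth[OF cs, of i] by (auto split: if_splits)
  qed
  have bsum: "b (sum f A) y = (\<Sum>a\<in>A. b (f a) y)" for f :: "'v \<Rightarrow> 'v" and A y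
    by (induction A rule: infinite_finite_induct) (auto simp: b_add)
  have "independent (e ` {..<length cs})"
    unfolding independent_explicit_module
  proof (intro allI impI)
    fix t u v assume t: "finite t" "t \<subseteq> e ` {..<length cs}" "(\<Sum>v\<in>t. scale (u v) v) = 0" "v \<in> t"
    then obtain i where i: "i < length cs" "v = e i" by auto
    have "0 = b (\<Sum>v\<in>t. scale (u v) v) v" using t(3) by simp
    also have "\<dots> = (\<Sum>w\<in>t. h (u w) * b w v)" by (simp add: bsum lin)
    also have "\<dots> = (\<Sum>w\<in>t. if w = v then h (u v) * cs ! i else 0)"
    proof (rule sum.cong[OF refl])
      fix w assume "w \<in> t"
      then obtain j where j: "j < length cs" "w = e j" using t by auto
      show "h (u w) * b w v = (if w = v then h (u v) * cs ! i else 0)"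
        using be[OF i(1) j(1)] be[OF i(1) i(1)] i j by auto
    qed
    also have "\<dots> = h (u v) * cs ! i" using t by simp
    finally have "h (u v) = 0" using units_nth[OF cs i(1)] by simp
    then show "u v = 0" by (rule h)
  qed
  then have "card (e ` {..<length cs}) \<le> card B" using independent_span_bound[OF B(1)] B(2) by auto
  then show "length cs \<le> card B" by (simp add: card_image[OF inj])
qed

section \<open>Splitting off hyperbolic spaces by isometries of 2-power order\<close>

locale quad_space_i = quad_space F sc b + coeff_field_i F
  for F :: "'f::field set" and sc :: "'f \<Rightarrow> 'v::ab_group_add \<Rightarrow> 'v" and b :: "'v \<Rightarrow> 'v \<Rightarrow> 'f"
begin

lemma eq_uminus_self: assumes "x = - x" shows "x = (0 :: 'f)"
proof -
  have "x + x = - x + x" by (rule arg_cong[OF assms])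
  then have "2 * x = 0" by (simp only: mult_2) simp
  then show ?thesis by simp
qed

lemma nondegD:
  assumes "nondeg V"
  shows "subsp V" "x \<in> V \<Longrightarrow> y \<in> V \<Longrightarrow> b x y \<in> F"
  using assms by (auto simp: nondeg_def)

lemma osum_left: assumes "osum V U W" "0 \<in> W" "x \<in> U" shows "x \<in> V"
proof -
  have "x + 0 \<in> V" using assms unfolding osum_def by blast
  then show ?thesis by simp
qed

lemma osum_commute: assumes "osum V U W" shows "osum V W U"
proof -
  have "{u + w | u w. u \<in> U \<and> w \<in> W} = {w + u | w u. w \<in> W \<and> u \<in> U}"
    by (subst add.commute) blast
  moreover have "b w u = 0" if "u \<in> U" "w \<in> W" for u w
    using assms that b_sym[of w u] by (simp add: osum_def)
  ultimately show ?thesis using assms by (simp add: osum_def)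
qed

lemma nondeg_summand:
  assumes V: "nondeg V" "osum V U W" and U: "subsp U" and W: "subsp W"
  shows "nondeg U"
  unfolding nondeg_def
proof (intro conjI ballI impI)
  have sub: "x \<in> V" if "x \<in> U" for x
    by (rule osum_left[OF V(2) subspD(1)[OF W] that])
  show "b x y \<in> F" if "x \<in> U" "y \<in> U" for x y using nondegD(2)[OF V(1)] sub that by blast
  fix x assume x: "x \<in> U" "\<forall>y\<in>U. b x y = 0"
  have "b x v = 0" if "v \<in> V" for v
    using V(2) that x unfolding osum_def by (auto simp: b_add_right)
  then show "x = 0" using V(1) sub[OF x(1)] unfolding nondeg_def by blast
qed (rule U)

text \<open>
  Two notions for Witt classes of subspaces: \<open>hyp V\<close> says that the class of \<open>V\<close> is zero, and
  \<open>reduces V U\<close> that \<open>U\<close> is a subspace in the same class because its complement in \<open>V\<close> is \<open>hyp\<close>.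
\<close>

definition hyp :: "'v set \<Rightarrow> bool" where
  "hyp V \<longleftrightarrow> (\<exists>cs. has_type V cs \<and> wequiv F cs [])"

definition reduces :: "'v set \<Rightarrow> 'v set \<Rightarrow> bool" where
  "reduces V U \<longleftrightarrow> nondeg U \<and> U \<subseteq> V \<and> (\<exists>C. osum V U C \<and> hyp C)"

lemma hyp_zero [simp]: "hyp {0}"
  unfolding hyp_def using has_type_zero by (intro exI[of _ "[]"]) auto

lemma hyp_osum: "osum V U W \<Longrightarrow> hyp U \<Longrightarrow> hyp W \<Longrightarrow> hyp V"
  unfolding hyp_def using osum_has_type wequiv_append by fastforce

lemma osum_zero: "osum V V {0}"
  by (auto simp: osum_def)

lemma reduces_refl: "nondeg V \<Longrightarrow> reduces V V"
  unfolding reduces_def using osum_zero hyp_zero by blast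

lemma reduces_trans [trans]: assumes "reduces V U" "reduces U T" shows "reduces V T"
proof -
  obtain C where C: "osum V U C" "hyp C" using assms by (auto simp: reduces_def)
  obtain D where D: "osum U T D" "hyp D" using assms by (auto simp: reduces_def)
  let ?E = "{d + c | d c. d \<in> D \<and> c \<in> C}"
  have D0: "0 \<in> D" using D(2) has_type_subsp subspD(1) by (auto simp: hyp_def)
  have T0: "0 \<in> T" using assms(2) subspD(1) by (auto simp: reduces_def nondeg_def)
  have DU: "d \<in> U" if "d \<in> D" for d by (rule osum_left[OF osum_commute[OF D(1)] T0 that])
  have TU: "t \<in> U" if "t \<in> T" for t by (rule osum_left[OF D(1) D0 that])
  have "osum ?E D C" using C(1) DU unfolding osum_def by blast
  then have "hyp ?E" using hyp_osum C D by blast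
  moreover have "osum V T ?E"
    unfolding osum_def
  proof (intro conjI ballI)
    show "V = {u + w |u w. u \<in> T \<and> w \<in> ?E}"
    proof (intro equalityI subsetI)
      fix v assume "v \<in> V"
      then obtain t d c where "t \<in> T" "d \<in> D" "c \<in> C" "v = (t + d) + c"
        using C(1) D(1) unfolding osum_def by blast
      then have "v = t + (d + c)" by (simp add: add.assoc)
      then show "v \<in> {u + w |u w. u \<in> T \<and> w \<in> ?E}" using \<open>t \<in> T\<close> \<open>d \<in> D\<close> \<open>c \<in> C\<close> by blast
    next
      fix v assume "v \<in> {u + w |u w. u \<in> T \<and> w \<in> ?E}"
      then obtain t d c where tdc: "t \<in> T" "d \<in> D" "c \<in> C" "v = t + (d + c)" by blast
      then have "t + d \<in> U" "v = (t + d) + c" using D(1) unfolding osum_def by (blast, simp add: add.assoc)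
      then show "v \<in> V" using C(1) tdc(3) unfolding osum_def by blast
    qed
    fix t e assume "t \<in> T" "e \<in> ?E"
    then show "b t e = 0" using C(1) D(1) TU unfolding osum_def by (auto simp: b_add_right)
  qed
  ultimately show ?thesis using assms unfolding reduces_def by blast
qed

lemma reduces_zero_iff_hyp: "reduces V {0} \<longleftrightarrow> hyp V"
proof
  assume "reduces V {0}"
  then obtain C where "osum V {0} C" "hyp C" by (auto simp: reduces_def)
  moreover have "V = C" using \<open>osum V {0} C\<close> by (auto simp: osum_def)
  ultimately show "hyp V" by simp
next
  assume "hyp V"
  then have "0 \<in> V" using has_type_subsp subspD(1) by (auto simp: hyp_def)
  moreover have "osum V {0} V" by (auto simp: osum_def)
  moreover have "nondeg {0}" by (auto simp: nondeg_def subsp_def)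
  ultimately show "reduces V {0}" using \<open>hyp V\<close> unfolding reduces_def by blast
qed

lemma reduces_osum: "osum V U C \<Longrightarrow> nondeg U \<Longrightarrow> U \<subseteq> V \<Longrightarrow> hyp C \<Longrightarrow> reduces V U"
  unfolding reduces_def by blast

definition isometry :: "('v \<Rightarrow> 'v) \<Rightarrow> bool" where
  "isometry g \<longleftrightarrow> (\<forall>x y. g (x + y) = g x + g y) \<and> (\<forall>c\<in>F. \<forall>x. g (sc c x) = sc c (g x)) \<and>
     (\<forall>x y. b (g x) (g y) = b x y)"

lemma isometryD:
  assumes "isometry g"
  shows "g (x + y) = g x + g y" "c \<in> F \<Longrightarrow> g (sc c x) = sc c (g x)" "b (g x) (g y) = b x y"
    "g 0 = 0" "g (- x) = - g x"
proof -
  show 1: "g (x + y) = g x + g y" "c \<in> F \<Longrightarrow> g (sc c x) = sc c (g x)" "b (g x) (g y) = b x y" for x y c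
    using assms by (auto simp: isometry_def)
  show "g 0 = 0" "g (- x) = - g x" using 1(2)[of 0 0] 1(2)[of "- 1" x] by (simp_all add: sc_uminus)
qed

lemma isometry_comp: "isometry g \<Longrightarrow> isometry h \<Longrightarrow> isometry (g \<circ> h)"
  by (simp add: isometry_def)

lemma isometry_funpow: "isometry g \<Longrightarrow> isometry (g ^^ n)"
  by (induction n) (auto simp: isometry_comp, simp add: isometry_def)

lemma funpow_stable: "g ` V \<subseteq> V \<Longrightarrow> (g ^^ n) ` V \<subseteq> V"
  by (induction n) auto

lemma subsp_fixed: "isometry g \<Longrightarrow> subsp V \<Longrightarrow> subsp {x \<in> V. g x = x}"
proof -
  assume g: "isometry g" and V: "subsp V"
  show ?thesis using subspD(1-3)[OF V] by (simp add: subsp_def isometryD[OF g])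
qed

lemma subsp_antifixed: "isometry g \<Longrightarrow> subsp V \<Longrightarrow> subsp {x \<in> V. g x = - x}"
proof -
  assume g: "isometry g" and V: "subsp V"
  have "sc c (- x) = - sc c x" for c x by (simp only: sc_uminus[symmetric] sc_assoc mult.commute)
  then show ?thesis using subspD(1-3)[OF V] by (simp add: subsp_def isometryD[OF g])
qed

text \<open>
  If \<open>h\<close> is an isometry with \<open>h\<^sup>2 = - 1\<close>, then \<open>b x (h x) = b (h x) (h (h x)) = - b x (h x)\<close>,
  so the space is an orthogonal sum of planes \<open>\<langle>a, a\<rangle>\<close> spanned by some \<open>x\<close> and \<open>h x\<close>.
\<close>

lemma hyp_of_complex_structure:
  assumes V: "nondeg V" "bounded V" and h: "isometry h" "h ` V \<subseteq> V"
    and sq: "\<And>x. x \<in> V \<Longrightarrow> h (h x) = - x"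
  shows "hyp V"
proof -
  have "\<exists>cs. (h ` V \<subseteq> V \<and> wequiv F cs []) \<and> has_type V cs"
  proof (rule exhaust[OF V, where P = "\<lambda>U cs. h ` U \<subseteq> U \<and> wequiv F cs []"])
    show "h ` {0} \<subseteq> {0} \<and> wequiv F [] []" by (simp add: isometryD[OF h(1)])
  next
    fix U cs w assume U: "h ` U \<subseteq> U \<and> wequiv F cs []" "has_type U cs" "U \<subseteq> V"
      and w: "w \<in> V" "\<forall>u\<in>U. b w u = 0" "b w w \<noteq> 0"
    let ?a = "b w w"
    have sV: "subsp V" and aF: "?a \<in> F" using V(1) w by (auto simp: nondeg_def)
    have hw: "h w \<in> V" using h(2) w(1) by blast
    have hwu: "b (h w) u = 0" if "u \<in> U" for u
    proof -
      have "b (h w) u = b (h (h w)) (h u)" by (simp add: isometryD(3)[OF h(1)])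
      also have "\<dots> = - b w (h u)" using sq[OF w(1)] by simp
      also have "\<dots> = 0" using w(2) U(1) that by auto
      finally show ?thesis .
    qed
    have "b (h w) w = b (h (h w)) (h w)" by (simp add: isometryD(3)[OF h(1)])
    also have "\<dots> = - b (h w) w" using sq[OF w(1)] by (simp add: b_sym[of w "h w"])
    finally have hww: "b (h w) w = 0" by (rule eq_uminus_self)
    let ?U1 = "{u + sc c w | u c. u \<in> U \<and> c \<in> F}"
    let ?U2 = "{u + sc c (h w) | u c. u \<in> ?U1 \<and> c \<in> F}"
    have t1: "has_type ?U1 (cs @ [?a])" using U w aF by (intro has_type_extend) auto
    have "has_type ?U2 ((cs @ [?a]) @ [b (h w) (h w)])"
      by (rule has_type_extend[OF t1])
        (use hwu hww aF w isometryD(3)[OF h(1)] in \<open>auto simp: b_add_right b_scale_right\<close>)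
    then have t2: "has_type ?U2 (cs @ [?a, ?a])" by (simp add: isometryD(3)[OF h(1)])
    have "wequiv F (cs @ ([?a] @ [?a])) ([] @ [])"
      using U(1) aF w by (intro wequiv_append wequiv_double) auto
    then have wq: "wequiv F (cs @ [?a, ?a]) []" by simp
    have "u + sc c w + sc d (h w) \<in> V" if "u \<in> U" "c \<in> F" "d \<in> F" for u c d
      using that U(3) w hw by (intro subspD(2,3)[OF sV]) auto
    then have sub: "?U2 \<subseteq> V" by blast
    have "h ` ?U2 \<subseteq> ?U2"
    proof
      fix y assume "y \<in> h ` ?U2"
      then obtain u c d where ucd: "u \<in> U" "c \<in> F" "d \<in> F" "y = h (u + sc c w + sc d (h w))" by blast
      have "sc d (- w) = sc (- d) w" by (simp add: sc_uminus[symmetric] sc_assoc)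
      then have y: "y = (h u + sc (- d) w) + sc c (h w)"
        using ucd sq[OF w(1)] by (simp add: isometryD[OF h(1)])
      have "h u \<in> U" using ucd(1) U(1) by blast
      then have "h u + sc (- d) w \<in> ?U1" using uminus_mem[OF ucd(3)] by blast
      then show "y \<in> ?U2" unfolding y using ucd(2) by blast
    qed
    then show "\<exists>U' cs'. (h ` U' \<subseteq> U' \<and> wequiv F cs' []) \<and> has_type U' cs' \<and> U' \<subseteq> V \<and> length cs < length cs'"
      using t2 wq sub by (intro exI[of _ ?U2] exI[of _ "cs @ [?a, ?a]"]) simp
  qed
  then show ?thesis by (auto simp: hyp_def)
qed

lemma involution_split:
  assumes V: "nondeg V" and z: "isometry z" "z ` V \<subseteq> V" and zz: "\<And>x. x \<in> V \<Longrightarrow> z (z x) = x"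
  shows "osum V {x \<in> V. z x = x} {x \<in> V. z x = - x}"
    "nondeg {x \<in> V. z x = x}" "nondeg {x \<in> V. z x = - x}"
proof -
  have sV: "subsp V" using V by (auto simp: nondeg_def)
  have half: "1 / 2 \<in> F" by simp
  show o: "osum V {x \<in> V. z x = x} {x \<in> V. z x = - x}"
    unfolding osum_def
  proof (intro conjI ballI equalityI subsetI)
    fix v assume v: "v \<in> V"
    let ?p = "sc (1 / 2) (v + z v)" and ?m = "sc (1 / 2) (v - z v)"
    have zv: "z v \<in> V" using z v by blast
    have "?p + ?m = sc (1 / 2) (v + v)" by (simp add: sc_add[symmetric])
    also have "\<dots> = sc (1 / 2) (sc 2 v)" using sc_add_left[of 1 1 v] by simp
    also have "\<dots> = v" by (simp add: sc_assoc)
    finally have s: "?p + ?m = v" .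
    have "?p \<in> {x \<in> V. z x = x}" using v zv half subspD[OF sV] zz[OF v]
      by (simp add: isometryD[OF z(1)] add.commute)
    moreover have "?m \<in> {x \<in> V. z x = - x}"
    proof -
      have "z ?m = sc (1 / 2) (- (v - z v))"
        using isometryD(1)[OF z(1), of v "- z v"] zz[OF v] half by (simp add: isometryD[OF z(1)])
      also have "\<dots> = - ?m" by (simp only: sc_uminus[symmetric] sc_assoc mult.commute)
      finally show ?thesis using v zv half subspD[OF sV] by simp
    qed
    ultimately have "?p + ?m \<in> {u + w |u w. u \<in> {x \<in> V. z x = x} \<and> w \<in> {x \<in> V. z x = - x}}" by blast
    then show "v \<in> {u + w |u w. u \<in> {x \<in> V. z x = x} \<and> w \<in> {x \<in> V. z x = - x}}" by (simp only: s)
  next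
    fix v assume "v \<in> {u + w |u w. u \<in> {x \<in> V. z x = x} \<and> w \<in> {x \<in> V. z x = - x}}"
    then show "v \<in> V" using subspD(2)[OF sV] by blast
  next
    fix u w assume "u \<in> {x \<in> V. z x = x}" "w \<in> {x \<in> V. z x = - x}"
    then have "b u w = - b u w" using isometryD(3)[OF z(1), of u w] by simp
    then show "b u w = 0" by (rule eq_uminus_self)
  qed
  show "nondeg {x \<in> V. z x = x}" "nondeg {x \<in> V. z x = - x}"
    using nondeg_summand[OF V o] nondeg_summand[OF V osum_commute[OF o]] subsp_fixed[OF z(1) sV] subsp_antifixed[OF z(1) sV]
    by blast+
qed

text \<open>
  On the part of \<open>V\<close> where \<open>g ^^ 2 ^ k\<close> is \<open>- 1\<close>, the isometry \<open>g ^^ 2 ^ (k - 1)\<close> has square \<open>- 1\<close>.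
  Splitting off these parts for decreasing \<open>k \<ge> 1\<close> leaves the vectors fixed by \<open>g ^^ 2\<close>.
\<close>

lemma reduces_fixed_square:
  assumes "nondeg V" "bounded V" "isometry g" "g ` V \<subseteq> V" "\<And>x. x \<in> V \<Longrightarrow> (g ^^ (2 ^ k)) x = x"
  shows "reduces V {x \<in> V. g (g x) = x}"
  using assms
proof (induction k arbitrary: V)
  case 0
  then have "{x \<in> V. g (g x) = x} = V" by auto
  then show ?case using reduces_refl 0 by simp
next
  case (Suc k)
  show ?case
  proof (cases k)
    case 0
    then have "{x \<in> V. g (g x) = x} = V" using Suc.prems(5) by (auto simp: numeral_2_eq_2)
    then show ?thesis using reduces_refl Suc by simp
  next
    case (Suc j)
    let ?z = "g ^^ (2 ^ k)" and ?h = "g ^^ (2 ^ j)"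
    let ?P = "{x \<in> V. ?z x = x}" and ?M = "{x \<in> V. ?z x = - x}"
    note V = Suc.prems(1,2) and g = Suc.prems(3,4)
    have z: "isometry ?z" "?z ` V \<subseteq> V" and h: "isometry ?h" "?h ` V \<subseteq> V"
      using g isometry_funpow funpow_stable by blast+
    have zz: "?z (?z x) = x" if "x \<in> V" for x
      using Suc.prems(5)[OF that] by (simp add: mult_2 funpow_add)
    have hh: "?h (?h x) = ?z x" for x using \<open>k = Suc j\<close> by (simp add: mult_2 funpow_add)
    note split = involution_split[OF V(1) z zz]
    have comm: "?z (?h x) = ?h (?z x)" "?z (g x) = g (?z x)" for x
      by (simp_all add: hh[symmetric] funpow_swap1 del: funpow.simps)
    have "hyp ?M"
      by (rule hyp_of_complex_structure[OF split(3) bounded_subset[OF V(2)] h(1)])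
        (use h comm hh in \<open>auto simp: isometryD[OF h(1)]\<close>)
    then have "reduces V ?P" using split by (intro reduces_osum) auto
    also have "reduces ?P {x \<in> ?P. g (g x) = x}"
      by (rule Suc.IH) (use split(2) bounded_subset[OF V(2)] g comm in auto)
    also have "{x \<in> ?P. g (g x) = x} = {x \<in> V. g (g x) = x}"
    proof -
      have "?z x = x" if "g (g x) = x" for x
      proof -
        have "((g ^^ 2) ^^ n) x = x" for n using that by (induction n) (auto simp: numeral_2_eq_2)
        then have "(g ^^ (2 * 2 ^ j)) x = x" by (simp only: funpow_mult)
        then show ?thesis using \<open>k = Suc j\<close> by simp
      qed
      then show ?thesis by auto
    qed
    finally show ?thesis .
  qed
qed

text \<open>
  On a space where the commutator of \<open>g\<close> and \<open>h\<close> acts as \<open>- 1\<close>, the squares of \<open>g\<close> and \<open>h\<close>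
  can be made trivial by splitting off hyperbolic spaces, and then \<open>(g h)\<^sup>2 = - 1\<close>.
\<close>

lemma hyp_of_commutator:
  assumes V: "nondeg V" "bounded V" and g: "isometry g" "g ` V \<subseteq> V" and h: "isometry h" "h ` V \<subseteq> V"
    and pow: "\<And>x. x \<in> V \<Longrightarrow> (g ^^ (2 ^ k)) x = x" "\<And>x. x \<in> V \<Longrightarrow> (h ^^ (2 ^ k)) x = x"
    and comm: "\<And>x. x \<in> V \<Longrightarrow> g (h x) = - h (g x)"
  shows "hyp V"
proof -
  let ?V1 = "{x \<in> V. g (g x) = x}"
  let ?V2 = "{x \<in> ?V1. h (h x) = x}"
  have 1: "reduces V ?V1" by (rule reduces_fixed_square[OF V g pow(1)])
  have gV: "g x \<in> V" and hV: "h x \<in> V" if "x \<in> V" for x using g h that by auto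
  have gg: "g (g (h x)) = h (g (g x))" and hh: "h (h (g x)) = g (h (h x))" if "x \<in> V" for x
    using comm[OF that] comm[OF gV[OF that]] comm[OF hV[OF that]]
    by (simp_all add: isometryD[OF g(1)] isometryD[OF h(1)])
  have 2: "reduces ?V1 ?V2"
    by (rule reduces_fixed_square[where k = k])
      (use 1 bounded_subset[OF V(2)] h pow gg in \<open>auto simp: reduces_def\<close>)
  have "hyp ?V2"
  proof (rule hyp_of_complex_structure[where h = "g \<circ> h"])
    show "nondeg ?V2" using 2 by (auto simp: reduces_def)
    show "bounded ?V2" by (rule bounded_subset[OF V(2)]) auto
    show "isometry (g \<circ> h)" using g h by (simp add: isometry_comp)
    show "(g \<circ> h) ` ?V2 \<subseteq> ?V2" using gV hV gg hh by auto
    fix x assume x: "x \<in> ?V2"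
    have "(g \<circ> h) ((g \<circ> h) x) = g (h (g (h x)))" by simp
    also have "h (g (h x)) = - g (h (h x))" using comm[of "h x"] hV x by simp
    also have "g (- g (h (h x))) = - x" using x by (simp add: isometryD[OF g(1)])
    finally show "(g \<circ> h) ((g \<circ> h) x) = - x" .
  qed
  then have "reduces ?V2 {0}" by (simp add: reduces_zero_iff_hyp)
  with 1 2 have "reduces V {0}" using reduces_trans by blast
  then show ?thesis by (simp add: reduces_zero_iff_hyp)
qed

end

section \<open>Central involutions in 2-groups\<close>

text \<open>
  The orbits that are not fixed points have even length, so the number of fixed points is even.
\<close>

lemma (in group_action) second_fixed_point:
  assumes ord: "Coset.order G = 2 ^ n" and E: "finite E" "even (card E)" and e0: "e0 \<in> E"
    and fixed: "\<And>g. g \<in> carrier G \<Longrightarrow> \<phi> g e0 = e0"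
  shows "\<exists>e\<in>E. e \<noteq> e0 \<and> (\<forall>g\<in>carrier G. \<phi> g e = e)"
proof (rule ccontr)
  assume none: "\<not> ?thesis"
  let ?O = "orbits G E \<phi>"
  have group_G: "group G" using group_hom group_hom.axioms(1) by blast
  have orb_e0: "orbit G \<phi> e0 = {e0}"
    using fixed orbit_refl[OF e0] by (auto simp: Group_Action.orbit_def)
  have ev: "even (card C)" if C: "C \<in> ?O" "C \<noteq> {e0}" for C
  proof -
    obtain x where x: "x \<in> E" "C = orbit G \<phi> x" using C(1) unfolding Group_Action.orbits_def by blast
    then have "x \<noteq> e0" using C(2) orb_e0 by auto
    then obtain g where g: "g \<in> carrier G" "\<phi> g x \<noteq> x" using none x by blast
    have "card C * card (stabilizer G \<phi> x) = 2 ^ n" using orbit_stabilizer_theorem[OF x(1)] ord x by simp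
    then obtain j where j: "card C = 2 ^ j" using divides_primepow_nat[of 2 "card C" n] by (metis dvd_triv_left two_is_prime_nat)
    have "card C \<noteq> 1"
    proof
      assume "card C = 1"
      then obtain c where "C = {c}" by (auto simp: card_1_singleton_iff)
      moreover have "x \<in> C" "\<phi> g x \<in> C" using x g orbit_refl[OF x(1)] by (auto simp: Group_Action.orbit_def)
      ultimately show False using g by auto
    qed
    then show ?thesis using j by (cases j) auto
  qed
  have fin: "finite ?O" using E(1) by (auto simp: Group_Action.orbits_def)
  have "{e0} \<in> ?O" using orb_e0 e0 by (auto simp: Group_Action.orbits_def)
  have "card E = card (\<Union>?O)" using orbits_coverture by simp
  also have "\<dots> = sum card ?O"
  proof (rule card_Union_disjoint)
    show "pairwise disjnt ?O" using disjoint_union by (auto simp: pairwise_def disjnt_def)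
    show "finite A" if "A \<in> ?O" for A using that orbits_coverture E(1) by (metis Union_upper finite_subset)
  qed
  also have "\<dots> = 1 + sum card (?O - {{e0}})"
    using fin \<open>{e0} \<in> ?O\<close> by (simp add: sum.remove)
  also have "odd \<dots>" using ev by (auto intro!: dvd_sum)
  finally show False using E(2) by simp
qed

lemma (in group) center_of_two_group:
  assumes "Coset.order G = 2 ^ n" "n > 0"
  shows "\<exists>z\<in>carrier G. z \<noteq> \<one> \<and> (\<forall>x\<in>carrier G. x \<otimes> z = z \<otimes> x)"
proof -
  interpret conj: group_action G "carrier G" "\<lambda>g. (\<lambda>h \<in> carrier G. g \<otimes> h \<otimes> (inv g))"
    by (rule action_by_conjugation)
  have "finite (carrier G)" using assms(1) by (metis order_gt_0_iff_finite zero_less_numeral zero_less_power)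
  moreover have "even (card (carrier G))" using assms by (simp add: Coset.order_def)
  ultimately obtain z where z: "z \<in> carrier G" "z \<noteq> \<one>"
    "\<forall>g\<in>carrier G. (\<lambda>h \<in> carrier G. g \<otimes> h \<otimes> (inv g)) z = z"
    using conj.second_fixed_point[OF assms(1), of \<one>] by auto
  have "x \<otimes> z = z \<otimes> x" if "x \<in> carrier G" for x
  proof -
    have "x \<otimes> z \<otimes> inv x = z" using z(3) that z(1) by simp
    then show ?thesis using that z(1) by (metis inv_solve_right' m_closed)
  qed
  then show ?thesis using z by blast
qed

lemma (in group) involution_power:
  assumes "Coset.order G = 2 ^ n" "c \<in> carrier G" "c \<noteq> \<one>"
  shows "\<exists>j. c [^] (2 ^ j :: nat) \<noteq> \<one> \<and> c [^] (2 ^ j :: nat) \<otimes> c [^] (2 ^ j :: nat) = \<one>"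
proof -
  have "c [^] (2 ^ n :: nat) = \<one>" using pow_order_eq_1[OF assms(2)] assms(1) by simp
  then obtain m where m: "c [^] (2 ^ m :: nat) = \<one>" "\<And>k. k < m \<Longrightarrow> c [^] (2 ^ k :: nat) \<noteq> \<one>"
    using exists_least_iff[of "\<lambda>m. c [^] (2 ^ m :: nat) = \<one>"] by blast
  have "m \<noteq> 0" using m(1) assms(2,3) by (cases m) auto
  then obtain j where "m = Suc j" by (cases m) auto
  then have "c [^] (2 ^ j :: nat) \<otimes> c [^] (2 ^ j :: nat) = \<one>"
    using m(1) assms(2) by (simp add: nat_pow_mult mult_2)
  then show ?thesis using m(2)[of j] \<open>m = Suc j\<close> by blast
qed

text \<open>
  If \<open>G\<close> is abelian, a power of \<open>g\<close> is an involution that is a square.  Otherwise the center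
  of \<open>G\<close> modulo its center provides an \<open>x\<close> whose commutators are all central but not all
  trivial; as \<open>y \<mapsto> [x, y]\<close> is then a homomorphism, an involution occurs among its values.
\<close>

lemma (in group) central_involution:
  assumes ord: "Coset.order G = 2 ^ n" and g: "g \<in> carrier G" "g \<otimes> g \<noteq> \<one>"
  shows "\<exists>z\<in>carrier G. z \<noteq> \<one> \<and> z \<otimes> z = \<one> \<and> (\<forall>x\<in>carrier G. x \<otimes> z = z \<otimes> x) \<and>
    ((\<exists>h\<in>carrier G. z = h \<otimes> h) \<or> (\<exists>x\<in>carrier G. \<exists>y\<in>carrier G. x \<otimes> y = z \<otimes> (y \<otimes> x)))"
proof (cases "\<forall>x\<in>carrier G. \<forall>y\<in>carrier G. x \<otimes> y = y \<otimes> x")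
  case True
  let ?c = "g \<otimes> g"
  obtain j where j: "?c [^] (2 ^ j :: nat) \<noteq> \<one>" "?c [^] (2 ^ j :: nat) \<otimes> ?c [^] (2 ^ j :: nat) = \<one>"
    using involution_power[OF ord _ g(2)] g by auto
  have "?c [^] (2 ^ j :: nat) = g [^] (2 ^ j :: nat) \<otimes> g [^] (2 ^ j :: nat)"
    using g pow_mult_distrib[of g g "2 ^ j :: nat"] by simp
  then show ?thesis using j True g by (intro bexI[of _ "?c [^] (2 ^ j :: nat)"]) auto
next
  case False
  define Z where "Z = {z \<in> carrier G. \<forall>x\<in>carrier G. x \<otimes> z = z \<otimes> x}"
  have sub: "subgroup Z G"
  proof (rule subgroupI)
    show "Z \<subseteq> carrier G" "Z \<noteq> {}" by (auto simp: Z_def intro!: exI[of _ \<one>])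
    show "a \<otimes> b \<in> Z" if "a \<in> Z" "b \<in> Z" for a b
    proof -
      have ab: "a \<in> carrier G" "b \<in> carrier G" using that by (auto simp: Z_def)
      have "x \<otimes> (a \<otimes> b) = a \<otimes> b \<otimes> x" if x: "x \<in> carrier G" for x
      proof -
        have "x \<otimes> a = a \<otimes> x" "x \<otimes> b = b \<otimes> x" using \<open>a \<in> Z\<close> \<open>b \<in> Z\<close> x by (auto simp: Z_def)
        then show ?thesis using ab x by (metis m_assoc)
      qed
      then show ?thesis using ab by (simp add: Z_def)
    qed
    show "inv a \<in> Z" if "a \<in> Z" for a
    proof -
      have a: "a \<in> carrier G" using that by (auto simp: Z_def)
      have "x \<otimes> inv a = inv a \<otimes> x" if x: "x \<in> carrier G" for x
      proof -
        have "x \<otimes> a = a \<otimes> x" using \<open>a \<in> Z\<close> x by (auto simp: Z_def)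
        then show ?thesis using a x by (metis inv_closed inv_solve_left inv_solve_right m_assoc m_closed)
      qed
      then show ?thesis using a by (simp add: Z_def)
    qed
  qed
  have "x \<otimes> z \<otimes> inv x = z" if "x \<in> carrier G" "z \<in> Z" for x z
  proof -
    have zG: "z \<in> carrier G" and xz: "x \<otimes> z = z \<otimes> x" using that by (auto simp: Z_def)
    show ?thesis unfolding xz using that(1) zG by (simp add: m_assoc)
  qed
  then have norm: "Z \<lhd> G" unfolding normal_inv_iff using sub by simp
  interpret Z: normal Z G by (rule norm)
  interpret Q: group "G Mod Z" by (rule Z.factorgroup_is_group)
  have fin: "finite (carrier G)" using ord by (metis order_gt_0_iff_finite zero_less_numeral zero_less_power)
  have "Coset.order (G Mod Z) * card Z = 2 ^ n" using lagrange[OF sub] ord by (simp add: Coset.order_def FactGroup_def)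
  then obtain m where m: "Coset.order (G Mod Z) = 2 ^ m" using divides_primepow_nat[of 2 _ n] by (metis dvd_triv_left two_is_prime_nat)
  have "m \<noteq> 0"
  proof
    assume "m = 0"
    then have "card Z = Coset.order G" using lagrange[OF sub] m by (simp add: Coset.order_def FactGroup_def)
    then have "Z = carrier G" using fin Z.subset by (simp add: card_subset_eq Coset.order_def)
    then show False using False unfolding Z_def by blast
  qed
  then obtain C where C: "C \<in> carrier (G Mod Z)" "C \<noteq> \<one>\<^bsub>G Mod Z\<^esub>"
    "\<forall>D\<in>carrier (G Mod Z). D \<otimes>\<^bsub>G Mod Z\<^esub> C = C \<otimes>\<^bsub>G Mod Z\<^esub> D"
    using Q.center_of_two_group[OF m] by auto
  then obtain x where x: "x \<in> carrier G" "C = Z #> x" by (auto simp: FactGroup_def RCOSETS_def)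
  have "x \<notin> Z" using C(2) x coset_join2[OF x(1) sub] by (auto simp: FactGroup_def)
  then obtain y where y: "y \<in> carrier G" "x \<otimes> y \<noteq> y \<otimes> x" using x(1) unfolding Z_def by fastforce
  have "Z #> y \<in> carrier (G Mod Z)" using y(1) by (auto simp: FactGroup_def RCOSETS_def)
  then have "(Z #> y) \<otimes>\<^bsub>G Mod Z\<^esub> (Z #> x) = (Z #> x) \<otimes>\<^bsub>G Mod Z\<^esub> (Z #> y)" using C(3) x(2) by blast
  then have "Z #> (x \<otimes> y) = Z #> (y \<otimes> x)" using x y by (simp add: Z.rcos_sum)
  then have "x \<otimes> y \<in> Z #> (y \<otimes> x)" using rcos_self[OF m_closed[OF x(1) y(1)] sub] by simp
  then obtain c where c: "c \<in> Z" "x \<otimes> y = c \<otimes> (y \<otimes> x)" unfolding r_coset_def by blast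
  have cG: "c \<in> carrier G" and cc: "\<And>u. u \<in> carrier G \<Longrightarrow> u \<otimes> c = c \<otimes> u" using c(1) unfolding Z_def by blast+
  have "c \<noteq> \<one>"
  proof
    assume "c = \<one>"
    then have "x \<otimes> y = y \<otimes> x" using c(2) m_closed[OF y(1) x(1)] by simp
    then show False using y(2) by blast
  qed
  then obtain j where j: "c [^] (2 ^ j :: nat) \<noteq> \<one>" "c [^] (2 ^ j :: nat) \<otimes> c [^] (2 ^ j :: nat) = \<one>"
    using involution_power[OF ord cG] by blast
  have pc: "u \<otimes> c [^] k = c [^] k \<otimes> u" if "u \<in> carrier G" for u and k :: nat
  proof (induction k)
    case (Suc k)
    have "u \<otimes> (c [^] k \<otimes> c) = c [^] k \<otimes> (u \<otimes> c)" using Suc that cG by (metis m_assoc nat_pow_closed)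
    then show ?case using cc[OF that] that cG by (simp add: m_assoc)
  qed (use that in simp)
  have comm: "x \<otimes> y [^] k = c [^] k \<otimes> (y [^] k \<otimes> x)" for k :: nat
  proof (induction k)
    case (Suc k)
    have "x \<otimes> (y [^] k \<otimes> y) = c [^] k \<otimes> (y [^] k \<otimes> (x \<otimes> y))"
      using Suc x y cG by (metis m_assoc m_closed nat_pow_closed)
    also have "\<dots> = c [^] k \<otimes> ((y [^] k \<otimes> c) \<otimes> (y \<otimes> x))" using c(2) x y cG by (simp add: m_assoc)
    also have "\<dots> = c [^] k \<otimes> ((c \<otimes> y [^] k) \<otimes> (y \<otimes> x))" using cc y by simp
    finally show ?case using x y cG by (simp add: m_assoc)
  qed (use x in simp)
  let ?z = "c [^] (2 ^ j :: nat)" and ?y = "y [^] (2 ^ j :: nat)"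
  have "?z \<in> carrier G" "?y \<in> carrier G" using cG y by simp_all
  moreover have "\<forall>u\<in>carrier G. u \<otimes> ?z = ?z \<otimes> u" using pc by blast
  ultimately show ?thesis using j comm[of "2 ^ j"] x(1) by blast
qed

text \<open>The same for a quotient, in terms of representatives.\<close>

lemma (in normal) central_involution_mod:
  assumes ord: "Coset.order G = 2 ^ n" and g: "g \<in> carrier G" "g \<otimes> g \<notin> H"
  shows "\<exists>z\<in>carrier G. z \<notin> H \<and> z \<otimes> z \<in> H \<and> (\<forall>x\<in>carrier G. \<exists>h\<in>H. x \<otimes> z = h \<otimes> (z \<otimes> x)) \<and>
    ((\<exists>x\<in>carrier G. \<exists>h\<in>H. z = h \<otimes> (x \<otimes> x)) \<or>
     (\<exists>x\<in>carrier G. \<exists>y\<in>carrier G. \<exists>h\<in>H. x \<otimes> y = h \<otimes> (z \<otimes> (y \<otimes> x))))"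
proof -
  interpret Q: group "G Mod H" by (rule factorgroup_is_group)
  have sub: "subgroup H G" by (rule subgroup_axioms)
  have "Coset.order (G Mod H) * card H = 2 ^ n" using lagrange[OF sub] ord by (simp add: Coset.order_def FactGroup_def)
  then obtain m where m: "Coset.order (G Mod H) = 2 ^ m" using divides_primepow_nat[of 2 _ n] by (metis dvd_triv_left two_is_prime_nat)
  have eq: "(\<exists>h\<in>H. a = h \<otimes> b) \<longleftrightarrow> H #> a = H #> b" if "a \<in> carrier G" "b \<in> carrier G" for a b
  proof
    assume "\<exists>h\<in>H. a = h \<otimes> b"
    then show "H #> a = H #> b" using repr_independence[of a H b] that sub by (auto simp: r_coset_def)
  next
    assume "H #> a = H #> b"
    then have "a \<in> H #> b" using rcos_self[OF that(1) sub] by simp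
    then show "\<exists>h\<in>H. a = h \<otimes> b" by (auto simp: r_coset_def)
  qed
  have one: "H #> a = H \<longleftrightarrow> a \<in> H" if "a \<in> carrier G" for a
    using coset_join1[OF _ that sub] coset_join2[OF that sub] by blast
  have car: "H #> a \<in> carrier (G Mod H)" if "a \<in> carrier G" for a
    using that by (auto simp: FactGroup_def RCOSETS_def)
  have mult: "(H #> a) \<otimes>\<^bsub>G Mod H\<^esub> (H #> b) = H #> (a \<otimes> b)" if "a \<in> carrier G" "b \<in> carrier G" for a b
    using rcos_sum that by simp
  have ex: "\<exists>a\<in>carrier G. C = H #> a" if "C \<in> carrier (G Mod H)" for C
    using that by (auto simp: FactGroup_def RCOSETS_def)
  have "(H #> g) \<otimes>\<^bsub>G Mod H\<^esub> (H #> g) \<noteq> \<one>\<^bsub>G Mod H\<^esub>" using mult g one by simp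
  from Q.central_involution[OF m car[OF g(1)] this]
  obtain C where C: "C \<in> carrier (G Mod H)" "C \<noteq> \<one>\<^bsub>G Mod H\<^esub>" "C \<otimes>\<^bsub>G Mod H\<^esub> C = \<one>\<^bsub>G Mod H\<^esub>"
    "\<forall>D\<in>carrier (G Mod H). D \<otimes>\<^bsub>G Mod H\<^esub> C = C \<otimes>\<^bsub>G Mod H\<^esub> D"
    "(\<exists>D\<in>carrier (G Mod H). C = D \<otimes>\<^bsub>G Mod H\<^esub> D) \<or>
     (\<exists>D\<in>carrier (G Mod H). \<exists>E\<in>carrier (G Mod H). D \<otimes>\<^bsub>G Mod H\<^esub> E = C \<otimes>\<^bsub>G Mod H\<^esub> (E \<otimes>\<^bsub>G Mod H\<^esub> D))"
    by blast
  obtain z where z: "z \<in> carrier G" "C = H #> z" using ex[OF C(1)] by blast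
  show ?thesis
  proof (rule bexI[OF _ z(1)], intro conjI ballI)
    show "z \<notin> H" using C(2) z one by auto
    show "z \<otimes> z \<in> H" using C(3) z one mult by auto
    show "\<exists>h\<in>H. x \<otimes> z = h \<otimes> (z \<otimes> x)" if "x \<in> carrier G" for x
      using C(4) car[OF that] z that mult eq by (metis m_closed)
    show "(\<exists>x\<in>carrier G. \<exists>h\<in>H. z = h \<otimes> (x \<otimes> x)) \<or>
     (\<exists>x\<in>carrier G. \<exists>y\<in>carrier G. \<exists>h\<in>H. x \<otimes> y = h \<otimes> (z \<otimes> (y \<otimes> x)))"
      using C(5)
    proof (elim disjE bexE)
      fix D assume "D \<in> carrier (G Mod H)" "C = D \<otimes>\<^bsub>G Mod H\<^esub> D"
      then obtain x where "x \<in> carrier G" "H #> z = H #> (x \<otimes> x)" using ex mult z by metis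
      then show ?thesis using eq z by (metis m_closed)
    next
      fix D E assume D: "D \<in> carrier (G Mod H)" "E \<in> carrier (G Mod H)" "D \<otimes>\<^bsub>G Mod H\<^esub> E = C \<otimes>\<^bsub>G Mod H\<^esub> (E \<otimes>\<^bsub>G Mod H\<^esub> D)"
      obtain x where x: "x \<in> carrier G" "D = H #> x" using ex D by blast
      obtain y where y: "y \<in> carrier G" "E = H #> y" using ex D by blast
      have "H #> (x \<otimes> y) = H #> (z \<otimes> (y \<otimes> x))" using D(3) x y z mult by simp
      then show ?thesis using eq x y z by (metis m_closed)
    qed
  qed
qed

lemma (in group) square_subgroup_normal: "square_subgroup G \<lhd> G"
  unfolding square_subgroup_def
proof (rule normal_generateI)
  show "{g [^] (2::nat) |g. g \<in> carrier G} \<subseteq> carrier G" by auto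
  fix h g assume "h \<in> {g [^] (2::nat) |g. g \<in> carrier G}" and g: "g \<in> carrier G"
  then obtain k where k: "k \<in> carrier G" "h = k \<otimes> k" by (auto simp: numeral_2_eq_2)
  have "inv g \<otimes> (g \<otimes> (k \<otimes> inv g)) = k \<otimes> inv g" using g k by (simp add: m_assoc[symmetric])
  then have "g \<otimes> h \<otimes> inv g = (g \<otimes> k \<otimes> inv g) \<otimes> (g \<otimes> k \<otimes> inv g)"
    using g k by (simp add: m_assoc)
  also have "\<dots> = (g \<otimes> k \<otimes> inv g) [^] (2::nat)" using g k by (simp add: numeral_2_eq_2)
  finally show "g \<otimes> h \<otimes> inv g \<in> {g [^] (2::nat) |g. g \<in> carrier G}"
    using g k by blast
qed

section \<open>Galois actions\<close>

text \<open>
  The Galois group is given as an abstract group acting on the field, so that subgroups and quotients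
  of the given group can be used without transport along an isomorphism.
\<close>

locale galois_action = group G + field_hom \<iota>
  for G :: "('g, 'm) monoid_scheme" (structure) and \<iota> :: "'k::field \<Rightarrow> 'l::field" +
  fixes act :: "'g \<Rightarrow> 'l \<Rightarrow> 'l"
  assumes finite_G: "finite (carrier G)"
    and act_hom: "g \<in> carrier G \<Longrightarrow> field_hom (act g)"
    and act_mult: "g \<in> carrier G \<Longrightarrow> h \<in> carrier G \<Longrightarrow> act (g \<otimes> h) x = act g (act h x)"
    and act_one: "act \<one> x = x"
    and faithful: "inj_on act (carrier G)"
    and fixed: "{x. \<forall>g\<in>carrier G. act g x = x} = range \<iota>"
begin

lemma act_ring:
  assumes "g \<in> carrier G"
  shows "act g (x + y) = act g x + act g y" "act g (x * y) = act g x * act g y"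
    "act g 0 = 0" "act g 1 = 1" "act g (- x) = - act g x" "act g (inverse x) = inverse (act g x)"
    "act g (sum f A) = (\<Sum>a\<in>A. act g (f a))" "act g (x / y) = act g x / act g y"
    "act g (x ^ k) = act g x ^ k" "act g (x - y) = act g x - act g y" "act g (of_nat k) = of_nat k"
proof -
  interpret h: field_hom "act g" by (rule act_hom[OF assms])
  show "act g (x + y) = act g x + act g y" "act g (x * y) = act g x * act g y"
    "act g 0 = 0" "act g 1 = 1" "act g (- x) = - act g x" "act g (inverse x) = inverse (act g x)"
    "act g (sum f A) = (\<Sum>a\<in>A. act g (f a))" "act g (x / y) = act g x / act g y"
    "act g (x ^ k) = act g x ^ k" "act g (x - y) = act g x - act g y" "act g (of_nat k) = of_nat k"
    by (simp_all add: hom_distribs)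
qed

lemma act_emb: "g \<in> carrier G \<Longrightarrow> act g (\<iota> c) = \<iota> c"
  using fixed by blast

lemma act_inv: "g \<in> carrier G \<Longrightarrow> act (inv g) (act g x) = x" "g \<in> carrier G \<Longrightarrow> act g (act (inv g) x) = x"
  using act_mult[of "inv g" g x] act_mult[of g "inv g" x] by (simp_all add: act_one)

text \<open>
  If \<open>act g x \<noteq> act h x\<close>, then subtracting \<open>act h x\<close> times the relation at \<open>y\<close> from the relation at \<open>x y\<close>
  eliminates \<open>h\<close> and keeps a nonzero multiple of the coefficient of \<open>g\<close>.
\<close>

lemma Dedekind:
  assumes "A \<subseteq> carrier G" "\<And>x. (\<Sum>g\<in>A. a g * act g x) = 0" "g \<in> A"
  shows "a g = 0"
proof -
  have "finite A" using assms(1) finite_G finite_subset by blast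
  then show ?thesis using assms
  proof (induction A arbitrary: a g rule: finite_induct)
    case (insert h A)
    have hG: "h \<in> carrier G" and AG: "A \<subseteq> carrier G" using insert.prems by auto
    have zero: "a g = 0" if g: "g \<in> A" for g
    proof -
      have "act g \<noteq> act h" using faithful g insert.hyps AG hG by (metis inj_onD subsetD)
      then obtain x where x: "act g x \<noteq> act h x" by auto
      have "a g * (act g x - act h x) = 0"
      proof (rule insert.IH[OF AG _ g])
        fix y
        have "(\<Sum>g\<in>insert h A. a g * act g (x * y)) - act h x * (\<Sum>g\<in>insert h A. a g * act g y) = 0"
          using insert.prems(2) by simp
        moreover have "(\<Sum>g\<in>insert h A. a g * act g (x * y)) - act h x * (\<Sum>g\<in>insert h A. a g * act g y) =
            (\<Sum>g\<in>insert h A. a g * (act g x - act h x) * act g y)"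
          unfolding sum_distrib_left sum_subtractf[symmetric]
          using insert.prems(1) by (intro sum.cong) (auto simp: act_ring algebra_simps)
        ultimately show "(\<Sum>g\<in>A. a g * (act g x - act h x) * act g y) = 0" using insert.hyps by simp
      qed
      then show ?thesis using x by simp
    qed
    have "a h * act h 1 = 0" using insert.prems(2)[of 1] zero insert.hyps by simp
    then have "a h = 0" using act_ring(4)[OF hG] by simp
    then show ?case using zero insert.prems(3) by auto
  qed simp
qed

definition fixed_field :: "'g set \<Rightarrow> 'l set" where
  "fixed_field S = {x. \<forall>s\<in>S. act s x = x}"

lemma fixed_fieldD: "x \<in> fixed_field S \<Longrightarrow> s \<in> S \<Longrightarrow> act s x = x"
  by (simp add: fixed_field_def)

lemma coeff_field_fixed: "S \<subseteq> carrier G \<Longrightarrow> coeff_field (fixed_field S)"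
  by unfold_locales (auto simp: fixed_field_def act_ring subset_iff)

lemma emb_fixed: "S \<subseteq> carrier G \<Longrightarrow> \<iota> c \<in> fixed_field S"
  by (auto simp: fixed_field_def act_emb)

definition tr :: "'g set \<Rightarrow> 'l \<Rightarrow> 'l" where
  "tr S x = (\<Sum>s\<in>S. act s x)"

lemma subgroup_sum_shift:
  assumes S: "subgroup S G" and t: "t \<in> S"
  shows "(\<Sum>s\<in>S. f (t \<otimes> s)) = sum f S" "(\<Sum>s\<in>S. f (s \<otimes> t)) = sum f S"
proof -
  have mem: "s \<in> carrier G" if "s \<in> S" for s using S that by (rule subgroup.mem_carrier)
  have cl: "inv t \<otimes> s \<in> S" "s \<otimes> inv t \<in> S" "t \<otimes> s \<in> S" "s \<otimes> t \<in> S" if "s \<in> S" for s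
    using that t S by (auto intro: subgroup.m_closed subgroup.m_inv_closed)
  show "(\<Sum>s\<in>S. f (t \<otimes> s)) = sum f S"
    by (rule sum.reindex_bij_witness[where i = "\<lambda>s. inv t \<otimes> s" and j = "\<lambda>s. t \<otimes> s"])
      (use cl mem t in \<open>auto simp: m_assoc[symmetric]\<close>)
  show "(\<Sum>s\<in>S. f (s \<otimes> t)) = sum f S"
    by (rule sum.reindex_bij_witness[where i = "\<lambda>s. s \<otimes> inv t" and j = "\<lambda>s. s \<otimes> t"])
      (use cl mem t in \<open>auto simp: m_assoc\<close>)
qed

lemma tr_fixed: assumes "subgroup S G" shows "tr S x \<in> fixed_field S"
  unfolding fixed_field_def
proof (intro CollectI ballI)
  fix t assume t: "t \<in> S"
  have mem: "s \<in> carrier G" if "s \<in> S" for s using assms that by (rule subgroup.mem_carrier)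
  have "act t (tr S x) = (\<Sum>s\<in>S. act (t \<otimes> s) x)"
    using mem t by (auto simp: tr_def act_ring act_mult intro!: sum.cong)
  then show "act t (tr S x) = tr S x"
    using subgroup_sum_shift(1)[OF assms t, of "\<lambda>s. act s x"] by (simp add: tr_def)
qed

lemma tr_act: assumes "subgroup S G" "t \<in> S" shows "tr S (act t x) = tr S x"
proof -
  have mem: "s \<in> carrier G" if "s \<in> S" for s using assms that by (blast dest: subgroup.mem_carrier)
  have "tr S (act t x) = (\<Sum>s\<in>S. act (s \<otimes> t) x)"
    using mem assms by (auto simp: tr_def act_mult intro!: sum.cong)
  then show ?thesis using subgroup_sum_shift(2)[OF assms, of "\<lambda>s. act s x"] by (simp add: tr_def)
qed

lemma tr_add: "S \<subseteq> carrier G \<Longrightarrow> tr S (x + y) = tr S x + tr S y"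
  by (simp add: tr_def act_ring subset_iff sum.distrib[symmetric])

lemma tr_scale: "S \<subseteq> carrier G \<Longrightarrow> c \<in> fixed_field S \<Longrightarrow> tr S (c * x) = c * tr S x"
  by (simp add: tr_def act_ring subset_iff sum_distrib_left fixed_fieldD)

lemma tr_nondegenerate:
  assumes "subgroup S G" "\<And>y. tr S (x * y) = 0" shows "x = 0"
proof -
  have sub: "S \<subseteq> carrier G" and one: "\<one> \<in> S" using assms(1) by (auto simp: subgroup.subset subgroup.one_closed)
  have "(\<Sum>s\<in>S. act s x * act s y) = 0" for y
    using assms(2)[of y] sub by (simp add: tr_def act_ring subset_iff)
  then have "act \<one> x = 0" using Dedekind[OF sub _ one, of "\<lambda>s. act s x"] by blast
  then show ?thesis by (simp add: act_one)
qed

end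

locale galois_action_i = galois_action G \<iota> act
  for G :: "('g, 'm) monoid_scheme" (structure) and \<iota> :: "'k::field \<Rightarrow> 'l::field"
    and act :: "'g \<Rightarrow> 'l \<Rightarrow> 'l" +
  assumes two_ne: "(2 :: 'k) \<noteq> 0" and sqrt_minus_one: "\<exists>i::'k. i\<^sup>2 = - 1"
    and fin_ext: "finite_extension \<iota>"
begin

lemma quad_space_tr:
  assumes S: "subgroup S G"
  shows "quad_space_i (fixed_field S) (*) (\<lambda>x y. tr S (x * y))"
proof -
  have sub: "S \<subseteq> carrier G" using S by (rule subgroup.subset)
  interpret coeff_field "fixed_field S" using sub by (rule coeff_field_fixed)
  obtain i where i: "i\<^sup>2 = - (1 :: 'k)" using sqrt_minus_one by blast
  have "(\<iota> i)\<^sup>2 = - 1" using i by (metis hom_one hom_power hom_uminus)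
  moreover have "(2 :: 'l) \<noteq> 0" using two_ne hom_numeral[of "num.Bit0 num.One"] hom_0_iff by metis
  moreover have comm: "tr S (x * y) = tr S (y * x)" for x y by (simp add: mult.commute)
  ultimately show ?thesis
    by (unfold_locales; (fact comm | use emb_fixed[OF sub] in
        \<open>auto simp: distrib_left distrib_right tr_add[OF sub] tr_scale[OF sub] mult.assoc\<close>))
qed

end

locale galois_2subgroup = galois_action_i G \<iota> act
  for G :: "('g, 'm) monoid_scheme" (structure) and \<iota> :: "'k::field \<Rightarrow> 'l::field"
    and act :: "'g \<Rightarrow> 'l \<Rightarrow> 'l" +
  fixes S :: "'g set" and n :: nat
  assumes S: "subgroup S G" and card_S: "card S = 2 ^ n"
begin

abbreviation T where "T \<equiv> G\<lparr>carrier := S\<rparr>"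

lemma S_carrier [simp]: "s \<in> S \<Longrightarrow> s \<in> carrier G"
  using S by (rule subgroup.mem_carrier)

lemma S_sub: "S \<subseteq> carrier G" by auto

sublocale T: group T by (rule subgroup_imp_group[OF S])

sublocale Q: quad_space_i "fixed_field S" "(*)" "\<lambda>x y. tr S (x * y)"
  by (rule quad_space_tr[OF S])

lemma order_T: "Coset.order T = 2 ^ n"
  by (simp add: Coset.order_def card_S)

lemma Q_bounded: "Q.bounded V"
proof -
  obtain B where B: "finite B" "module.span (ext_scale \<iota>) B = UNIV"
    using fin_ext by (auto simp: finite_extension_def)
  have vs: "vector_space (ext_scale \<iota>)"
    by unfold_locales (auto simp: ext_scale_def hom_distribs algebra_simps)
  show ?thesis
    by (rule Q.bounded_of_spanning[OF vs B, where h = \<iota>])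
      (auto simp: ext_scale_def tr_scale[OF S_sub emb_fixed[OF S_sub]] mult.assoc)
qed

lemma Q_nondeg_UNIV: "Q.nondeg UNIV"
  unfolding Q.nondeg_def Q.subsp_def using tr_fixed[OF S] tr_nondegenerate[OF S] by auto

lemma Q_isometry: assumes "s \<in> S" shows "Q.isometry (act s)"
proof -
  have "tr S (act s x * act s y) = tr S (x * y)" for x y
    using tr_act[OF S assms, of "x * y"] act_ring(2)[of s x y] assms by simp
  then show ?thesis using assms by (simp add: Q.isometry_def act_ring fixed_fieldD)
qed

lemma act_pow: "s \<in> S \<Longrightarrow> (act s ^^ k) x = act (s [^] k) x"
proof (induction k)
  case (Suc k)
  have "(act s ^^ Suc k) x = act (s \<otimes> s [^] k) x" using Suc by (simp add: act_mult)
  also have "s \<otimes> s [^] k = s [^] Suc k" using Suc.prems nat_pow_Suc2[of s k] by simp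
  finally show ?case .
qed (simp add: act_one)

lemma act_pow_order: assumes "s \<in> S" shows "(act s ^^ (2 ^ n)) x = x"
proof -
  have "s [^]\<^bsub>T\<^esub> Coset.order T = \<one>\<^bsub>T\<^esub>" using T.pow_order_eq_1[of s] assms by simp
  then have "s [^] (2 ^ n :: nat) = \<one>" using order_T nat_pow_consistent by simp
  then show ?thesis using act_pow[OF assms] by (simp add: act_one)
qed

definition \<Phi> where "\<Phi> = square_subgroup T"

lemma square_in_\<Phi>: "s \<in> S \<Longrightarrow> s \<otimes> s \<in> \<Phi>"
  unfolding \<Phi>_def square_subgroup_def
  by (rule generate.incl) (auto simp: numeral_2_eq_2 intro!: exI[of _ s])

lemma \<Phi>_normal: "\<Phi> \<lhd> T"
  unfolding \<Phi>_def by (rule T.square_subgroup_normal)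

lemma \<Phi>_minimal: "subgroup H T \<Longrightarrow> (\<And>s. s \<in> S \<Longrightarrow> s \<otimes> s \<in> H) \<Longrightarrow> \<Phi> \<subseteq> H"
  unfolding \<Phi>_def square_subgroup_def
  by (rule T.generate_subgroup_incl) (auto simp: numeral_2_eq_2)

lemma normal_act_stable:
  assumes N: "N \<lhd> T" and s: "s \<in> S" and x: "x \<in> fixed_field N" shows "act s x \<in> fixed_field N"
  unfolding fixed_field_def
proof (intro CollectI ballI)
  interpret N: normal N T by (rule N)
  fix m assume m: "m \<in> N"
  have mS: "m \<in> S" using N.subset m by auto
  have inv: "inv\<^bsub>T\<^esub> s = inv s" using m_inv_consistent[OF S s] by simp
  have "inv s \<otimes> m \<otimes> s \<in> N" using N.inv_op_closed1[of s m] s m inv by simp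
  then have "act (inv s \<otimes> m \<otimes> s) x = x" using x by (simp add: fixed_field_def)
  moreover have "act s (act (inv s \<otimes> m \<otimes> s) x) = act m (act s x)"
    using s mS by (simp add: act_mult act_inv)
  ultimately show "act m (act s x) = act s x" by simp
qed

lemma fixed_generate:
  assumes "H \<subseteq> S" shows "fixed_field (generate T H) = fixed_field H"
proof (intro equalityI subsetI)
  fix x assume "x \<in> fixed_field (generate T H)"
  then show "x \<in> fixed_field H" by (auto simp: fixed_field_def generate.incl)
next
  fix x assume x: "x \<in> fixed_field H"
  have "g \<in> S \<and> act g x = x" if "g \<in> generate T H" for g
    using that
  proof (induction rule: generate.induct)
    case one
    show ?case using T.one_closed by (simp add: act_one)
  next
    case (incl h)
    then show ?case using x assms by (auto simp: fixed_field_def)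
  next
    case (inv h)
    then have h: "h \<in> S" "act h x = x" using x assms by (auto simp: fixed_field_def)
    then have "inv\<^bsub>T\<^esub> h = inv h" using m_inv_consistent[OF S] by simp
    then show ?case using h act_inv(1)[of h x] T.inv_closed[of h] by simp
  next
    case (eng h1 h2)
    then show ?case using T.m_closed[of h1 h2] by (simp add: act_mult)
  qed
  then show "x \<in> fixed_field (generate T H)" by (simp add: fixed_field_def)
qed

text \<open>
  One step: modulo \<open>N\<close> there is a central involution \<open>z\<close> that is a square or a commutator,
  and the part of the fixed field of \<open>N\<close> on which \<open>z\<close> acts as \<open>- 1\<close> is hyperbolic.
\<close>

lemma reduces_step:
  assumes N: "N \<lhd> T" "N \<subseteq> \<Phi>" and red: "Q.reduces UNIV (fixed_field N)" and ne: "N \<noteq> \<Phi>"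
  shows "\<exists>N'. N' \<lhd> T \<and> N \<subset> N' \<and> N' \<subseteq> \<Phi> \<and> Q.reduces UNIV (fixed_field N')"
proof -
  interpret N: normal N T by (rule N)
  interpret \<Phi>: normal \<Phi> T by (rule \<Phi>_normal)
  have NS: "m \<in> S" if "m \<in> N" for m using N.subset that by auto
  have \<Phi>S: "m \<in> S" if "m \<in> \<Phi>" for m using \<Phi>.subset that by auto
  have SS: "x \<otimes> y \<in> S" "inv x \<in> S" if "x \<in> S" "y \<in> S" for x y
    using that S by (auto intro: subgroup.m_closed subgroup.m_inv_closed)
  have invT: "inv\<^bsub>T\<^esub> s = inv s" if "s \<in> S" for s using m_inv_consistent[OF S that] by simp
  have \<Phi>cl: "x \<otimes> y \<in> \<Phi>" if "x \<in> \<Phi>" "y \<in> \<Phi>" for x y using \<Phi>.m_closed that by simp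
  have \<Phi>inv: "inv x \<in> \<Phi>" if "x \<in> \<Phi>" for x using \<Phi>.m_inv_closed[OF that] invT[OF \<Phi>S[OF that]] by simp
  have "\<not> (\<forall>s\<in>S. s \<otimes> s \<in> N)" using \<Phi>_minimal[OF N.subgroup_axioms] N(2) ne by blast
  then obtain g where g: "g \<in> S" "g \<otimes> g \<notin> N" by blast
  obtain z where z: "z \<in> S" "z \<notin> N" "z \<otimes> z \<in> N" "\<forall>x\<in>S. \<exists>h\<in>N. x \<otimes> z = h \<otimes> (z \<otimes> x)"
    and zz: "(\<exists>x\<in>S. \<exists>h\<in>N. z = h \<otimes> (x \<otimes> x)) \<or>
     (\<exists>x\<in>S. \<exists>y\<in>S. \<exists>h\<in>N. x \<otimes> y = h \<otimes> (z \<otimes> (y \<otimes> x)))"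
    using N.central_involution_mod[OF order_T, of g, simplified] g by blast
  let ?V = "fixed_field N"
  let ?M = "{x \<in> ?V. act z x = - x}"
  have V: "Q.nondeg ?V" using red by (simp add: Q.reduces_def)
  have Vact: "act s x \<in> ?V" if "s \<in> S" "x \<in> ?V" for s x using normal_act_stable[OF N(1) that] .
  have Vz: "act z ` ?V \<subseteq> ?V" using Vact z by auto
  have zzV: "act z (act z x) = x" if "x \<in> ?V" for x
    using fixed_fieldD[OF that z(3)] z(1) by (simp add: act_mult)
  have comm: "act s (act z x) = act z (act s x)" if s: "s \<in> S" and x: "x \<in> ?V" for s x
  proof -
    obtain h where h: "h \<in> N" "s \<otimes> z = h \<otimes> (z \<otimes> s)" using z(4) s by blast
    have "act s (act z x) = act h (act z (act s x))"
      using act_mult[of s z x] act_mult[of h "z \<otimes> s" x] act_mult[of z s x] h s z(1) NS by simp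
    also have "\<dots> = act z (act s x)" by (rule fixed_fieldD[OF Vact[OF z(1) Vact[OF s x]] h(1)])
    finally show ?thesis .
  qed
  note split = Q.involution_split[OF V Q_isometry[OF z(1)] Vz zzV]
  have Mact: "act s ` ?M \<subseteq> ?M" if "s \<in> S" for s
  proof
    fix y assume "y \<in> act s ` ?M"
    then obtain x where x: "x \<in> ?V" "act z x = - x" "y = act s x" by blast
    then show "y \<in> ?M" using comm[OF that x(1)] Vact[OF that x(1)] that by (simp add: act_ring)
  qed
  have "Q.hyp ?M"
    using zz
  proof (elim disjE bexE)
    fix x h assume x: "x \<in> S" "h \<in> N" "z = h \<otimes> (x \<otimes> x)"
    show ?thesis
    proof (rule Q.hyp_of_complex_structure[OF split(3) Q_bounded Q_isometry[OF x(1)] Mact[OF x(1)]])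
      fix v assume v: "v \<in> ?M"
      have "act z v = act h (act x (act x v))"
        using x NS by (simp add: act_mult)
      also have "\<dots> = act x (act x v)" using fixed_fieldD[OF Vact[OF x(1) Vact[OF x(1)]] x(2)] v by blast
      finally show "act x (act x v) = - v" using v by simp
    qed
  next
    fix x y h assume x: "x \<in> S" and y: "y \<in> S" and h: "h \<in> N" "x \<otimes> y = h \<otimes> (z \<otimes> (y \<otimes> x))"
    show ?thesis
    proof (rule Q.hyp_of_commutator[OF split(3) Q_bounded Q_isometry[OF x] Mact[OF x] Q_isometry[OF y] Mact[OF y]
          act_pow_order[OF x] act_pow_order[OF y]])
      fix v assume v: "v \<in> ?M"
      have vM: "act y (act x v) \<in> ?M" using v Mact[OF x] Mact[OF y] by blast
      have "act x (act y v) = act h (act z (act y (act x v)))"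
        using act_mult[of x y v] h(2) act_mult[of h "z \<otimes> (y \<otimes> x)" v] act_mult[of z "y \<otimes> x" v]
          act_mult[of y x v] x y z(1) NS[OF h(1)] by simp
      also have "\<dots> = act z (act y (act x v))" using fixed_fieldD[OF _ h(1)] Vact[OF z(1)] vM by blast
      also have "\<dots> = - act y (act x v)" using vM by blast
      finally show "act x (act y v) = - act y (act x v)" .
    qed
  qed
  then have red': "Q.reduces ?V {x \<in> ?V. act z x = x}"
    using split(1,2) by (intro Q.reduces_osum) auto
  let ?H = "N \<union> {m \<otimes> z | m. m \<in> N}"
  let ?N = "generate T ?H"
  have HS: "?H \<subseteq> S" using NS SS z(1) by auto
  have Ninv: "m \<otimes> k \<in> N" if "m \<in> N" "k \<in> N" for m k using N.m_closed that by simp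
  have conjN: "s \<otimes> m \<otimes> inv s \<in> N" if "s \<in> S" "m \<in> N" for s m
    using N.inv_op_closed2[of s m] that invT by simp
  have "?N \<lhd> T"
  proof (rule T.normal_generateI)
    show "?H \<subseteq> carrier T" using HS by simp
    fix h s assume h: "h \<in> ?H" and "s \<in> carrier T"
    then have s: "s \<in> S" by simp
    show "s \<otimes>\<^bsub>T\<^esub> h \<otimes>\<^bsub>T\<^esub> inv\<^bsub>T\<^esub> s \<in> ?H"
    proof (cases "h \<in> N")
      case True
      then show ?thesis using conjN[OF s] invT[OF s] by simp
    next
      case False
      then obtain m where m: "m \<in> N" "h = m \<otimes> z" using h by blast
      obtain k where k: "k \<in> N" "s \<otimes> z = k \<otimes> (z \<otimes> s)" using z(4) s by blast
      have "s \<otimes> h \<otimes> inv s = (s \<otimes> m \<otimes> inv s) \<otimes> (s \<otimes> z \<otimes> inv s)"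
      proof -
        have "inv s \<otimes> (s \<otimes> (z \<otimes> inv s)) = z \<otimes> inv s" using s z(1) by (simp add: m_assoc[symmetric])
        then show ?thesis using s z(1) NS[OF m(1)] m(2) by (simp add: m_assoc)
      qed
      also have "s \<otimes> z \<otimes> inv s = k \<otimes> z" using k(2) s z(1) NS[OF k(1)] by (simp add: m_assoc)
      also have "(s \<otimes> m \<otimes> inv s) \<otimes> (k \<otimes> z) = ((s \<otimes> m \<otimes> inv s) \<otimes> k) \<otimes> z"
        using s z(1) NS[OF k(1)] NS[OF m(1)] by (simp add: m_assoc)
      finally show ?thesis using Ninv[OF conjN[OF s m(1)] k(1)] invT[OF s] by auto
    qed
  qed
  moreover have "N \<subset> ?N"
  proof -
    have "\<one> \<otimes> z \<in> ?H" using N.one_closed by auto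
    then have "z \<in> ?N" using generate.incl[of "\<one> \<otimes> z" ?H T] z(1) by simp
    then show ?thesis using z(2) generate.incl[of _ ?H T] by blast
  qed
  moreover have "z \<in> \<Phi>"
    using zz
  proof (elim disjE bexE)
    fix x h assume "x \<in> S" "h \<in> N" "z = h \<otimes> (x \<otimes> x)"
    then show ?thesis using \<Phi>cl N(2) square_in_\<Phi> by blast
  next
    fix x y h assume x: "x \<in> S" and y: "y \<in> S" and h: "h \<in> N" "x \<otimes> y = h \<otimes> (z \<otimes> (y \<otimes> x))"
    have hS: "h \<in> S" using NS h by blast
    have "(x \<otimes> x) \<otimes> ((inv x \<otimes> y) \<otimes> (inv x \<otimes> y)) \<otimes> inv (y \<otimes> y) = x \<otimes> y \<otimes> inv (y \<otimes> x)"
    proof -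
      have 1: "x \<otimes> (inv x \<otimes> u) = u" "y \<otimes> (inv y \<otimes> u) = u" if "u \<in> carrier G" for u
        using x y that by (simp_all add: m_assoc[symmetric])
      show ?thesis using x y by (simp add: m_assoc inv_mult_group 1)
    qed
    then have c: "x \<otimes> y \<otimes> inv (y \<otimes> x) \<in> \<Phi>"
      using \<Phi>cl \<Phi>inv square_in_\<Phi> SS x y by metis
    have "x \<otimes> y \<otimes> inv (y \<otimes> x) = h \<otimes> z" unfolding h(2) using x y z(1) hS by (simp add: m_assoc)
    then have "z = inv h \<otimes> (x \<otimes> y \<otimes> inv (y \<otimes> x))" using hS z(1) by (simp add: m_assoc[symmetric])
    then show ?thesis using c \<Phi>cl \<Phi>inv N(2) h(1) by auto
  qed
  then have "?N \<subseteq> \<Phi>" using \<Phi>cl N(2) by (intro T.generate_subgroup_incl \<Phi>.subgroup_axioms) blast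
  moreover have "fixed_field ?N = {x \<in> ?V. act z x = x}"
  proof -
    have "x \<in> fixed_field ?H \<longleftrightarrow> x \<in> ?V \<and> act z x = x" for x
    proof
      assume x: "x \<in> fixed_field ?H"
      have "act (\<one> \<otimes> z) x = x" by (rule fixed_fieldD[OF x]) (use N.one_closed in auto)
      then show "x \<in> ?V \<and> act z x = x" using x z(1) by (auto simp: fixed_field_def)
    next
      assume x: "x \<in> ?V \<and> act z x = x"
      then show "x \<in> fixed_field ?H" using NS z(1) by (auto simp: fixed_field_def act_mult)
    qed
    then show ?thesis using fixed_generate[OF HS] by blast
  qed
  ultimately show ?thesis using Q.reduces_trans[OF red red'] by (intro exI[of _ ?N]) simp
qed

text \<open>
  A normal subgroup \<open>N\<close> in \<open>\<Phi>\<close> with \<open>reduces UNIV (fixed_field N)\<close> and of maximal order must be \<open>\<Phi>\<close>.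
\<close>

theorem reduces_Frattini: "Q.reduces UNIV (fixed_field \<Phi>)"
proof -
  define P where "P = (\<lambda>N. N \<lhd> T \<and> N \<subseteq> \<Phi> \<and> Q.reduces UNIV (fixed_field N))"
  have fin: "finite \<Phi>"
  proof -
    have "\<Phi> \<subseteq> S" using subgroup.subset[OF normal_imp_subgroup[OF \<Phi>_normal]] by simp
    then show ?thesis using finite_G S_sub by (meson finite_subset)
  qed
  have "fixed_field {\<one>} = UNIV" by (auto simp: fixed_field_def act_one)
  moreover have "{\<one>} \<lhd> T" using T.one_is_normal by simp
  moreover have "{\<one>} \<subseteq> \<Phi>" using \<Phi>_normal by (auto dest!: normal_imp_subgroup dest: subgroup.one_closed)
  ultimately have "P {\<one>}" using Q.reduces_refl[OF Q_nondeg_UNIV] by (simp add: P_def)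
  moreover have "\<forall>N. P N \<longrightarrow> card N \<le> card \<Phi>" using card_mono[OF fin] by (auto simp: P_def)
  ultimately obtain N where N: "P N" "\<And>M. P M \<Longrightarrow> card M \<le> card N"
    using ex_has_greatest_nat[of P "{\<one>}" card "Suc (card \<Phi>)"] by (metis le_imp_less_Suc)
  have "N = \<Phi>"
  proof (rule ccontr)
    assume "N \<noteq> \<Phi>"
    then obtain N' where N': "N' \<lhd> T" "N \<subset> N'" "N' \<subseteq> \<Phi>" "Q.reduces UNIV (fixed_field N')"
      using reduces_step[of N] N(1) by (auto simp: P_def)
    then have "card N' \<le> card N" using N(2) by (simp add: P_def)
    moreover have "card N < card N'" using N'(2,3) fin by (meson finite_subset psubset_card_mono)
    ultimately show False by simp
  qed
  then show ?thesis using N(1) by (simp add: P_def)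
qed

end

section \<open>The fixed field of the Frattini subgroup\<close>

context galois_2subgroup
begin

text \<open>The coordinates of an isomorphism onto \<open>(\<int>/2)\<^sup>r\<close>, read as truth values.\<close>

lemma parity_characters:
  assumes "has_frattini_rank T r"
  obtains \<chi> :: "nat \<Rightarrow> 'g \<Rightarrow> bool"
  where "\<And>i s t. i < r \<Longrightarrow> s \<in> S \<Longrightarrow> t \<in> S \<Longrightarrow> \<chi> i (s \<otimes> t) \<longleftrightarrow> \<chi> i s \<noteq> \<chi> i t"
    "\<And>s. s \<in> S \<Longrightarrow> (\<forall>i<r. \<not> \<chi> i s) \<longleftrightarrow> s \<in> \<Phi>"
    "\<And>k. k < r \<Longrightarrow> \<exists>h\<in>S. \<forall>i<r. \<chi> i h \<longleftrightarrow> i = k"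
proof -
  interpret \<Phi>: normal \<Phi> T by (rule \<Phi>_normal)
  let ?P = "product_group {..<r} (\<lambda>_. integer_mod_group 2)"
  obtain \<psi> where \<psi>: "\<psi> \<in> iso (T Mod \<Phi>) ?P"
    using assms by (auto simp: has_frattini_rank_def is_iso_def \<Phi>_def)
  define c where "c = (\<lambda>s. \<Phi> #>\<^bsub>T\<^esub> s)"
  define \<chi> where "\<chi> = (\<lambda>i s. \<psi> (c s) i = 1)"
  have car: "c s \<in> carrier (T Mod \<Phi>)" if "s \<in> S" for s
    using that by (auto simp: c_def FactGroup_def RCOSETS_def)
  have ran: "\<psi> C i = 0 \<or> \<psi> C i = 1" if "C \<in> carrier (T Mod \<Phi>)" "i < r" for C i
  proof -
    have "\<psi> C \<in> carrier ?P" using \<psi> that by (auto simp: iso_def bij_betw_def)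
    then have "\<psi> C i \<in> {0..<2}" using that by (auto simp: carrier_integer_mod_group PiE_iff)
    then show ?thesis by auto
  qed
  have mult: "\<psi> (c (s \<otimes> t)) i = (\<psi> (c s) i + \<psi> (c t) i) mod 2" if "s \<in> S" "t \<in> S" "i < r" for s t i
  proof -
    have "c (s \<otimes> t) = c s \<otimes>\<^bsub>T Mod \<Phi>\<^esub> c t"
      using \<Phi>.rcos_sum[of s t] that by (simp add: c_def)
    then have "\<psi> (c (s \<otimes> t)) = \<psi> (c s) \<otimes>\<^bsub>?P\<^esub> \<psi> (c t)"
      using \<psi> car that by (simp add: iso_def hom_def)
    then show ?thesis using that by (simp add: product_group_def)
  qed
  have hom: "\<chi> i (s \<otimes> t) \<longleftrightarrow> \<chi> i s \<noteq> \<chi> i t" if "i < r" "s \<in> S" "t \<in> S" for i s t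
    using mult[OF that(2,3,1)] ran[OF car[OF that(2)] that(1)] ran[OF car[OF that(3)] that(1)]
    by (auto simp: \<chi>_def)
  have one: "\<one> \<in> S" using S by (rule subgroup.one_closed)
  have c_eq: "c s = c \<one> \<longleftrightarrow> s \<in> \<Phi>" if "s \<in> S" for s
  proof -
    have "c \<one> = \<Phi>" using T.coset_join2[OF _ \<Phi>.subgroup_axioms, of \<one>] one \<Phi>.one_closed by (simp add: c_def)
    moreover have "c s = \<Phi> \<longleftrightarrow> s \<in> \<Phi>"
      using T.coset_join1[of \<Phi> s] T.coset_join2[of s \<Phi>] \<Phi>.subgroup_axioms that by (auto simp: c_def)
    ultimately show ?thesis by simp
  qed
  have \<chi>1: "\<not> \<chi> i \<one>" if "i < r" for i using hom[OF that one one] by simp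
  have ker: "(\<forall>i<r. \<not> \<chi> i s) \<longleftrightarrow> s \<in> \<Phi>" if s: "s \<in> S" for s
  proof
    assume "s \<in> \<Phi>"
    then have "c s = c \<one>" using c_eq[OF s] by simp
    then show "\<forall>i<r. \<not> \<chi> i s" using \<chi>1 by (simp add: \<chi>_def)
  next
    assume 0: "\<forall>i<r. \<not> \<chi> i s"
    have "\<psi> (c s) = \<psi> (c \<one>)"
    proof (rule PiE_ext)
      show "\<psi> (c s) \<in> (\<Pi>\<^sub>E i\<in>{..<r}. carrier (integer_mod_group 2))" "\<psi> (c \<one>) \<in> (\<Pi>\<^sub>E i\<in>{..<r}. carrier (integer_mod_group 2))"
        using \<psi> car[OF s] car[OF one] by (auto simp: iso_def bij_betw_def)
      show "\<psi> (c s) i = \<psi> (c \<one>) i" if "i \<in> {..<r}" for i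
        using that 0 \<chi>1[of i] ran[OF car[OF s], of i] ran[OF car[OF one], of i] by (auto simp: \<chi>_def)
    qed
    then have "c s = c \<one>" using \<psi> car[OF s] car[OF one] by (auto simp: iso_def bij_betw_def dest: inj_onD)
    then show "s \<in> \<Phi>" using c_eq[OF s] by simp
  qed
  have surj: "\<exists>h\<in>S. \<forall>i<r. \<chi> i h \<longleftrightarrow> i = k" if "k < r" for k
  proof -
    let ?e = "\<lambda>i\<in>{..<r}. if i = k then 1 else 0 :: int"
    have "?e \<in> carrier ?P" by (auto simp: carrier_integer_mod_group)
    then have "?e \<in> \<psi> ` carrier (T Mod \<Phi>)" using \<psi> by (simp add: iso_def bij_betw_def)
    then obtain C where C: "C \<in> carrier (T Mod \<Phi>)" "\<psi> C = ?e" by auto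
    then obtain h where "h \<in> S" "C = c h" by (auto simp: FactGroup_def RCOSETS_def c_def)
    then show ?thesis using C(2) by (intro bexI[of _ h]) (auto simp: \<chi>_def)
  qed
  show ?thesis using that hom ker surj by blast
qed

lemma has_type_multiple:
  assumes U: "Q.has_type U cs" and y: "y * y \<in> fixed_field S" "y \<noteq> 0"
  shows "Q.has_type ((*) y ` U) (map ((*) (y * y)) cs)"
proof -
  obtain \<phi> where \<phi>: "Q.coordinates U cs \<phi>" and cs: "Q.units cs" using U by (auto simp: Q.has_type_def)
  note D = Q.coordinatesD[OF \<phi>]
  have "bij_betw ((*) y) U ((*) y ` U)" using y by (auto simp: bij_betw_def inj_on_def)
  then have "bij_betw (\<lambda>x. y * \<phi> x) (vecs (fixed_field S) (length cs)) ((*) y ` U)"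
    using bij_betw_trans[OF D(1)] by (simp add: comp_def)
  moreover have "tr S (y * u * (y * u)) = y * y * tr S (u * u)" for u
    using tr_scale[OF S_sub y(1), of "u * u"] by (simp add: ac_simps)
  moreover have "qval (map ((*) (y * y)) cs) x = y * y * qval cs x" for x
    by (simp add: qval_def sum_distrib_left mult.assoc)
  ultimately have "Q.coordinates ((*) y ` U) (map ((*) (y * y)) cs) (\<lambda>x. y * \<phi> x)"
    using D(3,4,5) by (auto simp: Q.coordinates_def distrib_left mult.left_commute)
  then show ?thesis using cs y by (auto simp: Q.has_type_def)
qed

text \<open>
  The elementary abelian extension is a tower of quadratic extensions
  \<open>V (k + 1) = V k \<oplus> y V k\<close>, where \<open>y\<close> is an eigenvector for the \<open>k\<close>-th character.
\<close>

theorem has_type_Frattini: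
  assumes "has_frattini_rank T r"
  shows "\<exists>as. length as = r \<and> Q.units as \<and>
    Q.has_type (fixed_field \<Phi>) (map ((*) (of_nat (card S))) (pf as))"
proof -
  obtain \<chi> :: "nat \<Rightarrow> 'g \<Rightarrow> bool" where hom: "\<And>i s t. i < r \<Longrightarrow> s \<in> S \<Longrightarrow> t \<in> S \<Longrightarrow> \<chi> i (s \<otimes> t) \<longleftrightarrow> \<chi> i s \<noteq> \<chi> i t"
    and ker: "\<And>s. s \<in> S \<Longrightarrow> (\<forall>i<r. \<not> \<chi> i s) \<longleftrightarrow> s \<in> \<Phi>"
    and surj: "\<And>k. k < r \<Longrightarrow> \<exists>h\<in>S. \<forall>i<r. \<chi> i h \<longleftrightarrow> i = k"
    using parity_characters[OF assms] by blast
  have one: "\<one> \<in> S" using S by (rule subgroup.one_closed)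
  have cl: "x \<otimes> y \<in> S" "inv x \<in> S" if "x \<in> S" "y \<in> S" for x y
    using that S by (auto intro: subgroup.m_closed subgroup.m_inv_closed)
  have \<chi>1: "\<not> \<chi> i \<one>" if "i < r" for i using hom[OF that one one] by simp
  have \<chi>inv: "\<chi> i (inv s) \<longleftrightarrow> \<chi> i s" if "i < r" "s \<in> S" for i s
    using hom[OF that(1) that(2) cl(2)[OF that(2,2)]] \<chi>1[OF that(1)] that(2) by simp
  define V where "V = (\<lambda>k. fixed_field {s \<in> S. \<forall>i<k. \<not> \<chi> i s})"
  have VD: "act s x = x" if "x \<in> V k" "s \<in> S" "\<And>i. i < k \<Longrightarrow> \<not> \<chi> i s" for k x s
    using that by (simp add: V_def fixed_field_def)
  have VI: "x \<in> V k" if "\<And>s. s \<in> S \<Longrightarrow> (\<And>i. i < k \<Longrightarrow> \<not> \<chi> i s) \<Longrightarrow> act s x = x" for k x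
    using that by (simp add: V_def fixed_field_def)
  have stable: "act s x \<in> V k" if k: "k \<le> r" and x: "x \<in> V k" and s: "s \<in> S" for k x s
  proof (rule VI)
    fix m assume m: "m \<in> S" "\<And>i. i < k \<Longrightarrow> \<not> \<chi> i m"
    let ?m = "inv s \<otimes> m \<otimes> s"
    have "\<not> \<chi> i ?m" if "i < k" for i
      using hom[of i "inv s \<otimes> m" s] hom[of i "inv s" m] \<chi>inv[of i s] cl s m that k by auto
    then have "act ?m x = x" using x cl s m by (intro VD) auto
    moreover have "act s (act ?m x) = act m (act s x)"
      using s m by (simp add: act_mult act_inv)
    ultimately show "act m (act s x) = act s x" by simp
  qed
  have "\<exists>as. length as = k \<and> Q.units as \<and> Q.has_type (V k) (map ((*) (of_nat (card S))) (pf as))" if "k \<le> r" for k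
    using that
  proof (induction k)
    case 0
    have "act s 1 = 1" if "s \<in> S" for s using that by (simp add: act_ring)
    then have t1: "tr S (1 * 1) = of_nat (card S)" by (simp add: tr_def)
    have "(of_nat (card S) :: 'l) \<noteq> 0" by (simp add: card_S)
    then have "Q.has_type {c * 1 | c. c \<in> fixed_field S} [tr S (1 * 1)]"
      using t1 by (intro Q.has_type_line) auto
    moreover have "V 0 = {c * 1 | c. c \<in> fixed_field S}" by (auto simp: V_def)
    ultimately show ?case using t1 by (intro exI[of _ "[]"]) simp
  next
    case (Suc k)
    then obtain as where as: "length as = k" "Q.units as" "Q.has_type (V k) (map ((*) (of_nat (card S))) (pf as))" by auto
    have k: "k < r" using Suc.prems by simp
    obtain h where h: "h \<in> S" "\<forall>i<r. \<chi> i h \<longleftrightarrow> i = k" using surj[OF k] by blast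
    define sg where "sg = (\<lambda>s. if \<chi> k s then - 1 else 1 :: 'l)"
    have sgm: "sg s * sg (s \<otimes> t) = sg t" if "s \<in> S" "t \<in> S" for s t
      using hom[OF k that] by (auto simp: sg_def)
    have sga: "act s (sg t) = sg t" if "s \<in> S" for s t using that by (simp add: sg_def act_ring)
    have "\<exists>x. (\<Sum>s\<in>S. sg s * act s x) \<noteq> 0"
      using Dedekind[OF S_sub _ one, of sg] \<chi>1[OF k] by (auto simp: sg_def)
    then obtain x0 where x0: "(\<Sum>s\<in>S. sg s * act s x0) \<noteq> 0" by blast
    define y where "y = (\<Sum>s\<in>S. sg s * act s x0)"
    have y0: "y \<noteq> 0" using x0 by (simp add: y_def)
    have ay: "act t y = sg t * y" if t: "t \<in> S" for t
    proof -
      have "act t y = (\<Sum>s\<in>S. sg s * act (t \<otimes> s) x0)"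
        using t sga by (simp add: y_def act_ring act_mult)
      also have "\<dots> = (\<Sum>s\<in>S. sg t * (sg (t \<otimes> s) * act (t \<otimes> s) x0))"
        using sgm[OF t] by (simp add: mult.assoc[symmetric])
      also have "\<dots> = (\<Sum>s\<in>S. sg t * (sg s * act s x0))"
        by (rule subgroup_sum_shift(1)[OF S t, of "\<lambda>s. sg t * (sg s * act s x0)"])
      finally show ?thesis by (simp add: y_def sum_distrib_left)
    qed
    have yy: "y * y \<in> fixed_field S" using ay by (auto simp: fixed_field_def act_ring sg_def)
    have hk: "\<not> \<chi> i h" if "i < k" for i using h(2) k that by auto
    have ah: "act h y = - y" using ay[OF h(1)] h(2) k by (simp add: sg_def)
    have hh: "act h (act h x) = x" if "x \<in> V (Suc k)" for x
    proof -
      have "act (h \<otimes> h) x = x" using hom[of _ h h] h(1) cl[OF h(1) h(1)] Suc.prems by (intro VD[OF that]) auto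
      then show ?thesis using h(1) by (simp add: act_mult)
    qed
    have key: "act s w = (if \<chi> k s then e * w else w)"
      if w: "w \<in> V (Suc k)" "act h w = e * w" "e = 1 \<or> e = - 1" and s: "s \<in> S" "\<And>i. i < k \<Longrightarrow> \<not> \<chi> i s" for w e s
    proof (cases "\<chi> k s")
      case True
      have "\<not> \<chi> i (s \<otimes> h)" if "i < Suc k" for i
        using that hom[of i s h] s(1) s(2)[of i] h True Suc.prems hk[of i] by (auto simp: less_Suc_eq)
      then have "act (s \<otimes> h) w = w" using VD[OF w(1) cl(1)[OF s(1) h(1)]] by blast
      then have "act s (e * w) = w" using s h(1) w(2) by (simp add: act_mult)
      then have "e * act s w = w" using w(3) s(1) by (auto simp: act_ring)
      then have "act s w = e * w" using w(3) by (metis minus_equation_iff mult_1 mult_minus1)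
      then show ?thesis using True by simp
    next
      case False
      then show ?thesis using VD[OF w(1) s(1)] s(2) by (auto simp: less_Suc_eq)
    qed
    have osum: "Q.osum (V (Suc k)) (V k) ((*) y ` V k)"
      unfolding Q.osum_def
    proof (intro conjI ballI equalityI subsetI)
      fix x assume x: "x \<in> V (Suc k)"
      define u w where "u = 1 / 2 * (x + act h x)" and "w = 1 / 2 * (x - act h x)"
      have F2: "act s (1 / 2) = 1 / 2" if "s \<in> S" for s
        using that act_ring(11)[of s 2] by (simp add: act_ring)
      have hx: "act h x \<in> V (Suc k)" using stable[OF Suc.prems x h(1)] .
      have uw: "u \<in> V (Suc k)" "w \<in> V (Suc k)"
        using VD[OF x] VD[OF hx] F2 by (auto intro!: VI simp: u_def w_def act_ring)
      have hu: "act h u = 1 * u" "act h w = (- 1) * w"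
        using hh[OF x] h(1) F2 by (simp_all add: u_def w_def act_ring add.commute)
          (simp add: mult_minus_right[symmetric] del: mult_minus_right)?
      have "u \<in> V k" using key[OF uw(1) hu(1)] by (intro VI) auto
      moreover have "w / y \<in> V k" using key[OF uw(2) hu(2)] ay by (intro VI) (auto simp: act_ring sg_def)
      moreover have "x = u + y * (w / y)"
      proof -
        have "u + w = 1 / 2 * ((x + act h x) + (x - act h x))"
          unfolding u_def w_def by (rule distrib_left[symmetric])
        also have "\<dots> = 1 / 2 * (2 * x)" by simp
        also have "\<dots> = x" by simp
        finally show ?thesis using y0 by simp
      qed
      ultimately show "x \<in> {u + w |u w. u \<in> V k \<and> w \<in> (*) y ` V k}" by blast
    next
      fix x assume "x \<in> {u + w |u w. u \<in> V k \<and> w \<in> (*) y ` V k}"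
      then obtain u v where uv: "u \<in> V k" "v \<in> V k" "x = u + y * v" by blast
      show "x \<in> V (Suc k)"
      proof (rule VI)
        fix s assume s: "s \<in> S" "\<And>i. i < Suc k \<Longrightarrow> \<not> \<chi> i s"
        then have "act s u = u" "act s v = v" "act s y = y"
          using VD[OF uv(1)] VD[OF uv(2)] ay by (auto simp: sg_def)
        then show "act s x = x" using s(1) uv(3) by (simp add: act_ring)
      qed
    next
      fix u w assume u: "u \<in> V k" and "w \<in> (*) y ` V k"
      then obtain v where v: "v \<in> V k" "w = y * v" by blast
      have "act h (u * w) = - (u * w)"
        using VD[OF u h(1)] VD[OF v(1) h(1)] hk ah h(1) v(2) by (simp add: act_ring)
      then have "tr S (u * w) = tr S ((- 1) * (u * w))" using tr_act[OF S h(1), of "u * w"] by simp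
      also have "\<dots> = - tr S (u * w)"
        by (subst tr_scale[OF S_sub]) simp_all
      finally show "tr S (u * w) = 0" by (rule Q.eq_uminus_self)
    qed
    have "Q.has_type (V (Suc k)) (map ((*) (of_nat (card S))) (pf as) @ map ((*) (y * y)) (map ((*) (of_nat (card S))) (pf as)))"
      by (rule Q.osum_has_type[OF osum as(3) has_type_multiple[OF as(3) yy y0]])
    moreover have "map ((*) (of_nat (card S))) (pf as) @ map ((*) (y * y)) (map ((*) (of_nat (card S))) (pf as)) =
        map ((*) (of_nat (card S))) (pf (y * y # as))"
      by (simp add: pf_Cons comp_def mult.left_commute mult.assoc)
    ultimately show ?case using as yy y0 by (intro exI[of _ "y * y # as"]) simp
  qed
  moreover have "V r = fixed_field \<Phi>"
  proof -
    have "\<Phi> \<subseteq> S" using subgroup.subset[OF normal_imp_subgroup[OF \<Phi>_normal]] by simp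
    then have "{s \<in> S. \<forall>i<r. \<not> \<chi> i s} = \<Phi>" using ker by blast
    then show ?thesis by (simp add: V_def)
  qed
  ultimately show ?thesis by fastforce
qed

corollary Witt_class_trace_form:
  assumes "has_frattini_rank T r"
  shows "\<exists>as cs. length as = r \<and> Q.units as \<and> Q.has_type UNIV cs \<and>
    wequiv (fixed_field S) cs (map ((*) (of_nat (card S))) (pf as))"
proof -
  obtain as where as: "length as = r" "Q.units as"
    "Q.has_type (fixed_field \<Phi>) (map ((*) (of_nat (card S))) (pf as))"
    using has_type_Frattini[OF assms] by blast
  obtain C ds where C: "Q.osum UNIV (fixed_field \<Phi>) C" "Q.has_type C ds" "wequiv (fixed_field S) ds []"
    using reduces_Frattini by (auto simp: Q.reduces_def Q.hyp_def)
  have "wequiv (fixed_field S) (map ((*) (of_nat (card S))) (pf as) @ ds) (map ((*) (of_nat (card S))) (pf as) @ [])"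
    using C(3) by (intro Q.wequiv_append Q.wequiv_refl)
  then show ?thesis using as Q.osum_has_type[OF C(1) as(3) C(2)] by auto
qed

end

section \<open>Fixed fields of odd index\<close>

lemma interpolation:
  fixes \<phi> :: "'f::field \<Rightarrow> 'f"
  assumes "finite A" shows "\<exists>p. (\<forall>k\<ge>card A. Polynomial.coeff p k = 0) \<and> (\<forall>u\<in>A. poly p u = \<phi> u)"
  using assms
proof (induction A rule: finite_induct)
  case empty
  then show ?case by (intro exI[of _ 0]) auto
next
  case (insert a A)
  then obtain p where p: "\<forall>k\<ge>card A. Polynomial.coeff p k = 0" "\<forall>u\<in>A. poly p u = \<phi> u" by blast
  let ?q = "\<Prod>u\<in>A. [:- u, 1:]"
  have q: "poly ?q v = 0 \<longleftrightarrow> v \<in> A" for v using insert.hyps by (auto simp: poly_prod)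
  have deg: "degree ?q \<le> card A"
    using degree_prod_sum_le[OF insert.hyps(1), of "\<lambda>u. [:- u, 1:]"] by (simp add: comp_def)
  define r where "r = p + smult ((\<phi> a - poly p a) / poly ?q a) ?q"
  have "poly r a = \<phi> a" using q[of a] insert.hyps by (simp add: r_def)
  moreover have "poly r u = \<phi> u" if "u \<in> A" for u
  proof -
    have "poly ?q u = 0" using q that by blast
    then show ?thesis using p that unfolding r_def poly_add poly_smult by simp
  qed
  moreover have "Polynomial.coeff r k = 0" if "k \<ge> card (insert a A)" for k
    using that insert.hyps p deg by (auto simp: r_def intro!: coeff_eq_0)
  ultimately show ?case by (intro exI[of _ r]) auto
qed

text \<open>
  The bound on the degree is stated by coefficients, so that it makes sense for \<open>card A = 0\<close>.
\<close>

lemma poly_zero_by_roots: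
  fixes p :: "'f::field poly"
  assumes "\<forall>k\<ge>card A. Polynomial.coeff p k = 0" "\<And>u. u \<in> A \<Longrightarrow> poly p u = 0"
  shows "p = 0"
proof (rule ccontr)
  assume p: "p \<noteq> 0"
  have "card A \<le> card {u. poly p u = 0}"
    using assms(2) by (intro card_mono poly_roots_finite[OF p]) auto
  also have "\<dots> \<le> degree p" by (rule card_poly_roots_bound[OF p])
  finally have "Polynomial.coeff p (degree p) = 0" using assms(1) by blast
  then show False using p by simp
qed

context galois_action
begin

lemma act_poly:
  assumes "g \<in> carrier G" shows "poly (map_poly (act g) p) (act g x) = act g (poly p x)"
proof -
  interpret h: field_hom "act g" by (rule act_hom[OF assms])
  interpret mp: map_poly_comm_semiring_hom "act g" ..
  show ?thesis by simp
qed

definition ev :: "'l \<Rightarrow> 'k poly \<Rightarrow> 'l" where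
  "ev x p = poly (map_poly \<iota> p) x"

lemma ev_ring:
  "ev x (p + q) = ev x p + ev x q" "ev x (p * q) = ev x p * ev x q" "ev x 0 = 0" "ev x 1 = 1"
  "ev x (smult c p) = \<iota> c * ev x p" "ev x (p ^ k) = ev x p ^ k" "ev x (p - q) = ev x p - ev x q"
  "ev x (sum f A) = (\<Sum>a\<in>A. ev x (f a))" "ev x (Polynomial.monom 1 k) = x ^ k"
proof -
  interpret mp: map_poly_idom_hom \<iota> ..
  show "ev x (p + q) = ev x p + ev x q" "ev x (p * q) = ev x p * ev x q" "ev x 0 = 0" "ev x 1 = 1"
    "ev x (smult c p) = \<iota> c * ev x p" "ev x (p ^ k) = ev x p ^ k" "ev x (p - q) = ev x p - ev x q"
    "ev x (sum f A) = (\<Sum>a\<in>A. ev x (f a))" "ev x (Polynomial.monom 1 k) = x ^ k"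
    by (simp_all add: ev_def hom_distribs poly_sum poly_monom)
qed

lemma act_ev: assumes "g \<in> carrier G" shows "act g (ev x p) = ev (act g x) p"
proof -
  have "act g \<circ> \<iota> = \<iota>" using act_emb[OF assms] by auto
  then have "map_poly (act g) (map_poly \<iota> p) = map_poly \<iota> p"
    using act_ring(3)[OF assms] by (subst map_poly_map_poly) auto
  then show ?thesis using act_poly[OF assms, of "map_poly \<iota> p" x] by (simp add: ev_def)
qed

definition conjugates :: "'l \<Rightarrow> 'l set" where
  "conjugates x = (\<lambda>g. act g x) ` carrier G"

lemma finite_conjugates: "finite (conjugates x)"
  using finite_G by (simp add: conjugates_def)

text \<open>
  All conjugates of \<open>x\<close> are roots.
\<close>

lemma ev_zero_degree: assumes "ev x p = 0" "p \<noteq> 0" shows "card (conjugates x) \<le> degree p"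
proof (rule ccontr)
  assume neg: "\<not> ?thesis"
  have "map_poly \<iota> p = 0"
  proof (rule poly_zero_by_roots[where A = "conjugates x"])
    show "\<forall>k\<ge>card (conjugates x). Polynomial.coeff (map_poly \<iota> p) k = 0"
      using neg by (auto simp: coeff_map_poly coeff_eq_0)
    fix u assume "u \<in> conjugates x"
    then obtain g where g: "g \<in> carrier G" "u = act g x" by (auto simp: conjugates_def)
    then have "ev u p = act g (ev x p)" by (simp add: act_ev)
    then show "poly (map_poly \<iota> p) u = 0" using assms(1) g by (simp add: ev_def act_ring)
  qed
  then have "Polynomial.coeff p k = 0" for k
    using coeff_map_poly[of \<iota> p k] by simp
  then show False using assms(2) by (metis leading_coeff_0_iff)
qed

text \<open>
  The polynomial \<open>p\<close> over \<open>L\<close> with \<open>p (g x) = g y\<close> is unchanged by the action on its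
  coefficients, by uniqueness.
\<close>

lemma ev_surj:
  assumes "\<And>g. g \<in> carrier G \<Longrightarrow> act g x = x \<Longrightarrow> act g y = y"
  shows "\<exists>p. (\<forall>k\<ge>card (conjugates x). Polynomial.coeff p k = 0) \<and> ev x p = y"
proof -
  define \<phi> where "\<phi> = (\<lambda>u. act (SOME g. g \<in> carrier G \<and> act g x = u) y)"
  have \<phi>: "\<phi> (act g x) = act g y" if g: "g \<in> carrier G" for g
  proof -
    let ?h = "SOME h. h \<in> carrier G \<and> act h x = act g x"
    have h: "?h \<in> carrier G \<and> act ?h x = act g x" by (rule someI[of _ g]) (use g in simp)
    then have "act (inv g \<otimes> ?h) x = x" using g by (simp add: act_mult act_inv)
    then have "act (inv g \<otimes> ?h) y = y" using assms g h by simp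
    then have "act g (act (inv g) (act ?h y)) = act g y" using g h by (simp add: act_mult)
    then show ?thesis using g by (simp add: \<phi>_def act_inv)
  qed
  obtain q where q: "\<forall>k\<ge>card (conjugates x). Polynomial.coeff q k = 0" "\<forall>u\<in>conjugates x. poly q u = \<phi> u"
    using interpolation[OF finite_conjugates] by blast
  have inv: "map_poly (act g) q = q" if g: "g \<in> carrier G" for g
  proof -
    have "map_poly (act g) q - q = 0"
    proof (rule poly_zero_by_roots[where A = "conjugates x"])
      show "\<forall>k\<ge>card (conjugates x). Polynomial.coeff (map_poly (act g) q - q) k = 0"
        using q(1) g by (auto simp: coeff_map_poly act_ring)
      fix u assume "u \<in> conjugates x"
      then obtain k where k: "k \<in> carrier G" "u = act k x" by (auto simp: conjugates_def)
      let ?v = "act (inv g \<otimes> k) x"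
      have u: "u = act g ?v" using g k by (simp add: act_mult act_inv)
      have "poly (map_poly (act g) q) u = act g (poly q ?v)" unfolding u by (rule act_poly[OF g])
      also have "poly q ?v = act (inv g \<otimes> k) y" using q(2) \<phi>[of "inv g \<otimes> k"] g k by (simp add: conjugates_def)
      also have "act g \<dots> = act k y" using g k by (simp add: act_mult act_inv)
      also have "\<dots> = poly q u" using q(2) \<phi>[OF k(1)] k by (simp add: conjugates_def)
      finally show "poly (map_poly (act g) q - q) u = 0" by simp
    qed
    then show ?thesis by simp
  qed
  have coeffs: "Polynomial.coeff q k \<in> range \<iota>" for k
  proof -
    have "act g (Polynomial.coeff q k) = Polynomial.coeff q k" if "g \<in> carrier G" for g
      using inv[OF that] coeff_map_poly[of "act g" q k] act_ring(3)[OF that] by simp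
    then show ?thesis using fixed by blast
  qed
  define p where "p = map_poly (inv_into UNIV \<iota>) q"
  have i0: "inv_into UNIV \<iota> 0 = 0" using inv_into_f_f[of \<iota> UNIV 0] inj_f by simp
  have cp: "Polynomial.coeff p k = inv_into UNIV \<iota> (Polynomial.coeff q k)" for k
    unfolding p_def by (rule coeff_map_poly[of "inv_into UNIV \<iota>" q k, OF i0])
  have "map_poly \<iota> p = q"
    by (rule poly_eqI) (simp add: coeff_map_poly cp f_inv_into_f[OF coeffs])
  moreover have "x \<in> conjugates x" unfolding conjugates_def by (rule image_eqI[of _ _ \<one>]) (simp_all add: act_one)
  then have "poly q x = y" using q(2) \<phi>[of \<one>] by (simp add: act_one)
  ultimately show ?thesis using q(1) cp i0 by (intro exI[of _ p]) (simp add: ev_def)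
qed

text \<open>
  If \<open>x\<close> has \<open>n\<close> conjugates, then \<open>x ^ n\<close> is the value at \<open>x\<close> of a polynomial \<open>q\<close> of degree less than
  \<open>n\<close>, and the polynomial is the difference of \<open>X ^ n\<close> and \<open>q\<close>.
\<close>

lemma minimal_polynomial:
  obtains f where "irreducible f" "degree f = card (conjugates x)" "\<And>p. ev x p = 0 \<Longrightarrow> f dvd p"
    "ev x f = 0"
proof -
  let ?n = "card (conjugates x)"
  obtain q where q: "\<forall>k\<ge>?n. Polynomial.coeff q k = 0" "ev x q = x ^ ?n"
    using ev_surj[of x "x ^ ?n"] by (auto simp: act_ring)
  define f where "f = Polynomial.monom 1 ?n - q"
  have ev: "ev x f = 0" using q by (simp add: f_def ev_ring)
  have cf: "Polynomial.coeff f ?n = 1" using q by (simp add: f_def)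
  have f0: "f \<noteq> 0" using cf by auto
  have "degree f \<le> ?n" using q(1) by (intro degree_le) (auto simp: f_def)
  then have deg: "degree f = ?n" using cf by (metis le_antisym le_degree one_neq_zero)
  have dvd: "f dvd p" if "ev x p = 0" for p
  proof (rule ccontr)
    assume "\<not> f dvd p"
    then have r: "p mod f \<noteq> 0" by (simp add: mod_eq_0_iff_dvd)
    have "ev x (p div f * f + p mod f) = 0" using that by simp
    then have "ev x (p mod f) = 0" unfolding ev_ring ev by simp
    then have "?n \<le> degree (p mod f)" by (rule ev_zero_degree[OF _ r])
    moreover have "degree (p mod f) < degree f" using degree_mod_less[OF f0, of p] r by blast
    ultimately show False using deg by simp
  qed
  have "x \<in> conjugates x" unfolding conjugates_def by (rule image_eqI[of _ _ \<one>]) (simp_all add: act_one)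
  then have pos: "?n > 0" using finite_conjugates by (auto simp: card_gt_0_iff)
  have "irreducible f"
  proof (rule irreducibleI[OF f0])
    show "\<not> f dvd 1" using pos deg f0 by (simp add: is_unit_iff_degree)
    fix a b assume ab: "f = a * b"
    then have nz: "a \<noteq> 0" "b \<noteq> 0" using f0 by auto
    have d: "degree a + degree b = ?n" using deg ab nz by (simp add: degree_mult_eq)
    have "ev x a = 0 \<or> ev x b = 0" using ev ab by (simp add: ev_ring)
    then have "degree b = 0 \<or> degree a = 0" using ev_zero_degree nz d by fastforce
    then show "a dvd 1 \<or> b dvd 1" using nz by (auto simp: is_unit_iff_degree)
  qed
  then show ?thesis using that deg dvd ev by blast
qed

text \<open>
  Otherwise the sum of the automorphisms in \<open>S\<close> agrees with that of the disjoint coset of \<open>g\<close>, against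
  Dedekind's lemma.
\<close>

lemma moved_element:
  assumes S: "subgroup S G" and g: "g \<in> carrier G" "g \<notin> S"
  shows "\<exists>y\<in>fixed_field S. act g y \<noteq> y"
proof (rule ccontr)
  assume "\<not> ?thesis"
  then have fix_tr: "act g (tr S u) = tr S u" for u using tr_fixed[OF S] by blast
  have SG: "s \<in> carrier G" if "s \<in> S" for s using S that by (rule subgroup.mem_carrier)
  let ?gS = "(\<lambda>s. g \<otimes> s) ` S"
  have disj: "g \<otimes> s \<notin> S" if "s \<in> S" for s
  proof
    assume "g \<otimes> s \<in> S"
    then have "g \<otimes> s \<otimes> inv s \<in> S" using S that by (meson subgroup.m_closed subgroup.m_inv_closed)
    then show False using g SG[OF that] by (simp add: m_assoc)
  qed
  have fin: "finite S" using finite_G SG by (meson finite_subset subsetI)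
  define a where "a = (\<lambda>h. if h \<in> S then - 1 else 1 :: 'l)"
  have one: "\<one> \<in> S" using S by (rule subgroup.one_closed)
  have "a \<one> = 0"
  proof (rule Dedekind[of "S \<union> ?gS" a])
    show "S \<union> ?gS \<subseteq> carrier G" using SG g by auto
    show "\<one> \<in> S \<union> ?gS" using one by simp
    fix u
    have inj: "inj_on (\<lambda>s. g \<otimes> s) S" using SG g by (auto simp: inj_on_def)
    have "(\<Sum>h\<in>S \<union> ?gS. a h * act h u) = (\<Sum>h\<in>S. a h * act h u) + (\<Sum>h\<in>?gS. a h * act h u)"
      using fin disj by (intro sum.union_disjoint) auto
    also have "(\<Sum>h\<in>S. a h * act h u) = - tr S u" by (simp add: a_def tr_def sum_negf)
    also have "(\<Sum>h\<in>?gS. a h * act h u) = act g (tr S u)"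
      using disj SG g by (simp add: sum.reindex[OF inj] a_def act_mult tr_def act_ring)
    finally show "(\<Sum>h\<in>S \<union> ?gS. a h * act h u) = 0" using fix_tr by simp
  qed
  then show False using one by (simp add: a_def)
qed

text \<open>
  If \<open>x\<close> is moved by \<open>D\<close> and \<open>y\<close> by \<open>g\<close>, then \<open>x + t y\<close> is moved by \<open>g\<close> and by \<open>D\<close> for all but finitely many
  \<open>t\<close> in the base field.
\<close>

lemma primitive_element_infinite:
  assumes inf: "infinite (UNIV :: 'k set)" and S: "subgroup S G"
    and D: "finite D" "D \<subseteq> carrier G - S"
  shows "\<exists>x\<in>fixed_field S. \<forall>g\<in>D. act g x \<noteq> x"
  using D
proof (induction D rule: finite_induct)
  case empty
  show ?case using tr_fixed[OF S] by blast
next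
  case (insert g D)
  have sub: "S \<subseteq> carrier G" using S by (rule subgroup.subset)
  interpret F: coeff_field "fixed_field S" by (rule coeff_field_fixed[OF sub])
  obtain x where x: "x \<in> fixed_field S" "\<forall>g\<in>D. act g x \<noteq> x" using insert by auto
  show ?case
  proof (cases "act g x = x")
    case True
    obtain y where y: "y \<in> fixed_field S" "act g y \<noteq> y" using moved_element[OF S] insert.prems by auto
    define bad where "bad = (\<lambda>h. {t. act h (x + \<iota> t * y) = x + \<iota> t * y})"
    have "finite (bad h)" if h: "h \<in> insert g D" for h
    proof -
      have hG: "h \<in> carrier G" using h insert.prems by auto
      have eq: "t \<in> bad h \<longleftrightarrow> \<iota> t * (act h y - y) = x - act h x" for t
        using hG by (auto simp: bad_def act_ring act_emb algebra_simps)
      show ?thesis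
      proof (cases "act h y = y")
        case True
        then have "h \<noteq> g" using y by auto
        then have "act h x \<noteq> x" using h x by auto
        then have "bad h = {}" using eq True by auto
        then show ?thesis by simp
      next
        case False
        have "s = t" if "s \<in> bad h" "t \<in> bad h" for s t
        proof -
          have "\<iota> s * (act h y - y) = \<iota> t * (act h y - y)" using that eq by simp
          then show ?thesis using False by simp
        qed
        then have "bad h \<subseteq> {s}" if "s \<in> bad h" for s using that by blast
        then show ?thesis by (metis finite.emptyI finite_insert finite_subset all_not_in_conv)
      qed
    qed
    then have "finite (\<Union>h\<in>insert g D. bad h)" using insert.hyps by blast
    then obtain t where "t \<notin> (\<Union>h\<in>insert g D. bad h)" using inf by (metis ex_new_if_finite)
    then show ?thesis using x y emb_fixed[OF sub]
      by (intro bexI[of _ "x + \<iota> t * y"]) (auto simp: bad_def)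
  qed (use x in auto)
qed

text \<open>
  A generator of the cyclic multiplicative group of the fixed field is moved whenever any of its
  elements is.
\<close>

lemma primitive_element_finite:
  assumes fin: "finite (fixed_field S)" and S: "subgroup S G"
  shows "\<exists>x\<in>fixed_field S. \<forall>g\<in>carrier G - S. act g x \<noteq> x"
proof -
  have sub: "S \<subseteq> carrier G" using S by (rule subgroup.subset)
  interpret F: coeff_field "fixed_field S" by (rule coeff_field_fixed[OF sub])
  define R where "R = (\<lparr>carrier = fixed_field S, monoid.mult = (*), one = 1, ring.zero = 0, add = (+)\<rparr> :: 'l ring)"
  have "cring R"
  proof (rule cringI)
    show "abelian_group R"
    proof (rule abelian_groupI)
      fix x assume "x \<in> carrier R"
      then show "\<exists>y\<in>carrier R. y \<oplus>\<^bsub>R\<^esub> x = \<zero>\<^bsub>R\<^esub>" by (intro bexI[of _ "- x"]) (auto simp: R_def)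
    qed (auto simp: R_def algebra_simps)
    show "comm_monoid R" by (rule comm_monoidI) (auto simp: R_def)
  qed (auto simp: R_def algebra_simps)
  then interpret R: cring R .
  have "field R"
  proof (rule R.cring_fieldI)
    show "Units R = carrier R - {\<zero>\<^bsub>R\<^esub>}"
    proof (intro equalityI subsetI)
      fix x assume "x \<in> carrier R - {\<zero>\<^bsub>R\<^esub>}"
      then show "x \<in> Units R" by (auto simp: Units_def R_def intro!: bexI[of _ "inverse x"])
    qed (auto simp: Units_def R_def)
  qed
  then interpret R: field R .
  obtain x where x: "x \<in> carrier (mult_of R)" "carrier (mult_of R) = {x [^]\<^bsub>R\<^esub> i | i::nat. i \<in> UNIV}"
    using R.finite_field_mult_group_has_gen fin by (auto simp: R_def)
  have pow: "x [^]\<^bsub>R\<^esub> i = x ^ i" for i :: nat by (induction i) (auto simp: R_def)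
  have xF: "x \<in> fixed_field S" using x by (simp add: R_def)
  have "act g x \<noteq> x" if g: "g \<in> carrier G - S" for g
  proof
    assume gx: "act g x = x"
    obtain y where y: "y \<in> fixed_field S" "act g y \<noteq> y" using moved_element[OF S] g by auto
    have "y \<noteq> 0" using y g by (auto simp: act_ring)
    then have "y \<in> carrier (mult_of R)" using y by (simp add: R_def)
    then obtain i :: nat where "y = x ^ i" using x(2) pow by auto
    then show False using y gx g by (simp add: act_ring)
  qed
  then show ?thesis using xF by blast
qed

lemma finite_of_finite_base:
  assumes "finite (UNIV :: 'k set)" "finite_extension \<iota>" shows "finite (UNIV :: 'l set)"
proof -
  obtain B where B: "finite B" "module.span (ext_scale \<iota>) B = UNIV"
    using assms(2) by (auto simp: finite_extension_def)
  interpret vector_space "ext_scale \<iota>"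
    by unfold_locales (auto simp: ext_scale_def hom_distribs algebra_simps)
  have "UNIV \<subseteq> (\<lambda>u. \<Sum>v\<in>B. ext_scale \<iota> (u v) v) ` (B \<rightarrow>\<^sub>E UNIV)"
  proof
    fix x :: 'l
    have "x \<in> span B" using B(2) by simp
    then obtain u where u: "x = (\<Sum>v\<in>B. ext_scale \<iota> (u v) v)" using span_finite[OF B(1)] by auto
    then show "x \<in> (\<lambda>u. \<Sum>v\<in>B. ext_scale \<iota> (u v) v) ` (B \<rightarrow>\<^sub>E UNIV)"
      by (intro image_eqI[of _ _ "restrict u B"]) auto
  qed
  moreover have "finite (B \<rightarrow>\<^sub>E (UNIV :: 'k set))" using B assms(1) by (intro finite_PiE) auto
  ultimately show ?thesis using finite_surj by blast
qed

lemma primitive_element: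
  assumes "finite_extension \<iota>" "subgroup S G"
  shows "\<exists>x\<in>fixed_field S. \<forall>g\<in>carrier G - S. act g x \<noteq> x"
proof (cases "finite (UNIV :: 'k set)")
  case True
  then have "finite (fixed_field S)" using finite_of_finite_base assms(1) by (meson finite_subset subset_UNIV)
  then show ?thesis using primitive_element_finite assms(2) by blast
next
  case False
  then show ?thesis using primitive_element_infinite[OF False assms(2), of "carrier G - S"] finite_G by auto
qed

text \<open>
  The fibres of \<open>g \<mapsto> act g x\<close> are the left cosets of \<open>S\<close>.
\<close>

lemma card_conjugates:
  assumes S: "subgroup S G" and x: "x \<in> fixed_field S" "\<forall>g\<in>carrier G - S. act g x \<noteq> x"
  shows "card (conjugates x) * card S = card (carrier G)"
proof -
  have SG: "s \<in> carrier G" if "s \<in> S" for s using S that by (rule subgroup.mem_carrier)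
  have fiber: "card {h \<in> carrier G. act h x = u} = card S" if u: "u \<in> conjugates x" for u
  proof -
    obtain g where g: "g \<in> carrier G" "u = act g x" using u by (auto simp: conjugates_def)
    have "{h \<in> carrier G. act h x = u} = (\<lambda>s. g \<otimes> s) ` S"
    proof (intro equalityI subsetI)
      fix h assume "h \<in> {h \<in> carrier G. act h x = u}"
      then have h: "h \<in> carrier G" "act h x = act g x" using g by auto
      have "act (inv g \<otimes> h) x = x" using g h by (simp add: act_mult act_inv)
      then have "inv g \<otimes> h \<in> S" using x(2) g h by auto
      moreover have "h = g \<otimes> (inv g \<otimes> h)" using g h by (simp add: m_assoc[symmetric])
      ultimately show "h \<in> (\<lambda>s. g \<otimes> s) ` S" by blast
    next
      fix h assume "h \<in> (\<lambda>s. g \<otimes> s) ` S"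
      then show "h \<in> {h \<in> carrier G. act h x = u}" using g SG x(1) by (auto simp: act_mult fixed_fieldD)
    qed
    moreover have "inj_on (\<lambda>s. g \<otimes> s) S" using SG g by (auto simp: inj_on_def)
    ultimately show ?thesis by (simp add: card_image)
  qed
  have "card (carrier G) = (\<Sum>u\<in>conjugates x. card {h \<in> carrier G. act h x = u})"
    using sum.image_gen[OF finite_G, of "\<lambda>_. 1 :: nat" "\<lambda>h. act h x"] by (simp add: conjugates_def)
  then show ?thesis using fiber by simp
qed

text \<open>
  The fixed field is \<open>K(x)\<close> for an element \<open>x\<close> whose minimal polynomial has odd degree, so the
  coordinates of a vector over it are values at \<open>x\<close> of polynomials over \<open>K\<close>.
\<close>

theorem Springer_fixed_field:
  assumes fe: "finite_extension \<iota>" and S: "subgroup S G" and odd: "card (carrier G) = m * card S" "odd m"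
    and aniso: "coeff_field.anisotropic UNIV cs"
  shows "coeff_field.anisotropic (fixed_field S) (map \<iota> cs)"
proof -
  have sub: "S \<subseteq> carrier G" using S by (rule subgroup.subset)
  interpret F: coeff_field "fixed_field S" by (rule coeff_field_fixed[OF sub])
  interpret K: coeff_field "UNIV :: 'k set" by unfold_locales auto
  obtain x where x: "x \<in> fixed_field S" "\<forall>g\<in>carrier G - S. act g x \<noteq> x" using primitive_element[OF fe S] by blast
  obtain f where f: "irreducible f" "degree f = card (conjugates x)" "\<And>p. ev x p = 0 \<Longrightarrow> f dvd p" "ev x f = 0"
    using minimal_polynomial[of x] by blast
  have "card S > 0" using S finite_G sub by (metis card_gt_0_iff empty_iff finite_subset subgroup.one_closed)
  then have oddf: "odd (degree f)" using card_conjugates[OF S x] odd f(2) by simp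
  have surj: "\<exists>p. ev x p = y" if "y \<in> fixed_field S" for y
  proof -
    have "act g y = y" if "g \<in> carrier G" "act g x = x" for g
      using that x(2) \<open>y \<in> fixed_field S\<close> by (auto simp: fixed_field_def)
    then show ?thesis using ev_surj by blast
  qed
  show ?thesis
    unfolding F.anisotropic_def
  proof (intro ballI impI)
    fix y assume y: "y \<in> vecs (fixed_field S) (length (map \<iota> cs))" "qval (map \<iota> cs) y = 0"
    have "\<forall>i. \<exists>p. ev x p = y i" using surj y(1) by (auto simp: vecs_def)
    then obtain v where v: "\<And>i. ev x (v i) = y i" by metis
    have "ev x (qpoly cs v) = qval (map \<iota> cs) y" by (simp add: qpoly_def qval_def ev_ring v)
    then have fd: "f dvd qpoly cs v" using y(2) f(3) by simp
    have an: "\<forall>y. qval cs y = 0 \<longrightarrow> (\<forall>i<length cs. y i = 0)"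
      using K.anisotropic_coeff[OF refl aniso] by blast
    have "y i = 0" if "i < length cs" for i
    proof -
      have "f dvd v i" by (rule Springer_polynomials[OF an f(1) oddf fd that])
      then obtain q where "v i = f * q" by (auto simp: dvd_def)
      then show ?thesis using v[of i] f(4) by (simp add: ev_ring)
    qed
    then have "y i = 0" for i using y(1) by (cases "i < length cs") (auto simp: vecs_def)
    then show "y = (\<lambda>_. 0)" by auto
  qed
qed

end

section \<open>The trace form over the base field\<close>

context galois_action_i
begin

lemma carrier_subgroup: "subgroup (carrier G) G"
  by (rule subgroup_self)

definition trK :: "'l \<Rightarrow> 'k" where
  "trK x = inv_into UNIV \<iota> (tr (carrier G) x)"

lemma emb_trK: "\<iota> (trK x) = tr (carrier G) x"
proof -
  have "tr (carrier G) x \<in> range \<iota>"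
    using tr_fixed[OF carrier_subgroup, of x] fixed by (auto simp: fixed_field_def)
  then show ?thesis unfolding trK_def by (rule f_inv_into_f)
qed

lemma trK_add: "trK (x + y) = trK x + trK y"
proof -
  have "\<iota> (trK (x + y)) = \<iota> (trK x + trK y)" by (simp add: emb_trK tr_add hom_add)
  then show ?thesis using inj_f by (auto dest: injD)
qed

lemma trK_scale: "trK (\<iota> c * x) = c * trK x"
proof -
  have "\<iota> (trK (\<iota> c * x)) = \<iota> (c * trK x)"
    by (simp add: emb_trK tr_scale emb_fixed hom_mult)
  then show ?thesis using inj_f by (auto dest: injD)
qed

sublocale vs: vector_space "ext_scale \<iota>"
  by unfold_locales (auto simp: ext_scale_def hom_distribs algebra_simps)

sublocale K: quad_space_i "UNIV :: 'k set" "ext_scale \<iota>" "\<lambda>x y. trK (x * y)"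
proof -
  have comm: "trK (x * y) = trK (y * x)" for x y by (simp add: mult.commute)
  show "quad_space_i (UNIV :: 'k set) (ext_scale \<iota>) (\<lambda>x y. trK (x * y))"
    by (unfold_locales; (fact comm | use two_ne sqrt_minus_one in
        \<open>auto simp: ext_scale_def hom_distribs distrib_left distrib_right trK_add trK_scale mult.assoc\<close>))
qed

lemma K_has_type: "\<exists>ds. K.has_type UNIV ds"
proof (rule K.orthogonal_basis)
  have "x = 0" if "\<And>y. trK (x * y) = 0" for x
  proof (rule tr_nondegenerate[OF carrier_subgroup])
    show "tr (carrier G) (x * y) = 0" for y using that[of y] emb_trK[of "x * y"] by simp
  qed
  then show "K.nondeg UNIV" by (auto simp: K.nondeg_def K.subsp_def)
  obtain B where B: "finite B" "vs.span B = UNIV"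
    using fin_ext by (auto simp: finite_extension_def)
  show "K.bounded UNIV"
    by (rule K.bounded_of_spanning[OF vs.vector_space_axioms B, where h = "\<lambda>c. c"])
      (auto simp: ext_scale_def trK_scale mult.assoc)
qed

text \<open>
  For a basis \<open>B\<close> of \<open>L\<close> over \<open>K\<close> with dual basis \<open>d\<close> with respect to the form
  \<open>\<Sum>\<^sub>g g (x y)\<close>, the identity \<open>y = \<Sum>\<^sub>g (\<Sum>\<^sub>b b g (d b)) g y\<close> and Dedekind's lemma yield
  \<open>\<Sum>\<^sub>b b (d b) = 1\<close>, so the matrix trace \<open>\<Sum>\<^sub>b \<Sum>\<^sub>g g (d b x b)\<close> is \<open>\<Sum>\<^sub>g g x\<close>.
\<close>

theorem ext_trace_eq: "ext_trace \<iota> x = trK x"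
proof -
  define B where "B = vs.extend_basis {}"
  have ind: "vs.independent B" and span: "vs.span B = UNIV"
    unfolding B_def using vs.independent_extend_basis vs.span_extend_basis vs.independent_empty by blast+
  obtain A where A: "finite A" "vs.span A = UNIV" using fin_ext by (auto simp: finite_extension_def)
  have fin: "finite B" using vs.independent_span_bound[OF A(1) ind] A(2) by auto
  obtain ds where ds: "K.has_type UNIV ds" using K_has_type by blast
  have "\<exists>d. \<forall>y. trK (d * y) = vs.representation B y b" for b
    using K.Riesz[OF ds, of "\<lambda>y. vs.representation B y b"] span
      vs.representation_add[OF ind] vs.representation_scale[OF ind] by auto
  then obtain d where d: "\<And>b y. trK (d b * y) = vs.representation B y b" by metis
  have expand: "(\<Sum>b\<in>B. tr (carrier G) (d b * y) * b) = y" for y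
  proof -
    have "(\<Sum>b\<in>B. ext_scale \<iota> (vs.representation B y b) b) = y"
      by (rule vs.sum_representation_eq[OF ind _ fin]) (simp_all add: span)
    then show ?thesis by (simp add: ext_scale_def d[symmetric] emb_trK)
  qed
  have "(\<Sum>b\<in>B. act \<one> (d b) * b) - 1 = 0"
  proof -
    let ?a = "\<lambda>g. (\<Sum>b\<in>B. act g (d b) * b) - (if g = \<one> then 1 else 0)"
    have "?a \<one> = 0"
    proof (rule Dedekind[of "carrier G" ?a])
      fix y
      have "(\<Sum>g\<in>carrier G. ?a g * act g y) =
          (\<Sum>g\<in>carrier G. \<Sum>b\<in>B. act g (d b * y) * b) - (\<Sum>g\<in>carrier G. if g = \<one> then act g y else 0)"
        unfolding sum_subtractf[symmetric]
      proof (rule sum.cong[OF refl])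
        fix g assume "g \<in> carrier G"
        then have "(\<Sum>b\<in>B. act g (d b * y) * b) = (\<Sum>b\<in>B. act g (d b) * b) * act g y"
          by (simp add: sum_distrib_right act_ring mult.assoc mult.commute[of "act g y"])
        then show "?a g * act g y = (\<Sum>b\<in>B. act g (d b * y) * b) - (if g = \<one> then act g y else 0)"
          by (simp add: left_diff_distrib)
      qed
      also have "(\<Sum>g\<in>carrier G. \<Sum>b\<in>B. act g (d b * y) * b) = y"
        using expand[of y] by (subst sum.swap) (simp add: tr_def sum_distrib_right)
      also have "(\<Sum>g\<in>carrier G. if g = \<one> then act g y else 0) = y" using finite_G by (simp add: act_one)
      finally show "(\<Sum>g\<in>carrier G. ?a g * act g y) = 0" by simp
    qed simp_all
    then show ?thesis by simp
  qed
  then have dual: "(\<Sum>b\<in>B. d b * b) = 1" by (simp add: act_one)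
  have trK_sum: "trK (sum f B) = (\<Sum>b\<in>B. trK (f b))" for f
    using fin by (induction B rule: finite_induct) (use trK_scale[of 0 0] in \<open>auto simp: trK_add\<close>)
  have "ext_trace \<iota> x = (\<Sum>b\<in>B. trK (x * (d b * b)))"
    unfolding ext_trace_def Let_def B_def[symmetric] by (simp add: d[symmetric] ac_simps)
  also have "\<dots> = trK (x * (\<Sum>b\<in>B. d b * b))" by (simp add: trK_sum[symmetric] sum_distrib_left)
  finally show ?thesis by (simp add: dual)
qed

end

section \<open>Extension of scalars for the trace form\<close>

context galois_2subgroup
begin

text \<open>
  \<open>L \<otimes> L\<^sup>S\<close> is realized as the space of all \<open>v : G \<rightarrow> L\<close> with \<open>v (s g) = s (v g)\<close> for
  \<open>s \<in> S\<close>, with the standard scalar product; \<open>x \<in> L\<close> becomes \<open>g \<mapsto> g x\<close>.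
\<close>

definition equivariant :: "'g set \<Rightarrow> ('g \<Rightarrow> 'l) set" where
  "equivariant C = {v. (\<forall>g. g \<notin> C \<longrightarrow> v g = 0) \<and> (\<forall>s\<in>S. \<forall>g\<in>carrier G. v (s \<otimes> g) = act s (v g))}"

sublocale E: quad_space_i "fixed_field S" "\<lambda>c (v :: 'g \<Rightarrow> 'l) g. c * v g" "\<lambda>v w. \<Sum>g\<in>carrier G. v g * w g"
proof -
  have comm: "(\<Sum>g\<in>carrier G. x g * y g) = (\<Sum>g\<in>carrier G. y g * x g)" for x y :: "'g \<Rightarrow> 'l"
    by (simp add: mult.commute)
  show "quad_space_i (fixed_field S) (\<lambda>c (v :: 'g \<Rightarrow> 'l) g. c * v g) (\<lambda>v w. \<Sum>g\<in>carrier G. v g * w g)"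
    by (unfold_locales; (fact comm |
       auto simp: fun_eq_iff distrib_left distrib_right sum.distrib sum_distrib_left mult.assoc))
qed

text \<open>
  An orthogonal basis \<open>e\<close> of \<open>L\<close> over \<open>K\<close> gives the vectors \<open>g \<mapsto> act g (e j)\<close>.  They span: subtracting the
  orthogonal projection from an equivariant \<open>v\<close> leaves some \<open>w\<close> with \<open>\<Sum>\<^sub>g w g * act g y = 0\<close> for all
  \<open>y\<close>, and \<open>w = 0\<close> by Dedekind's lemma.
\<close>

lemma base_change_type:
  assumes ds: "K.has_type UNIV ds"
  shows "E.has_type (equivariant (carrier G)) (map \<iota> ds)"
proof -
  obtain \<phi> where \<phi>: "K.coordinates UNIV ds \<phi>" and u: "K.units ds" using ds by (auto simp: K.has_type_def)
  let ?n = "length ds" and ?F = "fixed_field S"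
  define e where "e = (\<lambda>j. \<phi> (K.std_vec j))"
  have ee: "tr (carrier G) (e j * e k) = (if j = k then \<iota> (ds ! k) else 0)" if "j < ?n" "k < ?n" for j k
  proof -
    have "trK (e j * e k) = K.bil ds (K.std_vec j) (K.std_vec k)"
      unfolding e_def by (rule K.coordinates_bil[OF \<phi> K.std_vec_mem[OF that(1)] K.std_vec_mem[OF that(2)]])
    also have "\<dots> = (if j = k then ds ! k else 0)" using K.bil_std_vec[OF that(2)] by (simp add: K.std_vec_def)
    finally show ?thesis using emb_trK[of "e j * e k"] by auto
  qed
  have spans: "\<exists>x. y = (\<Sum>j<?n. \<iota> (x j) * e j)" for y
  proof -
    obtain x where x: "x \<in> vecs UNIV ?n" "y = \<phi> x"
      using K.coordinatesD(1)[OF \<phi>] by (auto simp: bij_betw_def)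
    have "\<phi> x = (\<Sum>j<?n. ext_scale \<iota> (x j) (\<phi> (K.std_vec j)))"
      using K.coordinatesD(3,4)[OF \<phi>] x(1) by (intro K.linear_expand) auto
    then show ?thesis using x by (auto simp: e_def ext_scale_def)
  qed
  define \<psi> where "\<psi> = (\<lambda>x g. if g \<in> carrier G then \<Sum>j<?n. x j * act g (e j) else 0)"
  have \<psi>_mem: "\<psi> x \<in> equivariant (carrier G)" if "x \<in> vecs ?F ?n" for x
  proof -
    have "act s (x j) = x j" if "s \<in> S" for s j
      using \<open>x \<in> vecs ?F ?n\<close> that by (auto simp: vecs_def intro: fixed_fieldD)
    then show ?thesis by (simp add: equivariant_def \<psi>_def act_ring act_mult)
  qed
  have \<psi>_b: "(\<Sum>g\<in>carrier G. v g * \<psi> x g) = (\<Sum>j<?n. x j * (\<Sum>g\<in>carrier G. v g * act g (e j)))" for v x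
  proof -
    have "(\<Sum>g\<in>carrier G. v g * \<psi> x g) = (\<Sum>g\<in>carrier G. \<Sum>j<?n. x j * (v g * act g (e j)))"
      by (intro sum.cong) (auto simp: \<psi>_def sum_distrib_left mult.left_commute)
    then show ?thesis by (subst (asm) sum.swap) (simp add: sum_distrib_left)
  qed
  have \<psi>_e: "(\<Sum>g\<in>carrier G. \<psi> x g * act g (e k)) = \<iota> (ds ! k) * x k" if k: "k < ?n" for x k
  proof -
    have "(\<Sum>g\<in>carrier G. \<psi> x g * act g (e k)) = (\<Sum>j<?n. x j * (\<Sum>g\<in>carrier G. act g (e k) * act g (e j)))"
      using \<psi>_b[of "\<lambda>g. act g (e k)" x] by (simp add: mult.commute)
    also have "\<dots> = (\<Sum>j<?n. if j = k then \<iota> (ds ! k) * x k else 0)"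
    proof (rule sum.cong[OF refl])
      fix j assume "j \<in> {..<?n}"
      moreover have "(\<Sum>g\<in>carrier G. act g (e k) * act g (e j)) = tr (carrier G) (e j * e k)"
        unfolding tr_def by (intro sum.cong) (auto simp: act_ring mult.commute)
      ultimately show "x j * (\<Sum>g\<in>carrier G. act g (e k) * act g (e j)) = (if j = k then \<iota> (ds ! k) * x k else 0)"
        using ee[of j k] k by simp
    qed
    finally show ?thesis using k by simp
  qed
  have nz: "\<iota> (ds ! k) \<noteq> 0" if "k < ?n" for k using K.units_nth[OF u that] by simp
  have "bij_betw \<psi> (vecs ?F ?n) (equivariant (carrier G))"
    unfolding bij_betw_def
  proof (intro conjI equalityI subsetI)
    show "inj_on \<psi> (vecs ?F ?n)"
    proof
      fix x y assume xy: "x \<in> vecs ?F ?n" "y \<in> vecs ?F ?n" "\<psi> x = \<psi> y"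
      have "x k = y k" for k
        using \<psi>_e[of k x] \<psi>_e[of k y] nz[of k] xy by (cases "k < ?n") (auto simp: vecs_def)
      then show "x = y" by auto
    qed
    fix v assume v: "v \<in> equivariant (carrier G)"
    define t where "t = (\<lambda>k. if k < ?n then (\<Sum>g\<in>carrier G. v g * act g (e k)) / \<iota> (ds ! k) else 0)"
    have "(\<Sum>g\<in>carrier G. v g * act g (e k)) \<in> ?F" for k
      unfolding fixed_field_def
    proof (intro CollectI ballI)
      fix s assume s: "s \<in> S"
      have "act s (\<Sum>g\<in>carrier G. v g * act g (e k)) = (\<Sum>g\<in>carrier G. v (s \<otimes> g) * act (s \<otimes> g) (e k))"
        using s v by (auto simp: act_ring act_mult equivariant_def intro!: sum.cong)
      also have "\<dots> = (\<Sum>g\<in>carrier G. v g * act g (e k))"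
        using s by (intro subgroup_sum_shift(1)[OF carrier_subgroup]) simp
      finally show "act s (\<Sum>g\<in>carrier G. v g * act g (e k)) = (\<Sum>g\<in>carrier G. v g * act g (e k))" .
    qed
    then have t: "t \<in> vecs ?F ?n" using emb_fixed[OF S_sub] by (auto simp: t_def vecs_def)
    define w where "w = (\<lambda>g. v g - \<psi> t g)"
    have we: "(\<Sum>g\<in>carrier G. w g * act g (e k)) = 0" if "k < ?n" for k
      using \<psi>_e[OF that, of t] nz[OF that] that by (simp add: w_def left_diff_distrib sum_subtractf t_def)
    have "(\<Sum>g\<in>carrier G. w g * act g y) = 0" for y
    proof -
      obtain x where x: "y = (\<Sum>j<?n. \<iota> (x j) * e j)" using spans by blast
      have "(\<Sum>g\<in>carrier G. w g * act g y) = (\<Sum>g\<in>carrier G. \<Sum>j<?n. \<iota> (x j) * (w g * act g (e j)))"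
        unfolding x by (intro sum.cong) (auto simp: act_ring act_emb sum_distrib_left mult.left_commute)
      also have "\<dots> = (\<Sum>j<?n. \<iota> (x j) * (\<Sum>g\<in>carrier G. w g * act g (e j)))"
        by (subst sum.swap) (simp add: sum_distrib_left)
      finally show ?thesis using we by simp
    qed
    then have "w g = 0" if "g \<in> carrier G" for g using Dedekind[OF order_refl _ that, of w] by blast
    then have "v g = \<psi> t g" for g using v by (cases "g \<in> carrier G") (auto simp: w_def equivariant_def \<psi>_def)
    then show "v \<in> \<psi> ` vecs ?F ?n" using t by (intro image_eqI[of _ _ t]) auto
  qed (use \<psi>_mem in auto)
  moreover have "(\<Sum>g\<in>carrier G. \<psi> x g * \<psi> x g) = qval (map \<iota> ds) x" for x
    using \<psi>_b[of "\<psi> x" x] \<psi>_e[of _ x] by (simp add: qval_def power2_eq_square mult.left_commute)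
  ultimately have "E.coordinates (equivariant (carrier G)) (map \<iota> ds) \<psi>"
    unfolding E.coordinates_def
    by (auto simp: \<psi>_def fun_eq_iff distrib_right sum.distrib sum_distrib_left mult.assoc)
  moreover have "Q.units (map \<iota> ds)" using u emb_fixed[OF S_sub] by (auto simp: K.units_def Q.units_def)
  ultimately show ?thesis by (auto simp: E.has_type_def)
qed

text \<open>
  Evaluation at \<open>g0\<close> identifies the equivariant functions supported on one coset with \<open>L\<close>, and the scalar
  product with the trace form over the fixed field of \<open>S\<close>.
\<close>

lemma coset_type:
  assumes cs: "Q.has_type UNIV cs" and g0: "g0 \<in> carrier G"
  shows "E.has_type (equivariant (S #> g0)) cs"
proof -
  obtain \<phi> where \<phi>: "Q.coordinates UNIV cs \<phi>" and u: "Q.units cs" using cs by (auto simp: Q.has_type_def)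
  let ?C = "S #> g0" and ?F = "fixed_field S"
  define ext where "ext = (\<lambda>y g. if g \<in> ?C then act (g \<otimes> inv g0) y else 0)"
  have C: "g \<in> ?C \<longleftrightarrow> (\<exists>s\<in>S. g = s \<otimes> g0)" for g by (auto simp: r_coset_def)
  have one: "\<one> \<in> S" using S by (rule subgroup.one_closed)
  have cl: "x \<otimes> y \<in> S" "inv x \<in> S" if "x \<in> S" "y \<in> S" for x y
    using that S by (auto intro: subgroup.m_closed subgroup.m_inv_closed)
  have ext_s: "ext y (s \<otimes> g0) = act s y" if "s \<in> S" for s y
    using that g0 by (auto simp: ext_def C m_assoc)
  have g0C: "g0 \<in> ?C" using C[of g0] one g0 by (auto intro!: bexI[of _ \<one>])
  have C_shift: "s \<otimes> g \<in> ?C \<longleftrightarrow> g \<in> ?C" if s: "s \<in> S" and g: "g \<in> carrier G" for s g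
  proof
    assume "s \<otimes> g \<in> ?C"
    then obtain t where t: "t \<in> S" "s \<otimes> g = t \<otimes> g0" using C by blast
    have "g = inv s \<otimes> (s \<otimes> g)" using s g by (simp add: m_assoc[symmetric])
    also have "\<dots> = (inv s \<otimes> t) \<otimes> g0" using t s g0 by (simp add: m_assoc)
    finally show "g \<in> ?C" using C cl s t by blast
  next
    assume "g \<in> ?C"
    then obtain t where t: "t \<in> S" "g = t \<otimes> g0" using C by blast
    then have "s \<otimes> g = (s \<otimes> t) \<otimes> g0" using s g0 by (simp add: m_assoc)
    then show "s \<otimes> g \<in> ?C" using C cl s t by blast
  qed
  have ext_mem: "ext y \<in> equivariant ?C" for y
    unfolding equivariant_def
  proof (intro CollectI conjI allI ballI impI)
    fix s g assume s: "s \<in> S" and g: "g \<in> carrier G"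
    show "ext y (s \<otimes> g) = act s (ext y g)"
    proof (cases "g \<in> ?C")
      case True
      then obtain t where t: "t \<in> S" "g = t \<otimes> g0" using C by blast
      then have "s \<otimes> g = (s \<otimes> t) \<otimes> g0" using s g0 by (simp add: m_assoc)
      then show ?thesis using ext_s[of "s \<otimes> t" y] ext_s[of t y] cl s t by (simp add: act_mult)
    next
      case False
      then show ?thesis using C_shift[OF s g] s by (simp add: ext_def act_ring)
    qed
  qed (simp add: ext_def)
  have "bij_betw ext UNIV (equivariant ?C)"
  proof (rule bij_betw_byWitness[where f' = "\<lambda>v. v g0"])
    have "ext y g0 = y" for y using ext_s[OF one, of y] g0 by (simp add: act_one)
    then show "\<forall>y\<in>UNIV. ext y g0 = y" by simp
    show "\<forall>v\<in>equivariant ?C. ext (v g0) = v"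
    proof
      fix v assume v: "v \<in> equivariant ?C"
      have "ext (v g0) g = v g" for g
      proof (cases "g \<in> ?C")
        case True
        then obtain t where t: "t \<in> S" "g = t \<otimes> g0" using C by blast
        then show ?thesis using ext_s[of t "v g0"] v g0 by (simp add: equivariant_def)
      qed (use v in \<open>auto simp: ext_def equivariant_def\<close>)
      then show "ext (v g0) = v" by auto
    qed
  qed (use ext_mem in auto)
  then have bij: "bij_betw (\<lambda>x. ext (\<phi> x)) (vecs ?F (length cs)) (equivariant ?C)"
    using bij_betw_trans[OF Q.coordinatesD(1)[OF \<phi>]] by (simp add: comp_def)
  have form: "(\<Sum>g\<in>carrier G. ext y g * ext y g) = tr S (y * y)" for y
  proof -
    have CG: "?C \<subseteq> carrier G" using C g0 by auto
    have "(\<Sum>g\<in>carrier G. ext y g * ext y g) = (\<Sum>g\<in>?C. ext y g * ext y g)"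
      using CG finite_G by (intro sum.mono_neutral_right) (auto simp: ext_def)
    also have "\<dots> = (\<Sum>s\<in>S. act s y * act s y)"
      using ext_s C g0 by (intro sum.reindex_bij_witness[where i = "\<lambda>s. s \<otimes> g0" and j = "\<lambda>g. g \<otimes> inv g0"])
        (auto simp: m_assoc)
    finally show ?thesis by (simp add: tr_def act_ring)
  qed
  have memC: "g \<otimes> inv g0 \<in> S" if "g \<in> ?C" for g using that C g0 by (auto simp: m_assoc)
  have "E.coordinates (equivariant ?C) cs (\<lambda>x. ext (\<phi> x))"
    unfolding E.coordinates_def
    using bij form Q.coordinatesD[OF \<phi>] memC
    by (auto simp: ext_def fun_eq_iff act_ring fixed_fieldD)
  then show ?thesis using u by (auto simp: E.has_type_def)
qed

lemma cosets_type:
  assumes cs: "Q.has_type UNIV cs" and js: "distinct js" "set js \<subseteq> rcosets S"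
  shows "E.has_type (equivariant (\<Union>(set js))) (concat (replicate (length js) cs))"
  using js
proof (induction js)
  case Nil
  have "equivariant {} = {0}" by (auto simp: equivariant_def act_ring fun_eq_iff)
  then show ?case by simp
next
  case (Cons C js)
  obtain g0 where g0: "g0 \<in> carrier G" "C = S #> g0" using Cons.prems by (auto simp: RCOSETS_def)
  have disj: "C \<inter> D = {}" if "D \<in> set js" for D
  proof -
    have "C \<noteq> D" "C \<in> rcosets S" "D \<in> rcosets S" using Cons.prems that by auto
    then show ?thesis using rcos_disjoint[OF S] by (simp add: pairwise_def disjnt_def)
  qed
  have shift: "s \<otimes> g \<in> D \<longleftrightarrow> g \<in> D" if D: "D \<in> rcosets S" and s: "s \<in> S" and g: "g \<in> carrier G" for D s g
  proof -
    obtain h where h: "h \<in> carrier G" "D = S #> h" using D by (auto simp: RCOSETS_def)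
    have cl: "x \<otimes> y \<in> S" "inv x \<in> S" if "x \<in> S" "y \<in> S" for x y
      using that S by (auto intro: subgroup.m_closed subgroup.m_inv_closed)
    have inC: "k \<in> D \<longleftrightarrow> k \<otimes> inv h \<in> S" if "k \<in> carrier G" for k
    proof
      assume "k \<in> D"
      then show "k \<otimes> inv h \<in> S" using h by (auto simp: r_coset_def m_assoc)
    next
      assume "k \<otimes> inv h \<in> S"
      moreover have "k = k \<otimes> inv h \<otimes> h" using that h by (simp add: m_assoc)
      ultimately show "k \<in> D" unfolding h(2) r_coset_def by blast
    qed
    have "s \<otimes> g \<otimes> inv h \<in> S \<longleftrightarrow> g \<otimes> inv h \<in> S"
    proof
      assume "s \<otimes> g \<otimes> inv h \<in> S"
      then have "inv s \<otimes> (s \<otimes> g \<otimes> inv h) \<in> S" using cl s by blast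
      moreover have "inv s \<otimes> (s \<otimes> g \<otimes> inv h) = g \<otimes> inv h" using s g h by (simp add: m_assoc[symmetric])
      ultimately show "g \<otimes> inv h \<in> S" by simp
    next
      assume "g \<otimes> inv h \<in> S"
      then have "s \<otimes> (g \<otimes> inv h) \<in> S" using cl s by blast
      then show "s \<otimes> g \<otimes> inv h \<in> S" using s g h by (simp add: m_assoc)
    qed
    then show ?thesis using inC s g by simp
  qed
  let ?D = "\<Union>(set js)"
  have sub: "C \<in> rcosets S" "set js \<subseteq> rcosets S" using Cons.prems by auto
  have CD: "C \<inter> ?D = {}" using disj by auto
  have "E.osum (equivariant (C \<union> ?D)) (equivariant C) (equivariant ?D)"
    unfolding E.osum_def
  proof (intro conjI ballI equalityI subsetI)
    fix v assume v: "v \<in> equivariant (C \<union> ?D)"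
    let ?v1 = "\<lambda>g. if g \<in> C then v g else 0" and ?v2 = "\<lambda>g. if g \<in> ?D then v g else 0"
    have "?v1 \<in> equivariant C" using v shift[OF sub(1)] by (auto simp: equivariant_def act_ring)
    moreover have "?v2 \<in> equivariant ?D"
    proof -
      have "s \<otimes> g \<in> ?D \<longleftrightarrow> g \<in> ?D" if "s \<in> S" "g \<in> carrier G" for s g
        using shift[OF _ that] sub(2) by blast
      then show ?thesis using v by (auto simp: equivariant_def act_ring)
    qed
    moreover have "v = ?v1 + ?v2"
    proof
      fix g show "v g = (?v1 + ?v2) g" using v CD by (auto simp: equivariant_def)
    qed
    ultimately show "v \<in> {u + w |u w. u \<in> equivariant C \<and> w \<in> equivariant ?D}" by blast
  next
    fix v assume "v \<in> {u + w |u w. u \<in> equivariant C \<and> w \<in> equivariant ?D}"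
    then obtain u w where "u \<in> equivariant C" "w \<in> equivariant ?D" "v = u + w" by blast
    then show "v \<in> equivariant (C \<union> ?D)" by (simp add: equivariant_def act_ring)
  next
    fix u w assume "u \<in> equivariant C" "w \<in> equivariant ?D"
    then have "g \<notin> C \<Longrightarrow> u g = 0" "g \<notin> ?D \<Longrightarrow> w g = 0" for g unfolding equivariant_def by blast+
    then have "u g * w g = 0" for g using CD by (metis IntI empty_iff mult_eq_0_iff)
    then show "(\<Sum>g\<in>carrier G. u g * w g) = 0" by (intro sum.neutral ballI)
  qed
  from E.osum_has_type[OF this coset_type[OF cs g0(1), folded g0(2)] Cons.IH] Cons.prems
  show ?case by simp
qed

text \<open>
  Both sides are diagonalizations of the space of equivariant functions on \<open>G\<close>.
\<close>

theorem trace_form_base_change: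
  assumes ds: "K.has_type UNIV ds" and cs: "Q.has_type UNIV cs"
  shows "isom (fixed_field S) (map \<iota> ds) (concat (replicate (card (rcosets S)) cs))"
proof -
  have "finite (rcosets S)" using finite_G S_sub by (auto simp: RCOSETS_def)
  then obtain js where js: "set js = rcosets S" "distinct js" using finite_distinct_list by blast
  have "\<Union>(rcosets S) = carrier G" by (rule rcosets_part_G[OF S])
  then have "E.has_type (equivariant (carrier G)) (concat (replicate (length js) cs))"
    using cosets_type[OF cs js(2)] js(1) by simp
  then show ?thesis using E.has_type_unique[OF base_change_type[OF ds]] distinct_card[OF js(2)] js(1) by simp
qed

end

theorem (in galois_2subgroup) trace_form_Witt_class:
  assumes odd: "odd (card (rcosets S))" and r: "has_frattini_rank T r" and ds: "K.has_type UNIV ds"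
  shows "\<exists>as. length as = r \<and> K.units as \<and> wequiv UNIV ds (map ((*) (of_nat (card S))) (pf as))"
proof -
  obtain bs cs where bs: "length bs = r" "Q.units bs" "Q.has_type UNIV cs"
    "wequiv (fixed_field S) cs (map ((*) (of_nat (card S))) (pf bs))"
    using Witt_class_trace_form[OF r] by blast
  have "isom (fixed_field S) (map \<iota> ds) (concat (replicate (card (rcosets S)) cs))"
    by (rule trace_form_base_change[OF ds bs(3)])
  also have "wequiv (fixed_field S) \<dots> cs"
    using bs(3) odd by (intro Q.wequiv_odd_multiple) (auto simp: Q.has_type_def)
  also note bs(4)
  finally have wq: "wequiv (fixed_field S) (map \<iota> ds) (map ((*) (\<iota> (of_nat (card S)))) (pf bs))"
    by (simp add: hom_of_nat)
  interpret anisotropy_preserving "fixed_field S" \<iota>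
  proof unfold_locales
    show "range \<iota> \<subseteq> fixed_field S" using emb_fixed[OF S_sub] by auto
    show "K.anisotropic cs \<Longrightarrow> Q.anisotropic (map \<iota> cs)" for cs
      using Springer_fixed_field[OF fin_ext S _ odd] lagrange[OF S] by (simp add: Coset.order_def)
  qed
  have "(of_nat (card S) :: 'k) \<noteq> 0" using two_ne by (simp add: card_S)
  then show ?thesis using scaled_Pfister_descent[OF _ bs(2) _ wq] ds bs(1) by (auto simp: K.has_type_def)
qed

section \<open>Comparison with quadratic forms on vector spaces\<close>

lemma pfister_uminus: "pfister (map uminus as) = pf as"
  by (induction as) (simp_all add: pf.simps(2))

lemma diag_tensor_single: "diag_tensor [e] ds = map ((*) e) ds"
  by (simp add: diag_tensor_Cons)

context coeff_field_not2
begin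

lemma nondegenerate_diag_form:
  assumes U: "F = UNIV" and cs: "units cs"
  shows "nondegenerate_form (diag_form cs)"
proof -
  let ?n = "length cs" and ?Q = "diag_form cs"
  interpret V: vector_space "\<lambda>c (x :: nat \<Rightarrow> 'a) i. c * x i"
    by unfold_locales (auto simp: fun_eq_iff algebra_simps)
  have space: "qf_space ?Q = vecs F ?n" by (auto simp: diag_form_def vecs_def U)
  have form: "qf_form ?Q x = qval cs x" for x by (simp add: diag_form_def qval_def)
  have scale: "qf_scale ?Q = (\<lambda>c x i. c * x i)" by (simp add: diag_form_def)
  have polar: "polar_form ?Q x y = 2 * bil cs x y" for x y
    unfolding polar_form_def form plus_fun_def qval_add by simp
  have span: "V.span (std_vec ` {..<?n}) = vecs F ?n"
  proof
    show "V.span (std_vec ` {..<?n}) \<subseteq> vecs F ?n"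
    proof (rule V.span_minimal)
      show "std_vec ` {..<?n} \<subseteq> vecs F ?n" using std_vec_mem by auto
      show "V.subspace (vecs F ?n)"
        unfolding V.subspace_def zero_fun_def plus_fun_def vecs_def using U by auto
    qed
    show "vecs F ?n \<subseteq> V.span (std_vec ` {..<?n})"
    proof
      fix x assume x: "x \<in> vecs F ?n"
      have "x = (\<Sum>j<?n. (\<lambda>i. x j * std_vec j i))"
        by (rule linear_expand[OF _ _ _ x, where h = "\<lambda>x. x" and scl = "\<lambda>c x i. c * x i"])
          (auto simp: plus_fun_def zero_fun_def)
      also have "\<dots> \<in> V.span (std_vec ` {..<?n})"
        by (intro V.span_sum V.span_scale V.span_base) auto
      finally show "x \<in> V.span (std_vec ` {..<?n})" .
    qed
  qed
  have "x = 0" if x: "x \<in> vecs F ?n" "\<forall>y\<in>vecs F ?n. polar_form ?Q x y = 0" for x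
  proof -
    have "x i = 0" for i
    proof (cases "i < ?n")
      case True
      then have "2 * (cs ! i * x i) = 0" using x(2) std_vec_mem[OF True] bil_std_vec[OF True, of x] by (simp add: polar)
      then have "cs ! i * x i = 0" by (simp only: mult_eq_0_iff two_nz simp_thms)
      then show ?thesis using units_nth[OF cs True] by simp
    qed (use x in \<open>auto simp: vecs_def\<close>)
    then show ?thesis by auto
  qed
  moreover have "quadratic_form ?Q"
    unfolding quadratic_form_def space scale form polar
  proof (intro conjI)
    show "vector_space (\<lambda>c (x :: nat \<Rightarrow> 'a) i. c * x i)" ..
    show "\<exists>B. finite B \<and> V.span B = vecs F ?n" using span by blast
  qed (auto simp: qval_scale bil_add bil_scale plus_fun_def distrib_left)
  ultimately show ?thesis by (auto simp: nondegenerate_form_def space)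
qed

end

context galois_action_i
begin

lemma nondegenerate_trace_form: "nondegenerate_form (trace_form \<iota>)"
proof -
  have polar: "polar_form (trace_form \<iota>) x y = 2 * trK (x * y)" for x y
  proof -
    have "(x + y)\<^sup>2 = x\<^sup>2 + (y\<^sup>2 + (x * y + x * y))" by (simp add: power2_eq_square algebra_simps)
    then have "trK ((x + y)\<^sup>2) = trK (x\<^sup>2) + (trK (y\<^sup>2) + (trK (x * y) + trK (x * y)))"
      by (simp only: trK_add)
    then show ?thesis unfolding polar_form_def trace_form_def by (simp add: ext_trace_eq)
  qed
  obtain B where B: "finite B" "vs.span B = UNIV"
    using fin_ext by (auto simp: finite_extension_def)
  have scale_right: "trK (x * (\<iota> c * z)) = c * trK (x * z)" for c x z
    using trK_scale[of c "x * z"] by (simp add: mult.left_commute)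
  have "quadratic_form (trace_form \<iota>)"
    unfolding quadratic_form_def polar
  proof (intro conjI)
    show "vector_space (qf_scale (trace_form \<iota>))" using vs.vector_space_axioms by (simp add: trace_form_def)
    show "\<exists>B. finite B \<and> module.span (qf_scale (trace_form \<iota>)) B = qf_space (trace_form \<iota>)"
      using B by (auto simp: trace_form_def)
    have "trK ((\<iota> c * x)\<^sup>2) = c\<^sup>2 * trK (x\<^sup>2)" for c x
      using trK_scale[of "c\<^sup>2" "x\<^sup>2"] by (simp add: power_mult_distrib hom_power)
    then show "\<forall>c. \<forall>x\<in>qf_space (trace_form \<iota>). qf_form (trace_form \<iota>) (qf_scale (trace_form \<iota>) c x) =
        c\<^sup>2 * qf_form (trace_form \<iota>) x"
      by (simp add: trace_form_def ext_trace_eq ext_scale_def)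
  qed (auto simp: trace_form_def ext_scale_def trK_add trK_scale scale_right distrib_right distrib_left mult.assoc)
  moreover have "x = 0" if "\<forall>y. 2 * trK (x * y) = 0" for x
  proof (rule tr_nondegenerate[OF carrier_subgroup])
    have "trK (x * y) = 0" for y using that two_ne by simp
    then show "tr (carrier G) (x * y) = 0" for y using emb_trK[of "x * y"] by simp
  qed
  ultimately show ?thesis unfolding nondegenerate_form_def polar by (simp add: trace_form_def)
qed

lemma trace_form_witt_equivalent:
  assumes ds: "K.has_type UNIV ds" and cs: "K.units cs" and wq: "wequiv UNIV ds cs"
  shows "witt_equivalent (trace_form \<iota>) (diag_form cs)"
proof -
  obtain \<phi> where \<phi>: "K.coordinates UNIV ds \<phi>" using ds by (auto simp: K.has_type_def)
  note D = K.coordinatesD[OF \<phi>]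
  obtain m n where iso: "isom UNIV (ds @ planes m) (cs @ planes n)" using wq by (auto simp: wequiv_def)
  obtain f f' where f1: "isom_map UNIV (ds @ planes m) (cs @ planes n) f"
    and "isom_map UNIV (cs @ planes n) (ds @ planes m) f'"
    and f2: "\<And>x. x \<in> vecs UNIV (length (ds @ planes m)) \<Longrightarrow> f x \<in> vecs UNIV (length (cs @ planes n))"
    "\<And>y. y \<in> vecs UNIV (length (cs @ planes n)) \<Longrightarrow> f' y \<in> vecs UNIV (length (ds @ planes m))"
    "\<And>x. x \<in> vecs UNIV (length (ds @ planes m)) \<Longrightarrow> f' (f x) = x"
    "\<And>y. y \<in> vecs UNIV (length (cs @ planes n)) \<Longrightarrow> f (f' y) = y"
    using K.isomE[OF iso] by blast
  note f = f1 f2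
  let ?d = "length ds" and ?c = "length cs"
  let ?pm = "length (planes m :: 'k list)" and ?pn = "length (planes n :: 'k list)"
  define \<phi>' where "\<phi>' = inv_into (vecs UNIV ?d) \<phi>"
  have "\<phi> ` vecs UNIV ?d = UNIV" using D(1) by (simp add: bij_betw_def)
  then have \<phi>': "\<phi>' x \<in> vecs UNIV ?d" "\<phi> (\<phi>' x) = x" for x
    unfolding \<phi>'_def by (simp_all add: inv_into_into f_inv_into_f)
  have \<phi>'\<phi>: "\<phi>' (\<phi> x) = x" if "x \<in> vecs UNIV ?d" for x
    using D(1) that unfolding \<phi>'_def by (simp add: bij_betw_def)
  have \<phi>'_add: "\<phi>' (x + y) = (\<lambda>i. \<phi>' x i + \<phi>' y i)" for x y
    using D(3)[OF \<phi>'(1)[of x] \<phi>'(1)[of y]] \<phi>'\<phi>[OF K.vecs_add[OF \<phi>'(1)[of x] \<phi>'(1)[of y]]] by (simp add: \<phi>'(2))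
  have \<phi>'_scale: "\<phi>' (ext_scale \<iota> c x) = (\<lambda>i. c * \<phi>' x i)" for c x
  proof -
    have mem: "(\<lambda>i. c * \<phi>' x i) \<in> vecs UNIV ?d" using \<phi>'(1)[of x] by simp
    have "\<phi> (\<lambda>i. c * \<phi>' x i) = ext_scale \<iota> c x"
      using D(4)[OF UNIV_I \<phi>'(1)[of x], of c] by (simp add: \<phi>'(2))
    then show ?thesis using \<phi>'\<phi>[OF mem] by simp
  qed
  have \<phi>'_q: "qval ds (\<phi>' x) = trK (x\<^sup>2)" for x
    using D(5)[OF \<phi>'(1)[of x]] by (simp add: \<phi>'(2) power2_eq_square)
  let ?J = "\<lambda>x y. vjoin ?d (\<phi>' x) y"
  have J: "?J x y \<in> vecs UNIV (length (ds @ planes m))" if "y \<in> vecs UNIV ?pm" for x y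
    using K.vjoin_mem[OF \<phi>'(1) that] by simp
  define h where "h = (\<lambda>(x, y). (vtake ?c (f (?J x y)), vdrop ?c (f (?J x y))))"
  define h' where "h' = (\<lambda>(u, w). (\<phi> (vtake ?d (f' (vjoin ?c u w))), vdrop ?d (f' (vjoin ?c u w))))"
  let ?A = "orthogonal_sum (trace_form \<iota>) (hyperbolic_form m)"
  let ?B = "orthogonal_sum (diag_form cs) (hyperbolic_form n)"
  have spA: "qf_space ?A = UNIV \<times> vecs UNIV ?pm"
    by (auto simp: orthogonal_sum_def trace_form_def hyperbolic_form_def diag_form_def vecs_def planes_def)
  have spB: "qf_space ?B = vecs UNIV ?c \<times> vecs UNIV ?pn"
    by (auto simp: orthogonal_sum_def hyperbolic_form_def diag_form_def vecs_def planes_def)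
  have scA: "qf_scale ?A c (x, y) = (ext_scale \<iota> c x, \<lambda>i. c * y i)" for c x y
    by (simp add: orthogonal_sum_def trace_form_def hyperbolic_form_def diag_form_def)
  have scB: "qf_scale ?B c (x, y) = (\<lambda>i. c * x i, \<lambda>i. c * y i)" for c x y
    by (simp add: orthogonal_sum_def hyperbolic_form_def diag_form_def)
  have foA: "qf_form ?A (x, y) = trK (x\<^sup>2) + qval (planes m) y" for x y
    by (simp add: orthogonal_sum_def trace_form_def hyperbolic_form_def diag_form_def qval_def planes_def ext_trace_eq)
  have foB: "qf_form ?B (u, w) = qval cs u + qval (planes n) w" for u w
    by (simp add: orthogonal_sum_def hyperbolic_form_def diag_form_def qval_def planes_def)
  have fJ: "f (?J x y) \<in> vecs UNIV (?c + ?pn)" if "y \<in> vecs UNIV ?pm" for x and y :: "nat \<Rightarrow> 'k"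
    using f(2)[OF J[OF that]] by simp
  have f'J: "f' (vjoin ?c u w) \<in> vecs UNIV (?d + ?pm)" if "u \<in> vecs UNIV ?c" "w \<in> vecs UNIV ?pn" for u w
    using f(3)[of "vjoin ?c u w"] K.vjoin_mem[OF that] by simp
  have "bij_betw h (qf_space ?A) (qf_space ?B)"
    unfolding spA spB
  proof (rule bij_betw_byWitness[where f' = h'])
    show "\<forall>p\<in>UNIV \<times> vecs UNIV ?pm. h' (h p) = p"
    proof clarify
      fix x and y :: "nat \<Rightarrow> 'k" assume y: "y \<in> vecs UNIV ?pm"
      have "f' (f (?J x y)) = ?J x y" using f(4)[OF J[OF y]] .
      then show "h' (h (x, y)) = (x, y)"
        by (simp add: h_def h'_def K.vtake_join[OF \<phi>'(1)] \<phi>'(2))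
    qed
    show "\<forall>p\<in>vecs UNIV ?c \<times> vecs UNIV ?pn. h (h' p) = p"
    proof clarify
      fix u w :: "nat \<Rightarrow> 'k" assume uw: "u \<in> vecs UNIV ?c" "w \<in> vecs UNIV ?pn"
      let ?z = "f' (vjoin ?c u w)"
      have "?J (\<phi> (vtake ?d ?z)) (vdrop ?d ?z) = ?z"
        using \<phi>'\<phi>[OF K.vtake_mem[OF f'J[OF uw]]] by simp
      moreover have "f ?z = vjoin ?c u w" using f(5)[of "vjoin ?c u w"] K.vjoin_mem[OF uw] by simp
      ultimately show "h (h' (u, w)) = (u, w)" using K.vtake_join[OF uw(1)] by (simp add: h_def h'_def)
    qed
    show "h ` (UNIV \<times> vecs UNIV ?pm) \<subseteq> vecs UNIV ?c \<times> vecs UNIV ?pn"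
      using K.vtake_mem[OF fJ] K.vdrop_mem[OF fJ] by (auto simp: h_def)
    show "h' ` (vecs UNIV ?c \<times> vecs UNIV ?pn) \<subseteq> UNIV \<times> vecs UNIV ?pm"
      using f'J by (auto simp: h'_def)
  qed
  moreover have "h (p + q) = h p + h q" if "p \<in> qf_space ?A" "q \<in> qf_space ?A" for p q
  proof -
    obtain x y x' y' where pq: "p = (x, y)" "q = (x', y')" by (cases p, cases q) auto
    have yy: "y \<in> vecs UNIV ?pm" "y' \<in> vecs UNIV ?pm" using that pq unfolding spA by auto
    have "?J (x + x') (y + y') = (\<lambda>i. ?J x y i + ?J x' y' i)"
      unfolding plus_fun_def \<phi>'_add by (rule K.vjoin_add)
    then show ?thesis using K.isom_mapD(1)[OF f(1) J[OF yy(1)] J[OF yy(2)], of x x'] pq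
      by (simp add: h_def K.vtake_add K.vdrop_add plus_fun_def)
  qed
  moreover have "h (qf_scale ?A c p) = qf_scale ?B c (h p)" if "p \<in> qf_space ?A" for c p
  proof -
    obtain x y where p: "p = (x, y)" by (cases p)
    have y: "y \<in> vecs UNIV ?pm" using that p unfolding spA by auto
    have "?J (ext_scale \<iota> c x) (\<lambda>i. c * y i) = (\<lambda>i. c * ?J x y i)"
      unfolding \<phi>'_scale by (rule K.vjoin_scale)
    then show ?thesis using K.isom_mapD(2)[OF f(1) UNIV_I J[OF y], of c x] p
      by (simp add: scA scB h_def K.vtake_scale K.vdrop_scale)
  qed
  moreover have "qf_form ?B (h p) = qf_form ?A p" if "p \<in> qf_space ?A" for p
  proof -
    obtain x y where p: "p = (x, y)" by (cases p)
    have y: "y \<in> vecs UNIV ?pm" using that p unfolding spA by auto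
    have "qval (cs @ planes n) (f (?J x y)) = qval (ds @ planes m) (?J x y)"
      by (rule K.isom_mapD(3)[OF f(1) J[OF y]])
    then show ?thesis using K.qval_join[OF \<phi>'(1), of "planes m" x y] p
      by (simp add: foA foB h_def qval_append \<phi>'_q)
  qed
  ultimately have "isometric ?A ?B" unfolding isometric_def by blast
  then show ?thesis unfolding witt_equivalent_def
    using nondegenerate_trace_form K.nondegenerate_diag_form[OF refl cs] by blast
qed

end

section \<open>Trace forms of Galois extensions\<close>

lemma field_isom_comp: "field_isom \<sigma> \<Longrightarrow> field_isom \<tau> \<Longrightarrow> field_isom (\<sigma> \<circ> \<tau>)"
proof -
  assume "field_isom \<sigma>" "field_isom \<tau>"
  interpret s: field_isom \<sigma> by fact
  interpret t: field_isom \<tau> by fact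
  have "surj (\<sigma> \<circ> \<tau>)" by (rule comp_surj[OF t.surj s.surj])
  then show "field_isom (\<sigma> \<circ> \<tau>)"
    by unfold_locales (auto simp: hom_distribs)
qed

theorem theorem1p2:
  fixes \<iota> :: "'k::field \<Rightarrow> 'l::field"
    and G :: "('g, 'm) monoid_scheme"
    and S :: "'g set"
    and r :: nat
  assumes "\<exists>\<zeta>::'k. primitive_root_of_unity 4 \<zeta>"
    and "group G" and "finite (carrier G)"
    and "G_galois_extension G \<iota>"
    and "sylow_subgroup 2 G S"
    and "has_frattini_rank (G\<lparr>carrier := S\<rparr>) r"
  shows "\<exists>as::'k list. length as = r \<and> (\<forall>a\<in>set as. a \<noteq> 0) \<and>
           witt_equivalent (trace_form \<iota>)
             (diag_form (diag_tensor [of_nat (card S)] (pfister as)))"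
proof -
  obtain \<zeta> :: 'k where \<zeta>: "primitive_root_of_unity 4 \<zeta>" using assms(1) by blast
  have z4: "\<zeta> ^ 4 = 1" and z2: "\<zeta>\<^sup>2 \<noteq> 1" using \<zeta> by (auto simp: primitive_root_of_unity_def)
  have "(\<zeta>\<^sup>2 - 1) * (\<zeta>\<^sup>2 + 1) = 0" using z4 by (simp add: power4_eq_xxxx power2_eq_square algebra_simps)
  then have zm: "\<zeta>\<^sup>2 = - 1" using z2 by (simp add: eq_neg_iff_add_eq_0)
  have two: "(2 :: 'k) \<noteq> 0"
  proof
    assume "(2 :: 'k) = 0"
    then have "(1 :: 'k) + 1 = 0" by simp
    then show False using zm z2 by (metis eq_neg_iff_add_eq_0)
  qed
  let ?L = "galois_group \<iota>"
  have fe: "finite_extension \<iota>" and fixed: "{x. \<forall>\<sigma>\<in>carrier ?L. \<sigma> x = x} = range \<iota>" and "?L \<cong> G"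
    using assms(4) by (auto simp: G_galois_extension_def finite_galois_extension_def)
  then obtain \<theta> where \<theta>: "\<theta> \<in> iso ?L G" by (auto simp: is_iso_def)
  have bij: "bij_betw \<theta> (carrier ?L) (carrier G)" using \<theta> by (simp add: iso_def)
  define act where "act = inv_into (carrier ?L) \<theta>"
  have act: "act g \<in> carrier ?L" "\<theta> (act g) = g" if "g \<in> carrier G" for g
    using bij that unfolding act_def by (auto simp: bij_betw_def inv_into_into f_inv_into_f)
  have act\<theta>: "act (\<theta> \<sigma>) = \<sigma>" if "\<sigma> \<in> carrier ?L" for \<sigma>
    using bij that unfolding act_def by (simp add: bij_betw_def)
  have isom: "field_isom (act g)" if "g \<in> carrier G" for g using act(1)[OF that] by (simp add: galois_group_def)
  have mult: "act (g \<otimes>\<^bsub>G\<^esub> h) = act g \<circ> act h" if "g \<in> carrier G" "h \<in> carrier G" for g h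
  proof -
    have m: "act g \<circ> act h \<in> carrier ?L"
      using act(1)[OF that(1)] act(1)[OF that(2)] field_isom_comp[OF isom[OF that(1)] isom[OF that(2)]]
      by (simp add: galois_group_def)
    have "\<theta> (act g \<circ> act h) = \<theta> (act g) \<otimes>\<^bsub>G\<^esub> \<theta> (act h)"
      using \<theta> act(1) that by (auto simp: iso_def hom_def galois_group_def)
    then have "\<theta> (act g \<circ> act h) = g \<otimes>\<^bsub>G\<^esub> h" using act(2) that by simp
    then show ?thesis using act\<theta>[OF m] by simp
  qed
  interpret G: group G by (rule assms(2))
  have one: "act \<one>\<^bsub>G\<^esub> x = x" for x
  proof -
    interpret o: field_isom "act \<one>\<^bsub>G\<^esub>" by (rule isom) simp
    have "act \<one>\<^bsub>G\<^esub> (act \<one>\<^bsub>G\<^esub> x) = act \<one>\<^bsub>G\<^esub> x" using mult[of "\<one>\<^bsub>G\<^esub>" "\<one>\<^bsub>G\<^esub>"] by (metis G.one_closed G.l_one comp_apply)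
    then show ?thesis using o.inj_f by (auto dest: injD)
  qed
  have im: "act ` carrier G = carrier ?L"
  proof (intro equalityI subsetI)
    fix \<sigma> assume \<sigma>: "\<sigma> \<in> carrier ?L"
    then have "\<theta> \<sigma> \<in> carrier G" using bij by (auto simp: bij_betw_def)
    then show "\<sigma> \<in> act ` carrier G" using act\<theta>[OF \<sigma>] by (metis image_eqI)
  qed (use act(1) in auto)
  interpret field_hom \<iota> using fe by (simp add: finite_extension_def)
  have S: "subgroup S G" and cS: "card S = 2 ^ multiplicity 2 (Coset.order G)"
    using assms(5) by (auto simp: sylow_subgroup_def)
  interpret galois_2subgroup G \<iota> act S "multiplicity 2 (Coset.order G)"
  proof (intro galois_2subgroup.intro galois_action_i.intro galois_action.intro
      galois_action_axioms.intro galois_action_i_axioms.intro galois_2subgroup_axioms.intro)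
    show "group G" "field_hom \<iota>" by unfold_locales
    show "field_hom (act g)" if "g \<in> carrier G" for g using isom[OF that] by (simp add: field_isom_def)
    show "act (g \<otimes>\<^bsub>G\<^esub> h) x = act g (act h x)" if "g \<in> carrier G" "h \<in> carrier G" for g h x
      using mult[OF that] by simp
    show "inj_on act (carrier G)" using act(2) by (metis inj_onI)
    show "{x. \<forall>g\<in>carrier G. act g x = x} = range \<iota>" using fixed by (simp add: im[symmetric])
    show "\<exists>i::'k. i\<^sup>2 = - 1" using zm by blast
  qed (use assms(3) two one fe S cS in auto)
  have lag: "card (rcosets\<^bsub>G\<^esub> S) * 2 ^ multiplicity 2 (Coset.order G) = Coset.order G"
    using G.lagrange[OF S] cS by simp
  have ord: "Coset.order G \<noteq> 0" using assms(3) G.order_gt_0_iff_finite by simp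
  have odd: "odd (card (rcosets\<^bsub>G\<^esub> S))"
  proof
    assume "even (card (rcosets\<^bsub>G\<^esub> S))"
    then obtain k where "card (rcosets\<^bsub>G\<^esub> S) = 2 * k" by blast
    then have "2 ^ Suc (multiplicity 2 (Coset.order G)) dvd Coset.order G"
      using lag by (metis dvd_triv_left mult.assoc mult.commute power_Suc)
    then have "Suc (multiplicity 2 (Coset.order G)) \<le> multiplicity 2 (Coset.order G)"
      using ord by (intro multiplicity_geI) auto
    then show False by simp
  qed
  obtain ds where ds: "K.has_type UNIV ds" using K_has_type by blast
  obtain as where as: "length as = r" "K.units as"
    "wequiv UNIV ds (map ((*) (of_nat (card S))) (pf as))"
    using trace_form_Witt_class[OF odd assms(6) ds] by blast
  have e: "(of_nat (card S) :: 'k) \<noteq> 0" using two by (simp add: card_S)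
  have "witt_equivalent (trace_form \<iota>) (diag_form (map ((*) (of_nat (card S))) (pf as)))"
    using e as(2) by (intro trace_form_witt_equivalent[OF ds _ as(3)]) simp
  then have "witt_equivalent (trace_form \<iota>)
      (diag_form (diag_tensor [of_nat (card S)] (pfister (map uminus as))))"
    by (simp add: diag_tensor_single pfister_uminus)
  then show ?thesis using as(1,2) by (intro exI[of _ "map uminus as"]) (auto simp: K.units_def)
qed

end
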